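(* The category $\mathcal{ESBSE}$ of étale spaces with clopen equalizers over Boolean spaces, whose morphisms are injective étale space cohomomorphisms, is equivalent to the category $\mathcal{BLSBIA}$ of left-handed skew Boolean $\cap$-algebras whose maximal lattice images are Boolean algebras, and whose morphisms are proper skew Boolean $\cap$-algebra homomorphisms.
   Context: **Skew Boolean algebras.** A skew lattice is an algebra $(S;\wedge,\vee)$ with associative idempotent binary operations satisfying $x\wedge(x\vee y)=x=x\vee(x\wedge y)$ and $(y\vee x)\wedge x=x=(y\wedge x)\vee x$. Its natural partial order is: $x\le y$ iff $x\wedge y=y\wedge x=x$ (equivalently $x\vee y=y\vee x=y$). It is symmetric if, for all $x,y$, $x\vee y=y\vee x$ iff $x\wedge y=y\wedge x$. A zero is an element $0$ with $x\wedge 0=0\wedge x=0$ for all $x$. It is Boolean if it is symmetric, has a zero, and for every $x$ the subalgebra $\lceil x\rceil=\{u\in S:u\le x\}=x\wedge S\wedge x$ is a Boolean lattice. In that case $a\setminus b$ denotes the complement of $a\wedge b\wedge a$ in $\lceil a\rceil$. A skew Boolean algebra is an algebra $(S;\wedge,\vee,\setminus,0)$ arising from a Boolean skew lattice in this way; homomorphisms preserve $\wedge,\vee,\setminus,0$. It is left-handed if $x\wedge y\wedge x=x\wedge y$ and $x\vee y\vee x=y\vee x$ for all $x,y$. The relation $\mathcal D$ is defined by $x\,\mathcal D\,y$ iff $x\wedge y\wedge x=x$ and $y\wedge x\wedge y=y$; it is a congruence, and $S/\mathcal D$ is the maximal lattice image of $S$, which is a generalized Boolean algebra (a relatively complemented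 distributive lattice with zero). A homomorphism $f:S_1\to S_2$ induces a homomorphism $\overline f:S_1/\mathcal D\to S_2/\mathcal D$. A homomorphism $h:B_1\to B_2$ of generalized Boolean algebras is proper if for every $c\in B_2$ there is $b\in B_1$ with $h(b)\ge c$; $f$ is proper if $\overline f$ is proper. A skew Boolean algebra has finite intersections if every finite set of its elements has a greatest lower bound for $\le$; then, with $a\cap b$ denoting the greatest lower bound of $a,b$, the algebra $(S;\wedge,\vee,\setminus,\cap,0)$ is called a skew Boolean $\cap$-algebra. Homomorphisms of skew Boolean $\cap$-algebras also preserve $\cap$. **Étale spaces.** A Boolean space is a compact Hausdorff space in which the clopen sets form a base. An étale space over $X$ is a triple $(E,\pi,X)$ with $\pi:E\to X$ a surjective local homeomorphism. The stalk over $x$ is $E_x=\pi^{-1}(x)$. For open $U\subseteq X$, $E(U)$ is the set of sections over $U$, i.e. continuous maps $s:U\to E$ with $\pi s=\mathrm{id}_U$, identified with their images (subsets of $E$). An étale space $(E,\pi,X)$ over a Boolean space has clopen equalizers if for all clopen $U,V\subseteq X$ and all $A\in E(U)$, $B\in E(V)$ there is a clopen $W\subseteq X$ with $A\cap B\in E(W)$ (set-theoretic intersection of the images). Let $(\mathcal A,g,X)$, $(\mathcal B,h,Y)$ be étale spaces and $f:X\to Y$ continuous. An $f$-cohomomorphism $k:\mathcal B\rightsquigarrow\mathcal A$ is a collection of maps $k_x:\mathcal B_{f(x)}\to\mathcal A_x$, $x\in X$, such that for every open $U\subseteq Y$ and every section $s\in\mathcal B(U)$ the function $x\mapsto k_x(s(f(x)))$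 is a section of $\mathcal A$ over $f^{-1}(U)$. It is injective if all maps $k_x$ are injective. In $\mathcal{ESBSE}$ a morphism from $\mathcal B$ to $\mathcal A$ is an injective $f$-cohomomorphism $k:\mathcal B\rightsquigarrow\mathcal A$ over some continuous map $f:X\to Y$. If $k:\mathcal B\rightsquigarrow\mathcal A$ is over $f:X\to Y$ and $l:\mathcal A\rightsquigarrow\mathcal C$ is over $e:W\to X$, the composite $\mathcal B\rightsquigarrow\mathcal C$ is over $f\circ e$ and has components $l_w\circ k_{e(w)}$, $w\in W$. *)

theory Defs
  imports "HOL-Analysis.Analysis" "HOL-Library.Equipollence"
begin

text \<open>
  Hom-sets are indexed by their endpoints, so a morphism value need not determine its domain and
  codomain; identities and composition take the objects as arguments. In \<open>Comp C A B D g f\<close>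
  the morphism \<open>f\<close> goes from \<open>A\<close> to \<open>B\<close> and \<open>g\<close> from \<open>B\<close> to \<open>D\<close>.
\<close>

record ('o, 'm) category =
  Obj :: "'o set"
  Hom :: "'o \<Rightarrow> 'o \<Rightarrow> 'm set"
  Ident :: "'o \<Rightarrow> 'm"
  Comp :: "'o \<Rightarrow> 'o \<Rightarrow> 'o \<Rightarrow> 'm \<Rightarrow> 'm \<Rightarrow> 'm"

locale is_category =
  fixes C :: "('o, 'm) category"
  assumes Ident_in_Hom: "A \<in> Obj C \<Longrightarrow> Ident C A \<in> Hom C A A"
    and Comp_in_Hom:
      "\<lbrakk>A \<in> Obj C; B \<in> Obj C; D \<in> Obj C; f \<in> Hom C A B; g \<in> Hom C B D\<rbrakk>
        \<Longrightarrow> Comp C A B D g f \<in> Hom C A D"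
    and Comp_Ident_right:
      "\<lbrakk>A \<in> Obj C; B \<in> Obj C; f \<in> Hom C A B\<rbrakk> \<Longrightarrow> Comp C A A B f (Ident C A) = f"
    and Comp_Ident_left:
      "\<lbrakk>A \<in> Obj C; B \<in> Obj C; f \<in> Hom C A B\<rbrakk> \<Longrightarrow> Comp C A B B (Ident C B) f = f"
    and Comp_assoc:
      "\<lbrakk>A \<in> Obj C; B \<in> Obj C; D \<in> Obj C; E \<in> Obj C;
        f \<in> Hom C A B; g \<in> Hom C B D; h \<in> Hom C D E\<rbrakk>
        \<Longrightarrow> Comp C A D E h (Comp C A B D g f) = Comp C A B E (Comp C B D E h g) f"

definition isomorphism_in ::
    "('o, 'm, 'z) category_scheme \<Rightarrow> 'o \<Rightarrow> 'o \<Rightarrow> 'm \<Rightarrow> bool" where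
  "isomorphism_in C A B f \<longleftrightarrow>
     f \<in> Hom C A B \<and>
     (\<exists>g \<in> Hom C B A. Comp C A B A g f = Ident C A \<and> Comp C B A B f g = Ident C B)"

record ('o1, 'm1, 'o2, 'm2) cat_functor =
  onObj :: "'o1 \<Rightarrow> 'o2"
  onHom :: "'o1 \<Rightarrow> 'o1 \<Rightarrow> 'm1 \<Rightarrow> 'm2"

locale is_functor =
  fixes C :: "('o1, 'm1) category" and D :: "('o2, 'm2) category"
    and F :: "('o1, 'm1, 'o2, 'm2) cat_functor"
  assumes onObj_in_Obj: "A \<in> Obj C \<Longrightarrow> onObj F A \<in> Obj D"
    and onHom_in_Hom:
      "\<lbrakk>A \<in> Obj C; B \<in> Obj C; f \<in> Hom C A B\<rbrakk>
        \<Longrightarrow> onHom F A B f \<in> Hom D (onObj F A) (onObj F B)"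
    and onHom_Ident: "A \<in> Obj C \<Longrightarrow> onHom F A A (Ident C A) = Ident D (onObj F A)"
    and onHom_Comp:
      "\<lbrakk>A \<in> Obj C; B \<in> Obj C; E \<in> Obj C; f \<in> Hom C A B; g \<in> Hom C B E\<rbrakk>
        \<Longrightarrow> onHom F A E (Comp C A B E g f) =
            Comp D (onObj F A) (onObj F B) (onObj F E) (onHom F B E g) (onHom F A B f)"

definition id_functor :: "('o, 'm, 'o, 'm) cat_functor" where
  "id_functor = \<lparr>onObj = (\<lambda>A. A), onHom = (\<lambda>A B f. f)\<rparr>"

definition comp_functor ::
    "('o2, 'm2, 'o3, 'm3) cat_functor \<Rightarrow> ('o1, 'm1, 'o2, 'm2) cat_functor
      \<Rightarrow> ('o1, 'm1, 'o3, 'm3) cat_functor" where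
  "comp_functor G F =
     \<lparr>onObj = (\<lambda>A. onObj G (onObj F A)),
      onHom = (\<lambda>A B f. onHom G (onObj F A) (onObj F B) (onHom F A B f))\<rparr>"

definition natural_isomorphism ::
    "('o1, 'm1) category \<Rightarrow> ('o2, 'm2) category
      \<Rightarrow> ('o1, 'm1, 'o2, 'm2) cat_functor \<Rightarrow> ('o1, 'm1, 'o2, 'm2) cat_functor
      \<Rightarrow> ('o1 \<Rightarrow> 'm2) \<Rightarrow> bool" where
  "natural_isomorphism C D F G t \<longleftrightarrow>
     (\<forall>A \<in> Obj C. isomorphism_in D (onObj F A) (onObj G A) (t A)) \<and>
     (\<forall>A \<in> Obj C. \<forall>B \<in> Obj C. \<forall>f \<in> Hom C A B.
        Comp D (onObj F A) (onObj F B) (onObj G B) (t B) (onHom F A B f) =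
        Comp D (onObj F A) (onObj G A) (onObj G B) (onHom G A B f) (t A))"

definition equivalent_categories ::
    "('o1, 'm1) category \<Rightarrow> ('o2, 'm2) category \<Rightarrow> bool" where
  "equivalent_categories C D \<longleftrightarrow>
     is_category C \<and> is_category D \<and>
     (\<exists>F G t u.
        is_functor C D F \<and> is_functor D C G \<and>
        natural_isomorphism C C id_functor (comp_functor G F) t \<and>
        natural_isomorphism D D (comp_functor F G) id_functor u)"

record 'a skew_algebra =
  carrier :: "'a set"
  meet :: "'a \<Rightarrow> 'a \<Rightarrow> 'a" (infixl \<open>\<sqinter>\<index>\<close> 70)
  join :: "'a \<Rightarrow> 'a \<Rightarrow> 'a" (infixl \<open>\<squnion>\<index>\<close> 65)
  diff :: "'a \<Rightarrow> 'a \<Rightarrow> 'a"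
  cap :: "'a \<Rightarrow> 'a \<Rightarrow> 'a"
  zero :: 'a (\<open>\<zero>\<index>\<close>)

locale skew_lattice =
  fixes S :: "'a skew_algebra" (structure)
  assumes meet_closed: "\<lbrakk>x \<in> carrier S; y \<in> carrier S\<rbrakk> \<Longrightarrow> x \<sqinter> y \<in> carrier S"
    and join_closed: "\<lbrakk>x \<in> carrier S; y \<in> carrier S\<rbrakk> \<Longrightarrow> x \<squnion> y \<in> carrier S"
    and meet_assoc:
      "\<lbrakk>x \<in> carrier S; y \<in> carrier S; z \<in> carrier S\<rbrakk> \<Longrightarrow> (x \<sqinter> y) \<sqinter> z = x \<sqinter> (y \<sqinter> z)"
    and join_assoc:
      "\<lbrakk>x \<in> carrier S; y \<in> carrier S; z \<in> carrier S\<rbrakk> \<Longrightarrow> (x \<squnion> y) \<squnion> z = x \<squnion> (y \<squnion> z)"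
    and meet_idem: "x \<in> carrier S \<Longrightarrow> x \<sqinter> x = x"
    and join_idem: "x \<in> carrier S \<Longrightarrow> x \<squnion> x = x"
    and absorb1: "\<lbrakk>x \<in> carrier S; y \<in> carrier S\<rbrakk> \<Longrightarrow> x \<sqinter> (x \<squnion> y) = x"
    and absorb2: "\<lbrakk>x \<in> carrier S; y \<in> carrier S\<rbrakk> \<Longrightarrow> x \<squnion> (x \<sqinter> y) = x"
    and absorb3: "\<lbrakk>x \<in> carrier S; y \<in> carrier S\<rbrakk> \<Longrightarrow> (y \<squnion> x) \<sqinter> x = x"
    and absorb4: "\<lbrakk>x \<in> carrier S; y \<in> carrier S\<rbrakk> \<Longrightarrow> (y \<sqinter> x) \<squnion> x = x"

definition natural_le :: "'a skew_algebra \<Rightarrow> 'a \<Rightarrow> 'a \<Rightarrow> bool" where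
  "natural_le S x y \<longleftrightarrow> x \<sqinter>\<^bsub>S\<^esub> y = x \<and> y \<sqinter>\<^bsub>S\<^esub> x = x"

definition lower_set :: "'a skew_algebra \<Rightarrow> 'a \<Rightarrow> 'a set" where
  "lower_set S x = {u \<in> carrier S. natural_le S u x}"

locale boolean_lattice =
  fixes A :: "'a set" and m j :: "'a \<Rightarrow> 'a \<Rightarrow> 'a" and bot top :: 'a
  assumes closed_m: "\<lbrakk>x \<in> A; y \<in> A\<rbrakk> \<Longrightarrow> m x y \<in> A"
    and closed_j: "\<lbrakk>x \<in> A; y \<in> A\<rbrakk> \<Longrightarrow> j x y \<in> A"
    and bot_in: "bot \<in> A"
    and top_in: "top \<in> A"
    and assoc_m: "\<lbrakk>x \<in> A; y \<in> A; z \<in> A\<rbrakk> \<Longrightarrow> m (m x y) z = m x (m y z)"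
    and assoc_j: "\<lbrakk>x \<in> A; y \<in> A; z \<in> A\<rbrakk> \<Longrightarrow> j (j x y) z = j x (j y z)"
    and comm_m: "\<lbrakk>x \<in> A; y \<in> A\<rbrakk> \<Longrightarrow> m x y = m y x"
    and comm_j: "\<lbrakk>x \<in> A; y \<in> A\<rbrakk> \<Longrightarrow> j x y = j y x"
    and absorb_m: "\<lbrakk>x \<in> A; y \<in> A\<rbrakk> \<Longrightarrow> m x (j x y) = x"
    and absorb_j: "\<lbrakk>x \<in> A; y \<in> A\<rbrakk> \<Longrightarrow> j x (m x y) = x"
    and distrib: "\<lbrakk>x \<in> A; y \<in> A; z \<in> A\<rbrakk> \<Longrightarrow> m x (j y z) = j (m x y) (m x z)"
    and bot_least: "x \<in> A \<Longrightarrow> m bot x = bot"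
    and top_greatest: "x \<in> A \<Longrightarrow> m x top = x"
    and complement_ex: "x \<in> A \<Longrightarrow> \<exists>y \<in> A. m x y = bot \<and> j x y = top"

locale boolean_skew_lattice = skew_lattice +
  assumes symmetric:
      "\<lbrakk>x \<in> carrier S; y \<in> carrier S\<rbrakk> \<Longrightarrow> x \<squnion> y = y \<squnion> x \<longleftrightarrow> x \<sqinter> y = y \<sqinter> x"
    and zero_closed: "\<zero> \<in> carrier S"
    and zero_left: "x \<in> carrier S \<Longrightarrow> \<zero> \<sqinter> x = \<zero>"
    and zero_right: "x \<in> carrier S \<Longrightarrow> x \<sqinter> \<zero> = \<zero>"
    and boolean_lower_set:
      "x \<in> carrier S \<Longrightarrow> boolean_lattice (lower_set S x) (meet S) (join S) \<zero> x"

locale skew_boolean_algebra = boolean_skew_lattice +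
  assumes diff_in_lower_set:
      "\<lbrakk>a \<in> carrier S; b \<in> carrier S\<rbrakk> \<Longrightarrow> diff S a b \<in> lower_set S a"
    and diff_meet:
      "\<lbrakk>a \<in> carrier S; b \<in> carrier S\<rbrakk> \<Longrightarrow> (a \<sqinter> b \<sqinter> a) \<sqinter> diff S a b = \<zero>"
    and diff_join:
      "\<lbrakk>a \<in> carrier S; b \<in> carrier S\<rbrakk> \<Longrightarrow> (a \<sqinter> b \<sqinter> a) \<squnion> diff S a b = a"

definition is_glb :: "'a skew_algebra \<Rightarrow> 'a set \<Rightarrow> 'a \<Rightarrow> bool" where
  "is_glb S A g \<longleftrightarrow>
     g \<in> carrier S \<and> (\<forall>a \<in> A. natural_le S g a) \<and>
     (\<forall>h \<in> carrier S. (\<forall>a \<in> A. natural_le S h a) \<longrightarrow> natural_le S h g)"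

locale skew_boolean_cap_algebra = skew_boolean_algebra +
  assumes finite_intersections:
      "\<lbrakk>finite A; A \<noteq> {}; A \<subseteq> carrier S\<rbrakk> \<Longrightarrow> \<exists>g. is_glb S A g"
    and cap_is_glb: "\<lbrakk>a \<in> carrier S; b \<in> carrier S\<rbrakk> \<Longrightarrow> is_glb S {a, b} (cap S a b)"

definition left_handed :: "'a skew_algebra \<Rightarrow> bool" where
  "left_handed S \<longleftrightarrow>
     (\<forall>x \<in> carrier S. \<forall>y \<in> carrier S.
        x \<sqinter>\<^bsub>S\<^esub> y \<sqinter>\<^bsub>S\<^esub> x = x \<sqinter>\<^bsub>S\<^esub> y \<and> x \<squnion>\<^bsub>S\<^esub> y \<squnion>\<^bsub>S\<^esub> x = y \<squnion>\<^bsub>S\<^esub> x)"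

definition D_rel :: "'a skew_algebra \<Rightarrow> ('a \<times> 'a) set" where
  "D_rel S =
     {(x, y). x \<in> carrier S \<and> y \<in> carrier S \<and>
        x \<sqinter>\<^bsub>S\<^esub> y \<sqinter>\<^bsub>S\<^esub> x = x \<and> y \<sqinter>\<^bsub>S\<^esub> x \<sqinter>\<^bsub>S\<^esub> y = y}"

definition D_quot :: "'a skew_algebra \<Rightarrow> 'a set set" where
  "D_quot S = carrier S // D_rel S"

definition D_meet :: "'a skew_algebra \<Rightarrow> 'a set \<Rightarrow> 'a set \<Rightarrow> 'a set" where
  "D_meet S P Q = (\<Union>x \<in> P. \<Union>y \<in> Q. D_rel S `` {x \<sqinter>\<^bsub>S\<^esub> y})"

definition D_join :: "'a skew_algebra \<Rightarrow> 'a set \<Rightarrow> 'a set \<Rightarrow> 'a set" where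
  "D_join S P Q = (\<Union>x \<in> P. \<Union>y \<in> Q. D_rel S `` {x \<squnion>\<^bsub>S\<^esub> y})"

definition boolean_lattice_image :: "'a skew_algebra \<Rightarrow> bool" where
  "boolean_lattice_image S \<longleftrightarrow>
     (\<exists>bot top. boolean_lattice (D_quot S) (D_meet S) (D_join S) bot top)"

definition cap_homomorphism ::
    "'a skew_algebra \<Rightarrow> 'b skew_algebra \<Rightarrow> ('a \<Rightarrow> 'b) \<Rightarrow> bool" where
  "cap_homomorphism S T f \<longleftrightarrow>
     f \<in> carrier S \<rightarrow> carrier T \<and>
     (\<forall>x \<in> carrier S. \<forall>y \<in> carrier S.
        f (meet S x y) = meet T (f x) (f y) \<and>
        f (join S x y) = join T (f x) (f y) \<and>
        f (diff S x y) = diff T (f x) (f y) \<and>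
        f (cap S x y) = cap T (f x) (f y)) \<and>
     f (zero S) = zero T"

definition induced_hom ::
    "'b skew_algebra \<Rightarrow> ('a \<Rightarrow> 'b) \<Rightarrow> 'a set \<Rightarrow> 'b set" where
  "induced_hom T f P = D_rel T `` (f ` P)"

text \<open>The condition \<open>D_meet T c d = c\<close> expresses \<open>c \<le> d\<close> in the lattice \<open>T/\<D>\<close>.\<close>

definition proper_hom ::
    "'a skew_algebra \<Rightarrow> 'b skew_algebra \<Rightarrow> ('a \<Rightarrow> 'b) \<Rightarrow> bool" where
  "proper_hom S T f \<longleftrightarrow>
     (\<forall>c \<in> D_quot T. \<exists>b \<in> D_quot S. D_meet T c (induced_hom T f b) = c)"

record ('e, 'x) etale =
  total :: "'e topology"
  base :: "'x topology"
  proj :: "'e \<Rightarrow> 'x"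

definition open_base :: "'a topology \<Rightarrow> 'a set set \<Rightarrow> bool" where
  "open_base X \<B> \<longleftrightarrow>
     (\<forall>B \<in> \<B>. openin X B) \<and>
     (\<forall>U x. openin X U \<and> x \<in> U \<longrightarrow> (\<exists>B \<in> \<B>. x \<in> B \<and> B \<subseteq> U))"

definition clopenin :: "'a topology \<Rightarrow> 'a set \<Rightarrow> bool" where
  "clopenin X U \<longleftrightarrow> openin X U \<and> closedin X U"

definition boolean_space :: "'a topology \<Rightarrow> bool" where
  "boolean_space X \<longleftrightarrow>
     compact_space X \<and> Hausdorff_space X \<and> open_base X {U. clopenin X U}"

definition local_homeomorphism :: "'e topology \<Rightarrow> 'x topology \<Rightarrow> ('e \<Rightarrow> 'x) \<Rightarrow> bool" where
  "local_homeomorphism E X p \<longleftrightarrow>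
     p \<in> topspace E \<rightarrow> topspace X \<and>
     (\<forall>e \<in> topspace E. \<exists>V. openin E V \<and> e \<in> V \<and> openin X (p ` V) \<and>
        homeomorphic_map (subtopology E V) (subtopology X (p ` V)) p)"

definition etale_space :: "('e, 'x) etale \<Rightarrow> bool" where
  "etale_space A \<longleftrightarrow>
     local_homeomorphism (total A) (base A) (proj A) \<and>
     proj A ` topspace (total A) = topspace (base A)"

definition stalk :: "('e, 'x) etale \<Rightarrow> 'x \<Rightarrow> 'e set" where
  "stalk A x = {e \<in> topspace (total A). proj A e = x}"

definition section_over :: "('e, 'x) etale \<Rightarrow> 'x set \<Rightarrow> ('x \<Rightarrow> 'e) \<Rightarrow> bool" where
  "section_over A U s \<longleftrightarrow>
     continuous_map (subtopology (base A) U) (total A) s \<and> (\<forall>x \<in> U. proj A (s x) = x)"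

definition section_images :: "('e, 'x) etale \<Rightarrow> 'x set \<Rightarrow> 'e set set" where
  "section_images A U = {s ` U | s. section_over A U s}"

definition clopen_equalizers :: "('e, 'x) etale \<Rightarrow> bool" where
  "clopen_equalizers A \<longleftrightarrow>
     (\<forall>U V. clopenin (base A) U \<longrightarrow> clopenin (base A) V \<longrightarrow>
        (\<forall>P \<in> section_images A U. \<forall>Q \<in> section_images A V.
           \<exists>W. clopenin (base A) W \<and> P \<inter> Q \<in> section_images A W))"

text \<open>
  \<open>cohomomorphism B A f k\<close> says that \<open>k\<close> is an \<open>f\<close>-cohomomorphism from \<open>B\<close> to \<open>A\<close>; the continuous
  map \<open>f\<close> of base spaces goes in the opposite direction, from \<open>base A\<close> to \<open>base B\<close>.
\<close>

definition cohomomorphism ::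
    "('e, 'y) etale \<Rightarrow> ('d, 'x) etale \<Rightarrow> ('x \<Rightarrow> 'y) \<Rightarrow> ('x \<Rightarrow> 'e \<Rightarrow> 'd) \<Rightarrow> bool" where
  "cohomomorphism B A f k \<longleftrightarrow>
     continuous_map (base A) (base B) f \<and>
     (\<forall>x \<in> topspace (base A). k x \<in> stalk B (f x) \<rightarrow> stalk A x) \<and>
     (\<forall>U s. openin (base B) U \<and> section_over B U s \<longrightarrow>
        section_over A {x \<in> topspace (base A). f x \<in> U} (\<lambda>x. k x (s (f x))))"

definition injective_cohomomorphism ::
    "('e, 'y) etale \<Rightarrow> ('d, 'x) etale \<Rightarrow> ('x \<Rightarrow> 'y) \<Rightarrow> ('x \<Rightarrow> 'e \<Rightarrow> 'd) \<Rightarrow> bool" where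
  "injective_cohomomorphism B A f k \<longleftrightarrow>
     cohomomorphism B A f k \<and> (\<forall>x \<in> topspace (base A). inj_on (k x) (stalk B (f x)))"

text \<open>
  There is no type of all sets, so the objects of both categories are taken small relative to an
  arbitrary infinite type \<open>'u\<close> acting as universe: a set is small if its cardinality is strictly
  below that of \<open>'u\<close>. Algebras are small as sets. Etale spaces are small in the sense that the
  total space has a small base of open sets (then so has the base space); their points are drawn
  from \<open>'u set\<close>, which is large enough up to isomorphism, since a \<open>T0\<close> space with a base \<open>\<B>\<close> has
  at most as many points as \<open>\<B>\<close> has subsets. If the cardinality of \<open>'u\<close> is a strong limit (as for a
  Grothendieck universe), this is the same, up to isomorphism, as having small sets of points; in
  general the number of points cannot be bounded by the cardinality of the algebra of sections.
  Every algebra and every etale space on any types is, up to isomorphism, an object for some \<open>'u\<close>,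
  and all morphisms between objects are included.

  Morphisms are made extensional, i.e. undefined outside their proper domains, so that equality of
  values is equality of morphisms.
\<close>

definition small :: "'u itself \<Rightarrow> 'b set \<Rightarrow> bool" where
  "small TYPE('u) A \<longleftrightarrow> A \<prec> (UNIV :: 'u set)"

definition BLSBIA :: "('u skew_algebra, 'u \<Rightarrow> 'u) category" where
  "BLSBIA =
     \<lparr>Obj = {S. skew_boolean_cap_algebra S \<and> left_handed S \<and> boolean_lattice_image S \<and>
               small TYPE('u) (carrier S)},
      Hom = (\<lambda>S T. {f \<in> extensional (carrier S). cap_homomorphism S T f \<and> proper_hom S T f}),
      Ident = (\<lambda>S. restrict (\<lambda>x. x) (carrier S)),
      Comp = (\<lambda>S T R g f. compose (carrier S) g f)\<rparr>"

type_synonym ('e, 'x) etale_mor = "('x \<Rightarrow> 'x) \<times> ('x \<Rightarrow> 'e \<Rightarrow> 'e)"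

definition ESBSE :: "(('u set, 'u set) etale, ('u set, 'u set) etale_mor) category" where
  "ESBSE =
     \<lparr>Obj = {A. etale_space A \<and> boolean_space (base A) \<and> clopen_equalizers A \<and>
               (\<exists>\<B>. open_base (total A) \<B> \<and> small TYPE('u) \<B>)},
      Hom = (\<lambda>B A. {(f, k). injective_cohomomorphism B A f k \<and>
               f \<in> extensional (topspace (base A)) \<and>
               k \<in> extensional (topspace (base A)) \<and>
               (\<forall>x \<in> topspace (base A). k x \<in> extensional (stalk B (f x)))}),
      Ident = (\<lambda>A. (restrict (\<lambda>x. x) (topspace (base A)),
                   restrict (\<lambda>x. restrict (\<lambda>e. e) (stalk A x)) (topspace (base A)))),
      Comp = (\<lambda>B A C (e, l) (f, k).
                (compose (topspace (base C)) f e,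
                 restrict (\<lambda>w. compose (stalk B (f (e w))) (l w) (k (e w)))
                   (topspace (base C))))\<rparr>"

end

theory Submission
  imports Defs
begin

text \<open>
  The functor sends an etale space to its algebra of sections over clopen sets, with \<open>s \<sqinter> t\<close> the
  restriction of \<open>s\<close> to the domain of \<open>t\<close>, \<open>s \<squnion> t\<close> the section that extends \<open>t\<close> by \<open>s\<close>, and
  \<open>s \<inter> t\<close> the restriction to the locus of agreement, which is clopen by the equalizer condition. It is
  faithful because every germ lies on a clopen section. It is full because a homomorphism determines
  the base map by Stone duality and then the maps on stalks by evaluating sections; preservation of
  \<open>\<inter>\<close> makes these maps well defined and injective. It is essentially surjective because an algebra
  \<open>S\<close> is represented on the etale space whose base points are the prime filters \<open>F\<close> of \<open>S/\<D>\<close> and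
  whose points over \<open>F\<close> are the classes of elements of \<open>F\<close>, two elements being identified when their
  intersection lies in \<open>F\<close>. The space is small: a section over a clopen set has a compact open image,
  hence one that is a finite union of basic open sets.
\<close>

section \<open>Equivalences from fully faithful, essentially surjective functors\<close>

text \<open>The spectrum is not made into a functor: that would require carrying germs along
  preimages of filters. Choice supplies an inverse functor once every algebra is known to be
  isomorphic to some algebra of sections. The quotient \<open>S/\<D>\<close> is kept out of the
  computations. Left-handedness turns its order into the equation \<open>x \<sqinter> y = x\<close>,
  which for sections says that one domain contains the other, so ideals, prime filters and
  properness are all handled on elements. The obstacle in representing an algebra is gluing: a join
  lies above its right argument only, so joining finitely many elements may destroy the left ones.
  Elements that agree on their overlap have commuting meets, hence by symmetry commuting joins, and
  then nothing is lost. Compactness reduces every gluing to a finite one; it holds for the spectrum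
  because the lattice image has a top. Partial maps do not live on the type \<open>'u\<close> of the
  algebras, so an algebra of sections is transported along an injection, which exists by
  smallness.\<close>

locale fully_faithful_ess_surj = is_functor C D F + C: is_category C + D: is_category D
  for C :: "('o1, 'm1) category" and D :: "('o2, 'm2) category" and F +
  assumes faithful: "\<lbrakk>A \<in> Obj C; B \<in> Obj C; f \<in> Hom C A B; g \<in> Hom C A B;
        onHom F A B f = onHom F A B g\<rbrakk> \<Longrightarrow> f = g"
    and full: "\<lbrakk>A \<in> Obj C; B \<in> Obj C; h \<in> Hom D (onObj F A) (onObj F B)\<rbrakk>
        \<Longrightarrow> \<exists>f \<in> Hom C A B. onHom F A B f = h"
    and ess_surj: "X \<in> Obj D \<Longrightarrow> \<exists>A \<in> Obj C. \<exists>u. isomorphism_in D (onObj F A) X u"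
begin

definition G_obj where "G_obj X = (SOME A. A \<in> Obj C \<and> (\<exists>u. isomorphism_in D (onObj F A) X u))"

definition counit where "counit X = (SOME u. isomorphism_in D (onObj F (G_obj X)) X u)"

definition counit_inv where
  "counit_inv X = (SOME v. v \<in> Hom D X (onObj F (G_obj X)) \<and>
     Comp D (onObj F (G_obj X)) X (onObj F (G_obj X)) v (counit X) = Ident D (onObj F (G_obj X)) \<and>
     Comp D X (onObj F (G_obj X)) X (counit X) v = Ident D X)"

definition lift where "lift A B h = (SOME f. f \<in> Hom C A B \<and> onHom F A B f = h)"

text \<open>Conjugation by the chosen isomorphisms turns \<open>g\<close> into a morphism between
  objects in the image of \<open>F\<close>, and fullness lifts it. This is the action that makes
  \<open>counit\<close> natural.\<close>

definition G where
  "G = \<lparr>onObj = G_obj, onHom = (\<lambda>X Y g. lift (G_obj X) (G_obj Y)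
     (Comp D (onObj F (G_obj X)) X (onObj F (G_obj Y))
        (Comp D X Y (onObj F (G_obj Y)) (counit_inv Y) g) (counit X)))\<rparr>"

lemma G_obj:
  assumes "X \<in> Obj D"
  shows "G_obj X \<in> Obj C" "onObj F (G_obj X) \<in> Obj D"
    and isomorphism_counit: "isomorphism_in D (onObj F (G_obj X)) X (counit X)"
proof -
  have *: "G_obj X \<in> Obj C \<and> (\<exists>u. isomorphism_in D (onObj F (G_obj X)) X u)"
    unfolding G_obj_def by (rule someI_ex) (use ess_surj[OF assms] in blast)
  then show "G_obj X \<in> Obj C" "onObj F (G_obj X) \<in> Obj D"
    by (auto intro: onObj_in_Obj)
  show "isomorphism_in D (onObj F (G_obj X)) X (counit X)"
    unfolding counit_def by (rule someI_ex) (use * in blast)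
qed

lemma counit:
  assumes "X \<in> Obj D"
  shows counit_in_Hom: "counit X \<in> Hom D (onObj F (G_obj X)) X"
    and counit_inv_in_Hom: "counit_inv X \<in> Hom D X (onObj F (G_obj X))"
    and counit_inv_counit:
      "Comp D (onObj F (G_obj X)) X (onObj F (G_obj X)) (counit_inv X) (counit X)
        = Ident D (onObj F (G_obj X))"
    and counit_counit_inv: "Comp D X (onObj F (G_obj X)) X (counit X) (counit_inv X) = Ident D X"
proof -
  have "\<exists>v. v \<in> Hom D X (onObj F (G_obj X)) \<and>
     Comp D (onObj F (G_obj X)) X (onObj F (G_obj X)) v (counit X) = Ident D (onObj F (G_obj X)) \<and>
     Comp D X (onObj F (G_obj X)) X (counit X) v = Ident D X"
    using isomorphism_counit[OF assms] unfolding isomorphism_in_def by blast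
  from someI_ex[OF this, folded counit_inv_def] isomorphism_counit[OF assms]
  show "counit X \<in> Hom D (onObj F (G_obj X)) X"
    "counit_inv X \<in> Hom D X (onObj F (G_obj X))"
    "Comp D (onObj F (G_obj X)) X (onObj F (G_obj X)) (counit_inv X) (counit X)
        = Ident D (onObj F (G_obj X))"
    "Comp D X (onObj F (G_obj X)) X (counit X) (counit_inv X) = Ident D X"
    by (auto simp: isomorphism_in_def)
qed

lemma lift:
  assumes "A \<in> Obj C" "B \<in> Obj C" "h \<in> Hom D (onObj F A) (onObj F B)"
  shows "lift A B h \<in> Hom C A B" "onHom F A B (lift A B h) = h"
proof -
  have "lift A B h \<in> Hom C A B \<and> onHom F A B (lift A B h) = h"
    unfolding lift_def by (rule someI_ex) (use full[OF assms] in blast)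
  then show "lift A B h \<in> Hom C A B" "onHom F A B (lift A B h) = h" by auto
qed

lemmas obj_intros = G_obj(1,2) onObj_in_Obj
lemmas hom_intros = onHom_in_Hom counit_in_Hom counit_inv_in_Hom D.Comp_in_Hom C.Comp_in_Hom
  C.Ident_in_Hom D.Ident_in_Hom

lemma
  assumes "X \<in> Obj D" "Y \<in> Obj D" "g \<in> Hom D X Y"
  shows G_in_Hom: "onHom G X Y g \<in> Hom C (G_obj X) (G_obj Y)"
    and F_G: "onHom F (G_obj X) (G_obj Y) (onHom G X Y g) =
      Comp D (onObj F (G_obj X)) X (onObj F (G_obj Y))
        (Comp D X Y (onObj F (G_obj Y)) (counit_inv Y) g) (counit X)"
proof -
  have "Comp D (onObj F (G_obj X)) X (onObj F (G_obj Y))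
        (Comp D X Y (onObj F (G_obj Y)) (counit_inv Y) g) (counit X)
      \<in> Hom D (onObj F (G_obj X)) (onObj F (G_obj Y))"
    using assms by (intro hom_intros obj_intros)
  from lift[OF G_obj(1)[OF assms(1)] G_obj(1)[OF assms(2)] this]
  show "onHom G X Y g \<in> Hom C (G_obj X) (G_obj Y)"
    "onHom F (G_obj X) (G_obj Y) (onHom G X Y g) =
      Comp D (onObj F (G_obj X)) X (onObj F (G_obj Y))
        (Comp D X Y (onObj F (G_obj Y)) (counit_inv Y) g) (counit X)"
    by (simp_all add: G_def)
qed

text \<open>The factor \<open>counit_inv Y\<close> in \<open>F_G\<close> cancels against
  \<open>counit Y\<close>. Preservation of composites by \<open>G\<close> is derived from this
  square instead of the explicit formula.\<close>

lemma counit_natural: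
  assumes "X \<in> Obj D" "Y \<in> Obj D" "g \<in> Hom D X Y"
  shows "Comp D (onObj F (G_obj X)) (onObj F (G_obj Y)) Y (counit Y)
      (onHom F (G_obj X) (G_obj Y) (onHom G X Y g))
    = Comp D (onObj F (G_obj X)) X Y g (counit X)"
proof -
  let ?X = "onObj F (G_obj X)" and ?Y = "onObj F (G_obj Y)"
  have ob: "?X \<in> Obj D" "?Y \<in> Obj D" using assms by (auto intro: obj_intros)
  note h = counit_in_Hom[OF assms(1)] counit_in_Hom[OF assms(2)] counit_inv_in_Hom[OF assms(2)]
  have v: "Comp D X Y ?Y (counit_inv Y) g \<in> Hom D X ?Y"
    using assms ob h by (intro D.Comp_in_Hom)
  have "Comp D ?X ?Y Y (counit Y) (Comp D ?X X ?Y (Comp D X Y ?Y (counit_inv Y) g) (counit X))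
      = Comp D ?X X Y (Comp D X ?Y Y (counit Y) (Comp D X Y ?Y (counit_inv Y) g)) (counit X)"
    using D.Comp_assoc[OF ob(1) assms(1) ob(2) assms(2) h(1) v h(2)] .
  also have "Comp D X ?Y Y (counit Y) (Comp D X Y ?Y (counit_inv Y) g)
      = Comp D X Y Y (Comp D Y ?Y Y (counit Y) (counit_inv Y)) g"
    using D.Comp_assoc[OF assms(1,2) ob(2) assms(2,3) h(3,2)] .
  also have "\<dots> = g"
    using assms by (simp add: counit_counit_inv D.Comp_Ident_left)
  finally show ?thesis using assms by (simp add: F_G)
qed

text \<open>\<open>counit X\<close> is a split monomorphism with retraction
  \<open>counit_inv X\<close>.\<close>

lemma counit_cancel:
  assumes "X \<in> Obj D" "Z \<in> Obj D" "f \<in> Hom D Z (onObj F (G_obj X))"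
    "g \<in> Hom D Z (onObj F (G_obj X))"
    "Comp D Z (onObj F (G_obj X)) X (counit X) f = Comp D Z (onObj F (G_obj X)) X (counit X) g"
  shows "f = g"
proof -
  let ?X = "onObj F (G_obj X)"
  have ob: "?X \<in> Obj D" using assms by (auto intro: obj_intros)
  have eq: "Comp D Z X ?X (counit_inv X) (Comp D Z ?X X (counit X) k) = k"
    if k: "k \<in> Hom D Z ?X" for k
    unfolding D.Comp_assoc[OF assms(2) ob assms(1) ob k counit_in_Hom[OF assms(1)]
        counit_inv_in_Hom[OF assms(1)]] counit_inv_counit[OF assms(1)]
    by (rule D.Comp_Ident_left[OF assms(2) ob k])
  show ?thesis using eq[OF assms(3)] eq[OF assms(4)] unfolding assms(5) by (rule trans[OF sym])
qed

text \<open>Faithfulness allows both equations to be tested after applying \<open>F\<close>. For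
  composites the test is pushed one step further, along \<open>counit\<close>, where naturality
  brings both sides to the same morphism.\<close>

lemma functor_G: "is_functor D C G"
proof
  fix X assume X: "X \<in> Obj D"
  then show "onObj G X \<in> Obj C" by (simp add: G_def obj_intros)
  let ?X = "onObj F (G_obj X)"
  have "onHom F (G_obj X) (G_obj X) (onHom G X X (Ident D X)) = Ident D ?X"
    using X by (simp add: F_G hom_intros obj_intros D.Comp_Ident_right counit_inv_counit)
  also have "\<dots> = onHom F (G_obj X) (G_obj X) (Ident C (G_obj X))"
    using X by (simp add: onHom_Ident obj_intros)
  finally have "onHom G X X (Ident D X) = Ident C (G_obj X)"
    by (rule faithful[rotated -1]) (use X in \<open>auto intro: obj_intros hom_intros G_in_Hom\<close>)
  then show "onHom G X X (Ident D X) = Ident C (onObj G X)" by (simp add: G_def)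
next
  fix X Y g assume "X \<in> Obj D" "Y \<in> Obj D" "g \<in> Hom D X Y"
  from G_in_Hom[OF this] show "onHom G X Y g \<in> Hom C (onObj G X) (onObj G Y)"
    by (simp add: G_def)
next
  fix X Y Z f g
  assume ob: "X \<in> Obj D" "Y \<in> Obj D" "Z \<in> Obj D" and f: "f \<in> Hom D X Y" and g: "g \<in> Hom D Y Z"
  let ?X = "onObj F (G_obj X)" and ?Y = "onObj F (G_obj Y)" and ?Z = "onObj F (G_obj Z)"
  let ?f = "onHom F (G_obj X) (G_obj Y) (onHom G X Y f)"
  let ?g = "onHom F (G_obj Y) (G_obj Z) (onHom G Y Z g)"
  have ob': "?X \<in> Obj D" "?Y \<in> Obj D" "?Z \<in> Obj D" "G_obj X \<in> Obj C" "G_obj Y \<in> Obj C" "G_obj Z \<in> Obj C"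
    using ob by (auto intro: obj_intros)
  have gf: "Comp D X Y Z g f \<in> Hom D X Z" using ob f g by (intro D.Comp_in_Hom)
  have f': "?f \<in> Hom D ?X ?Y" and g': "?g \<in> Hom D ?Y ?Z"
    using ob ob' f g by (auto intro: onHom_in_Hom G_in_Hom)
  have "onHom F (G_obj X) (G_obj Z) (onHom G X Z (Comp D X Y Z g f)) = Comp D ?X ?Y ?Z ?g ?f"
  proof (rule counit_cancel[OF ob(3) ob'(1)])
    have "Comp D ?X ?Z Z (counit Z) (Comp D ?X ?Y ?Z ?g ?f)
        = Comp D ?X ?Y Z (Comp D ?Y ?Z Z (counit Z) ?g) ?f"
      by (rule D.Comp_assoc[OF ob'(1-3) ob(3) f' g' counit_in_Hom[OF ob(3)]])
    also have "\<dots> = Comp D ?X ?Y Z (Comp D ?Y Y Z g (counit Y)) ?f"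
      using ob g by (simp add: counit_natural)
    also have "\<dots> = Comp D ?X Y Z g (Comp D ?X ?Y Y (counit Y) ?f)"
      by (rule D.Comp_assoc[OF ob'(1,2) ob(2,3) f' counit_in_Hom[OF ob(2)] g, symmetric])
    also have "\<dots> = Comp D ?X Y Z g (Comp D ?X X Y f (counit X))"
      using ob f by (simp add: counit_natural)
    also have "\<dots> = Comp D ?X X Z (Comp D X Y Z g f) (counit X)"
      by (rule D.Comp_assoc[OF ob'(1) ob counit_in_Hom[OF ob(1)] f g])
    also have "\<dots> = Comp D ?X ?Z Z (counit Z)
        (onHom F (G_obj X) (G_obj Z) (onHom G X Z (Comp D X Y Z g f)))"
      using ob gf by (simp add: counit_natural)
    finally show "Comp D ?X ?Z Z (counit Z)
        (onHom F (G_obj X) (G_obj Z) (onHom G X Z (Comp D X Y Z g f)))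
      = Comp D ?X ?Z Z (counit Z) (Comp D ?X ?Y ?Z ?g ?f)" by simp
  qed (use ob ob' f g f' g' gf in \<open>auto intro: onHom_in_Hom G_in_Hom D.Comp_in_Hom\<close>)
  also have "\<dots> = onHom F (G_obj X) (G_obj Z)
      (Comp C (G_obj X) (G_obj Y) (G_obj Z) (onHom G Y Z g) (onHom G X Y f))"
    using ob ob' f g by (simp add: onHom_Comp G_in_Hom)
  finally have "onHom G X Z (Comp D X Y Z g f)
      = Comp C (G_obj X) (G_obj Y) (G_obj Z) (onHom G Y Z g) (onHom G X Y f)"
    by (rule faithful[rotated -1])
      (use ob ob' f g gf in \<open>auto intro: C.Comp_in_Hom G_in_Hom\<close>)
  then show "onHom G X Z (Comp D X Y Z g f) = Comp C (onObj G X) (onObj G Y) (onObj G Z)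
      (onHom G Y Z g) (onHom G X Y f)" by (simp add: G_def)
qed

text \<open>The lift of the inverse of the counit at \<open>F A\<close>, so that one triangle
  identity of an adjoint equivalence holds by construction.\<close>

definition unit where "unit A = lift A (G_obj (onObj F A)) (counit_inv (onObj F A))"

lemma unit:
  assumes "A \<in> Obj C"
  shows unit_in_Hom: "unit A \<in> Hom C A (G_obj (onObj F A))"
    and F_unit: "onHom F A (G_obj (onObj F A)) (unit A) = counit_inv (onObj F A)"
  using lift[OF assms, of "G_obj (onObj F A)" "counit_inv (onObj F A)"] assms
  unfolding unit_def by (auto intro: obj_intros hom_intros)

text \<open>A fully faithful functor reflects isomorphisms: the inverse is the lift of
  \<open>counit (onObj F A)\<close>.\<close>

lemma isomorphism_unit:
  assumes A: "A \<in> Obj C"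
  shows "isomorphism_in C A (G_obj (onObj F A)) (unit A)"
proof -
  let ?B = "G_obj (onObj F A)"
  let ?v = "lift ?B A (counit (onObj F A))"
  have FA: "onObj F A \<in> Obj D" and B: "?B \<in> Obj C"
    using A by (auto intro: obj_intros)
  have v: "?v \<in> Hom C ?B A" "onHom F ?B A ?v = counit (onObj F A)"
    using lift[OF B A counit_in_Hom[OF FA]] by auto
  have "Comp C A ?B A ?v (unit A) = Ident C A"
    by (rule faithful[OF A A])
      (use A B v FA in \<open>auto simp: onHom_Comp onHom_Ident unit_in_Hom F_unit counit_counit_inv
        intro: C.Comp_in_Hom C.Ident_in_Hom\<close>)
  moreover have "Comp C ?B A ?B (unit A) ?v = Ident C ?B"
    by (rule faithful[OF B B])
      (use A B v FA in \<open>auto simp: onHom_Comp onHom_Ident unit_in_Hom F_unit counit_inv_counit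
        intro: C.Comp_in_Hom C.Ident_in_Hom\<close>)
  ultimately show ?thesis using A v unfolding isomorphism_in_def by (auto intro: unit_in_Hom)
qed

lemma unit_natural:
  assumes A: "A \<in> Obj C" and B: "B \<in> Obj C" and f: "f \<in> Hom C A B"
  shows "Comp C A B (G_obj (onObj F B)) (unit B) f
    = Comp C A (G_obj (onObj F A)) (G_obj (onObj F B))
        (onHom G (onObj F A) (onObj F B) (onHom F A B f)) (unit A)"
proof -
  let ?A = "onObj F A" and ?B = "onObj F B"
  let ?GA = "G_obj ?A" and ?GB = "G_obj ?B"
  have ob: "?A \<in> Obj D" "?B \<in> Obj D" "?GA \<in> Obj C" "?GB \<in> Obj C"
      "onObj F ?GA \<in> Obj D" "onObj F ?GB \<in> Obj D"
    using A B by (auto intro: obj_intros)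
  have f': "onHom F A B f \<in> Hom D ?A ?B" using A B f by (rule onHom_in_Hom)
  have Gf: "onHom G ?A ?B (onHom F A B f) \<in> Hom C ?GA ?GB"
    using ob f' by (intro G_in_Hom)
  note vf = D.Comp_in_Hom[OF ob(1,2,6) f' counit_inv_in_Hom[OF ob(2)]]
  have "onHom F A ?GB (Comp C A ?GA ?GB (onHom G ?A ?B (onHom F A B f)) (unit A))
      = Comp D ?A (onObj F ?GA) (onObj F ?GB)
          (Comp D (onObj F ?GA) ?A (onObj F ?GB)
            (Comp D ?A ?B (onObj F ?GB) (counit_inv ?B) (onHom F A B f)) (counit ?A))
          (counit_inv ?A)"
    using A ob f' Gf by (simp add: onHom_Comp unit_in_Hom F_unit F_G)
  also have "\<dots> = Comp D ?A ?A (onObj F ?GB)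
            (Comp D ?A ?B (onObj F ?GB) (counit_inv ?B) (onHom F A B f))
            (Comp D ?A (onObj F ?GA) ?A (counit ?A) (counit_inv ?A))"
    by (rule D.Comp_assoc[OF ob(1,5,1,6) counit_inv_in_Hom[OF ob(1)] counit_in_Hom[OF ob(1)] vf,
        symmetric])
  also have "\<dots> = Comp D ?A ?B (onObj F ?GB) (counit_inv ?B) (onHom F A B f)"
    using ob vf by (simp add: counit_counit_inv D.Comp_Ident_right)
  also have "\<dots> = onHom F A ?GB (Comp C A B ?GB (unit B) f)"
    using A B ob f by (simp add: onHom_Comp unit_in_Hom F_unit)
  finally show ?thesis
    by (rule faithful[rotated -1, symmetric])
      (use A B ob f Gf in \<open>auto intro: C.Comp_in_Hom unit_in_Hom\<close>)
qed

theorem equivalent: "equivalent_categories C D"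
  unfolding equivalent_categories_def
proof (intro conjI exI)
  show "is_category C" "is_category D" "is_functor C D F" "is_functor D C G"
    by (fact C.is_category_axioms D.is_category_axioms is_functor_axioms functor_G)+
  show "natural_isomorphism C C id_functor (comp_functor G F) unit"
    unfolding natural_isomorphism_def
    by (auto simp: id_functor_def comp_functor_def G_def intro: isomorphism_unit)
      (use unit_natural in \<open>simp add: G_def\<close>)
  show "natural_isomorphism D D (comp_functor F G) id_functor counit"
    unfolding natural_isomorphism_def
    by (auto simp: id_functor_def comp_functor_def G_def intro: isomorphism_counit)
      (use counit_natural in \<open>simp add: G_def\<close>)
qed

end

section \<open>Left-handed skew lattices\<close>

text \<open>In the left-handed case this is the preorder that the order of \<open>S/\<D>\<close> induces on \<open>S\<close>.\<close>

definition pre_le :: "'a skew_algebra \<Rightarrow> 'a \<Rightarrow> 'a \<Rightarrow> bool" where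
  "pre_le S x y \<longleftrightarrow> x \<sqinter>\<^bsub>S\<^esub> y = x"

locale left_handed_skew_lattice = skew_lattice +
  assumes left_handed: "left_handed S"
begin

lemma left_handed_meet: "\<lbrakk>x \<in> carrier S; y \<in> carrier S\<rbrakk> \<Longrightarrow> x \<sqinter> y \<sqinter> x = x \<sqinter> y"
  and left_handed_join: "\<lbrakk>x \<in> carrier S; y \<in> carrier S\<rbrakk> \<Longrightarrow> x \<squnion> y \<squnion> x = y \<squnion> x"
  using left_handed by (auto simp: left_handed_def)

lemma meet_left_idem:
  assumes "x \<in> carrier S" "y \<in> carrier S" shows "x \<sqinter> (x \<sqinter> y) = x \<sqinter> y"
  using assms meet_assoc[of x x y] by (simp add: meet_idem)

lemma pre_le_iff_join:
  assumes "x \<in> carrier S" "y \<in> carrier S"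
  shows "pre_le S x y \<longleftrightarrow> x \<squnion> y = y"
  using assms absorb4[of y x] absorb1[of x y] by (auto simp: pre_le_def)

lemma pre_le_refl: "x \<in> carrier S \<Longrightarrow> pre_le S x x"
  by (simp add: pre_le_def meet_idem)

lemma pre_le_trans:
  assumes "x \<in> carrier S" "y \<in> carrier S" "z \<in> carrier S" "pre_le S x y" "pre_le S y z"
  shows "pre_le S x z"
  using assms meet_assoc[of x y z] by (simp add: pre_le_def)

lemma meet_pre_le1: "\<lbrakk>x \<in> carrier S; y \<in> carrier S\<rbrakk> \<Longrightarrow> pre_le S (x \<sqinter> y) x"
  by (simp add: pre_le_def left_handed_meet)

lemma meet_pre_le2: "\<lbrakk>x \<in> carrier S; y \<in> carrier S\<rbrakk> \<Longrightarrow> pre_le S (x \<sqinter> y) y"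
  by (simp add: pre_le_def meet_assoc meet_idem)

lemma pre_le_meet:
  assumes "x \<in> carrier S" "y \<in> carrier S" "z \<in> carrier S" "pre_le S z x" "pre_le S z y"
  shows "pre_le S z (x \<sqinter> y)"
  using assms meet_assoc[of z x y] by (simp add: pre_le_def)

lemma join_pre_le1: "\<lbrakk>x \<in> carrier S; y \<in> carrier S\<rbrakk> \<Longrightarrow> pre_le S x (x \<squnion> y)"
  by (simp add: pre_le_def absorb1)

lemma join_pre_le2: "\<lbrakk>x \<in> carrier S; y \<in> carrier S\<rbrakk> \<Longrightarrow> pre_le S y (x \<squnion> y)"
  by (simp add: pre_le_iff_join join_closed left_handed_join flip: join_assoc)

lemma join_pre_le:
  assumes "x \<in> carrier S" "y \<in> carrier S" "z \<in> carrier S" "pre_le S x z" "pre_le S y z"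
  shows "pre_le S (x \<squnion> y) z"
  using assms by (simp add: pre_le_iff_join join_closed join_assoc)

lemma D_rel_iff:
  "(x, y) \<in> D_rel S \<longleftrightarrow> x \<in> carrier S \<and> y \<in> carrier S \<and> pre_le S x y \<and> pre_le S y x"
  by (auto simp: D_rel_def pre_le_def left_handed_meet meet_idem)

lemma equiv_D_rel: "equiv (carrier S) (D_rel S)"
proof (rule equivI)
  show "D_rel S \<subseteq> carrier S \<times> carrier S" "refl_on (carrier S) (D_rel S)" "sym (D_rel S)"
    by (auto simp: refl_on_def sym_def D_rel_iff pre_le_refl)
  show "trans (D_rel S)"
    unfolding trans_def D_rel_iff by (metis pre_le_trans)
qed

abbreviation D_class where "D_class x \<equiv> D_rel S `` {x}"

lemma D_class_eq_iff:
  "\<lbrakk>x \<in> carrier S; y \<in> carrier S\<rbrakk> \<Longrightarrow> D_class x = D_class y \<longleftrightarrow> pre_le S x y \<and> pre_le S y x"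
  using eq_equiv_class_iff[OF equiv_D_rel, of x y] by (simp add: D_rel_iff)

lemma D_quot_eq: "D_quot S = D_class ` carrier S"
  by (auto simp: D_quot_def quotient_def)

lemma D_rel_meet:
  assumes "(x, x') \<in> D_rel S" "(y, y') \<in> D_rel S"
  shows "(x \<sqinter> y, x' \<sqinter> y') \<in> D_rel S"
proof -
  have "pre_le S (x \<sqinter> y) (x' \<sqinter> y')" if "(x, x') \<in> D_rel S" "(y, y') \<in> D_rel S" for x x' y y'
    using that unfolding D_rel_iff
    by (metis meet_closed meet_pre_le1 meet_pre_le2 pre_le_meet pre_le_trans)
  from this[OF assms] this[of x' x y' y] assms show ?thesis
    by (auto simp: D_rel_iff meet_closed)
qed

lemma D_rel_join:
  assumes "(x, x') \<in> D_rel S" "(y, y') \<in> D_rel S"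
  shows "(x \<squnion> y, x' \<squnion> y') \<in> D_rel S"
proof -
  have "pre_le S (x \<squnion> y) (x' \<squnion> y')" if "(x, x') \<in> D_rel S" "(y, y') \<in> D_rel S" for x x' y y'
    using that unfolding D_rel_iff
    by (metis join_closed join_pre_le1 join_pre_le2 join_pre_le pre_le_trans)
  from this[OF assms] this[of x' x y' y] assms show ?thesis
    by (auto simp: D_rel_iff join_closed)
qed

text \<open>The operations on classes are unions over all representatives. For a congruence all
  members of the union coincide, so it collapses to a single class.\<close>

lemma D_op_class:
  assumes "\<And>x x' y y'. \<lbrakk>(x, x') \<in> D_rel S; (y, y') \<in> D_rel S\<rbrakk> \<Longrightarrow> (f x y, f x' y') \<in> D_rel S"
    and "x \<in> carrier S" "y \<in> carrier S"
  shows "(\<Union>x' \<in> D_class x. \<Union>y' \<in> D_class y. D_class (f x' y')) = D_class (f x y)"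
proof -
  have "D_class (f x' y') = D_class (f x y)" if "x' \<in> D_class x" "y' \<in> D_class y" for x' y'
    using equiv_class_eq[OF equiv_D_rel] assms(1) that by blast
  moreover have "x \<in> D_class x" "y \<in> D_class y"
    using equiv_class_self[OF equiv_D_rel] assms by auto
  ultimately show ?thesis by blast
qed

lemma D_meet_class:
  "\<lbrakk>x \<in> carrier S; y \<in> carrier S\<rbrakk> \<Longrightarrow> D_meet S (D_class x) (D_class y) = D_class (x \<sqinter> y)"
  unfolding D_meet_def by (rule D_op_class) (rule D_rel_meet)

lemma D_join_class:
  "\<lbrakk>x \<in> carrier S; y \<in> carrier S\<rbrakk> \<Longrightarrow> D_join S (D_class x) (D_class y) = D_class (x \<squnion> y)"
  unfolding D_join_def by (rule D_op_class) (rule D_rel_join)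

lemma natural_le_D:
  assumes "x \<in> carrier S" "y \<in> carrier S" "natural_le S x y"
  shows "pre_le S x y" "y \<sqinter> x = x"
  using assms by (auto simp: natural_le_def pre_le_def)

lemma natural_le_trans:
  assumes "x \<in> carrier S" "y \<in> carrier S" "z \<in> carrier S" "natural_le S x y" "natural_le S y z"
  shows "natural_le S x z"
  using assms meet_assoc[of x y z] meet_assoc[of z y x] by (simp add: natural_le_def)

lemma natural_le_antisym: "\<lbrakk>natural_le S x y; natural_le S y x\<rbrakk> \<Longrightarrow> x = y"
  by (auto simp: natural_le_def)

lemma meet_natural_le: "\<lbrakk>x \<in> carrier S; y \<in> carrier S\<rbrakk> \<Longrightarrow> natural_le S (x \<sqinter> y) x"
  by (simp add: natural_le_def left_handed_meet meet_left_idem)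

text \<open>The natural order is one-sided here: a meet lies below its left factor, a join above its
  right one. For sections, a restriction lies below what it restricts, and the result of overwriting
  lies above what overwrites.\<close>

lemma join_natural_le:
  assumes "x \<in> carrier S" "y \<in> carrier S" shows "natural_le S y (x \<squnion> y)"
proof -
  have "y \<squnion> (x \<squnion> y) = x \<squnion> y" using assms left_handed_join[of y x] by (simp add: join_assoc)
  then have "y \<sqinter> (x \<squnion> y) = y" using assms absorb1[of y "x \<squnion> y"] by (simp add: join_closed)
  then show ?thesis using assms by (simp add: natural_le_def absorb3)
qed

text \<open>Inside one \<open>\<D>\<close>-class the natural order is trivial; a restriction of a
  section with the same domain is the section itself.\<close>

lemma natural_le_eq:
  assumes "x \<in> carrier S" "y \<in> carrier S" "natural_le S x y" "pre_le S y x" shows "x = y"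
  using assms by (simp add: natural_le_def pre_le_def)

end

section \<open>Left-handed skew Boolean algebras with intersections\<close>

locale left_handed_cap_algebra = skew_boolean_cap_algebra +
  assumes left_handed_S: "left_handed S"

sublocale left_handed_cap_algebra \<subseteq> left_handed_skew_lattice
  by unfold_locales (rule left_handed_S)

context left_handed_cap_algebra
begin

text \<open>Elements with a common upper bound lie in the Boolean lattice below it, where the
  operations commute.\<close>

lemma natural_le_meet_comm:
  assumes "x \<in> carrier S" "y \<in> carrier S" "z \<in> carrier S" "natural_le S x z" "natural_le S y z"
  shows "x \<sqinter> y = y \<sqinter> x" "x \<squnion> y = y \<squnion> x"
proof -
  interpret L: boolean_lattice "lower_set S z" "meet S" "join S" "\<zero>" z
    using assms by (intro boolean_lower_set)
  show "x \<sqinter> y = y \<sqinter> x" "x \<squnion> y = y \<squnion> x"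
    using assms by (auto simp: lower_set_def intro!: L.comm_m L.comm_j)
qed

lemma cap_closed: "\<lbrakk>a \<in> carrier S; b \<in> carrier S\<rbrakk> \<Longrightarrow> cap S a b \<in> carrier S"
  and cap_le1: "\<lbrakk>a \<in> carrier S; b \<in> carrier S\<rbrakk> \<Longrightarrow> natural_le S (cap S a b) a"
  and cap_le2: "\<lbrakk>a \<in> carrier S; b \<in> carrier S\<rbrakk> \<Longrightarrow> natural_le S (cap S a b) b"
  and cap_greatest: "\<lbrakk>a \<in> carrier S; b \<in> carrier S; c \<in> carrier S; natural_le S c a; natural_le S c b\<rbrakk>
     \<Longrightarrow> natural_le S c (cap S a b)"
  using cap_is_glb[of a b] by (auto simp: is_glb_def)

lemma cap_comm: "\<lbrakk>a \<in> carrier S; b \<in> carrier S\<rbrakk> \<Longrightarrow> cap S a b = cap S b a"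
  by (intro natural_le_antisym cap_greatest cap_closed cap_le1 cap_le2)

lemma cap_absorb:
  assumes "a \<in> carrier S" "b \<in> carrier S" "natural_le S a b" shows "cap S a b = a"
  using assms
  by (intro natural_le_antisym cap_greatest cap_closed cap_le1) (auto simp: natural_le_def meet_idem)

lemma diff_closed: "\<lbrakk>a \<in> carrier S; b \<in> carrier S\<rbrakk> \<Longrightarrow> diff S a b \<in> carrier S"
  and diff_le: "\<lbrakk>a \<in> carrier S; b \<in> carrier S\<rbrakk> \<Longrightarrow> natural_le S (diff S a b) a"
  using diff_in_lower_set[of a b] by (auto simp: lower_set_def)

lemma diff_meet': "\<lbrakk>a \<in> carrier S; b \<in> carrier S\<rbrakk> \<Longrightarrow> (a \<sqinter> b) \<sqinter> diff S a b = \<zero>"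
  and diff_join': "\<lbrakk>a \<in> carrier S; b \<in> carrier S\<rbrakk> \<Longrightarrow> (a \<sqinter> b) \<squnion> diff S a b = a"
  using diff_meet[of a b] diff_join[of a b] by (auto simp: left_handed_meet)

lemma meet_zero_commute:
  assumes "a \<in> carrier S" "b \<in> carrier S" "a \<sqinter> b = \<zero>" shows "b \<sqinter> a = \<zero>"
proof -
  have "b \<sqinter> a = b \<sqinter> a \<sqinter> b" using assms by (simp add: left_handed_meet)
  then show ?thesis using assms meet_assoc[of b a b] by (simp add: zero_right)
qed

text \<open>By definition the difference is disjoint from \<open>a \<sqinter> b\<close>. As it lies
  below \<open>a\<close>, the factor \<open>a\<close> is absorbed and disjointness from
  \<open>b\<close> remains.\<close>

lemma diff_meet_right:
  assumes "a \<in> carrier S" "b \<in> carrier S"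
  shows "diff S a b \<sqinter> b = \<zero>" "b \<sqinter> diff S a b = \<zero>"
proof -
  let ?d = "diff S a b"
  have d: "?d \<in> carrier S" "?d \<sqinter> a = ?d"
    using assms diff_closed diff_le[of a b] by (auto simp: natural_le_def)
  have "?d \<sqinter> (a \<sqinter> b) = \<zero>" using assms d diff_meet'[of a b] meet_zero_commute meet_closed by blast
  then show "?d \<sqinter> b = \<zero>" using assms d meet_assoc[of ?d a b] by simp
  then show "b \<sqinter> ?d = \<zero>" using assms d meet_zero_commute by blast
qed

text \<open>Split \<open>a\<close> into its part over \<open>b\<close> and its part outside
  \<open>b\<close>; the former is absorbed by \<open>b\<close>, so the join becomes one of disjoint
  elements.\<close>

lemma join_eq_diff_join:
  assumes "a \<in> carrier S" "b \<in> carrier S" shows "a \<squnion> b = diff S a b \<squnion> b"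
proof -
  let ?d = "diff S a b"
  note c = assms diff_closed[OF assms] meet_closed[OF assms]
  have "a \<squnion> b = ((a \<sqinter> b) \<squnion> ?d) \<squnion> b" using assms by (simp add: diff_join')
  also have "(a \<sqinter> b) \<squnion> ?d = ?d \<squnion> (a \<sqinter> b)"
    using c by (intro natural_le_meet_comm[of _ _ a] meet_natural_le diff_le)
  also have "?d \<squnion> (a \<sqinter> b) \<squnion> b = ?d \<squnion> b" using c by (simp add: join_assoc absorb4)
  finally show ?thesis .
qed

text \<open>Disjoint elements have commuting meets, hence by symmetry commuting joins, so each of
  them lies below their join and not just the right one.\<close>

lemma diff_le_join:
  assumes "a \<in> carrier S" "b \<in> carrier S" shows "natural_le S (diff S a b) (a \<squnion> b)"
proof -
  have "diff S a b \<squnion> b = b \<squnion> diff S a b"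
    using assms symmetric[of "diff S a b" b] by (simp add: diff_closed diff_meet_right)
  then show ?thesis
    using assms join_natural_le[of b "diff S a b"] by (simp add: join_eq_diff_join diff_closed)
qed

text \<open>The hypothesis says that \<open>a\<close> and \<open>b\<close>, viewed as sections, agree wherever both are defined.\<close>

lemma compatible_join:
  assumes c: "a \<in> carrier S" "b \<in> carrier S" and le: "pre_le S (a \<sqinter> b) (cap S a b)"
  shows "natural_le S a (a \<squnion> b)"
proof -
  \<comment> \<open>Both sides lie below \<open>a\<close>, so they commute; being also equivalent in
    the preorder, they are equal. Used for both orders of the arguments, this makes the meets
    commute, because \<open>cap\<close> is commutative.\<close>
  have eq: "a \<sqinter> b = cap S a b" if c: "a \<in> carrier S" "b \<in> carrier S" "pre_le S (a \<sqinter> b) (cap S a b)" for a b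
  proof -
    have cc: "cap S a b \<in> carrier S" "a \<sqinter> b \<in> carrier S" using c by (auto intro: cap_closed meet_closed)
    have "pre_le S (cap S a b) (a \<sqinter> b)"
      using c cc by (intro pre_le_meet natural_le_D cap_le1 cap_le2)
    moreover have "cap S a b \<sqinter> (a \<sqinter> b) = (a \<sqinter> b) \<sqinter> cap S a b"
      using c cc by (intro natural_le_meet_comm[of _ _ a] cap_le1 meet_natural_le)
    ultimately show ?thesis using c by (simp add: pre_le_def)
  qed
  have "pre_le S (b \<sqinter> a) (cap S b a)"
    using pre_le_trans[of "b \<sqinter> a" "a \<sqinter> b" "cap S a b"] c le
    by (simp add: cap_comm[of b a] meet_closed cap_closed pre_le_meet meet_pre_le1 meet_pre_le2)
  then have "a \<sqinter> b = b \<sqinter> a" using eq[of a b] eq[of b a] c le by (simp add: cap_comm)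
  then have "a \<squnion> b = b \<squnion> a" using c symmetric by blast
  then show ?thesis using join_natural_le[of b a] c by simp
qed

end

section \<open>Algebras of partial maps\<close>

text \<open>Where both maps are undefined the test succeeds and the value is \<open>None\<close> all
  the same, so the domain is exactly the locus where both are defined and agree.\<close>

definition map_cap :: "('x \<rightharpoonup> 'e) \<Rightarrow> ('x \<rightharpoonup> 'e) \<Rightarrow> ('x \<rightharpoonup> 'e)" where
  "map_cap P Q = (\<lambda>x. if P x = Q x then P x else None)"

lemmas map_op_defs = map_cap_def restrict_map_def map_add_def dom_def fun_eq_iff

text \<open>The code \<open>\<iota>\<close> moves the algebra to the universe on which the objects of \<open>BLSBIA\<close> live.\<close>

definition map_algebra :: "('x \<rightharpoonup> 'e) set \<Rightarrow> (('x \<rightharpoonup> 'e) \<Rightarrow> 'u) \<Rightarrow> 'u skew_algebra" where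
  "map_algebra \<C> \<iota> =
     (let \<delta> = inv_into \<C> \<iota> in
     \<lparr>carrier = \<iota> ` \<C>,
      meet = (\<lambda>a b. \<iota> (\<delta> a |` dom (\<delta> b))),
      join = (\<lambda>a b. \<iota> (\<delta> a ++ \<delta> b)),
      diff = (\<lambda>a b. \<iota> (\<delta> a |` (- dom (\<delta> b)))),
      cap = (\<lambda>a b. \<iota> (map_cap (\<delta> a) (\<delta> b))),
      zero = \<iota> Map.empty\<rparr>)"

text \<open>All laws of the algebra hold pointwise for arbitrary partial maps, so only closure under
  the operations is asked of \<open>\<C>\<close>. The member with the largest domain becomes the top
  of the lattice image.\<close>

locale partial_map_family =
  fixes \<C> :: "('x \<rightharpoonup> 'e) set" and \<iota> :: "('x \<rightharpoonup> 'e) \<Rightarrow> 'u"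
  assumes inj_code: "inj_on \<iota> \<C>"
    and empty_mem: "Map.empty \<in> \<C>"
    and restrict_mem: "\<lbrakk>P \<in> \<C>; Q \<in> \<C>\<rbrakk> \<Longrightarrow> P |` dom Q \<in> \<C>"
    and restrict_compl_mem: "\<lbrakk>P \<in> \<C>; Q \<in> \<C>\<rbrakk> \<Longrightarrow> P |` (- dom Q) \<in> \<C>"
    and add_mem: "\<lbrakk>P \<in> \<C>; Q \<in> \<C>\<rbrakk> \<Longrightarrow> P ++ Q \<in> \<C>"
    and cap_mem: "\<lbrakk>P \<in> \<C>; Q \<in> \<C>\<rbrakk> \<Longrightarrow> map_cap P Q \<in> \<C>"
    and ex_global: "\<exists>M \<in> \<C>. \<forall>P \<in> \<C>. dom P \<subseteq> dom M"
begin

abbreviation "S \<equiv> map_algebra \<C> \<iota>"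

lemma decode: "P \<in> \<C> \<Longrightarrow> inv_into \<C> \<iota> (\<iota> P) = P"
  by (rule inv_into_f_f[OF inj_code])

lemma code_eq_iff: "\<lbrakk>P \<in> \<C>; Q \<in> \<C>\<rbrakk> \<Longrightarrow> \<iota> P = \<iota> Q \<longleftrightarrow> P = Q"
  using inj_code by (auto dest: inj_onD)

lemma carrier_map_algebra: "carrier S = \<iota> ` \<C>"
  and zero_map_algebra: "zero S = \<iota> Map.empty"
  by (simp_all add: map_algebra_def Let_def)

lemma ops_map_algebra:
  assumes "P \<in> \<C>" "Q \<in> \<C>"
  shows "meet S (\<iota> P) (\<iota> Q) = \<iota> (P |` dom Q)"
    and "join S (\<iota> P) (\<iota> Q) = \<iota> (P ++ Q)"
    and "diff S (\<iota> P) (\<iota> Q) = \<iota> (P |` (- dom Q))"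
    and "cap S (\<iota> P) (\<iota> Q) = \<iota> (map_cap P Q)"
  using assms by (simp_all add: map_algebra_def Let_def decode)

lemmas mem = empty_mem restrict_mem restrict_compl_mem add_mem cap_mem

lemmas alg_simps = carrier_map_algebra zero_map_algebra ops_map_algebra mem code_eq_iff

lemma natural_le_code:
  assumes "P \<in> \<C>" "Q \<in> \<C>" shows "natural_le S (\<iota> P) (\<iota> Q) \<longleftrightarrow> P \<subseteq>\<^sub>m Q"
proof -
  have "P |` dom Q = P \<and> Q |` dom P = P \<longleftrightarrow> P \<subseteq>\<^sub>m Q"
    unfolding map_le_def restrict_map_def dom_def fun_eq_iff by (auto split: if_splits) (metis option.exhaust)+
  then show ?thesis using assms by (simp add: natural_le_def alg_simps)
qed

text \<open>After decoding, each axiom is an identity of partial maps, checked at a point by cases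
  on which of the maps are defined there.\<close>

sublocale skew_lattice S
  by (unfold_locales, unfold carrier_map_algebra; elim imageE; simp only: ops_map_algebra mem)
    ((intro imageI mem; assumption)
      | rule arg_cong[where f = \<iota>], rule ext,
        simp add: map_op_defs split: option.split)+

lemma lower_set_code:
  assumes "P \<in> \<C>" shows "lower_set S (\<iota> P) = \<iota> ` {Q \<in> \<C>. Q \<subseteq>\<^sub>m P}"
  using assms by (auto simp: lower_set_def carrier_map_algebra natural_le_code)

text \<open>A map below \<open>P\<close> is a restriction of \<open>P\<close>, hence determined by
  its domain; the laws are those of subsets of \<open>dom P\<close>. The complement of
  \<open>Q\<close> is \<open>P\<close> restricted to the points outside
  \<open>dom Q\<close>.\<close>

lemma boolean_lattice_lower_set:
  assumes P: "P \<in> \<C>" shows "boolean_lattice (lower_set S (\<iota> P)) (meet S) (join S) \<zero>\<^bsub>S\<^esub> (\<iota> P)"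
proof -
  have le_cases: "Q x = None \<or> Q x = P x" if "Q \<subseteq>\<^sub>m P" for Q x
    using that by (auto simp: map_le_def dom_def)
  have restr: "Q |` A \<subseteq>\<^sub>m P" if "Q \<subseteq>\<^sub>m P" for Q A
    using that by (auto simp: map_le_def restrict_map_def dom_def split: if_splits)
  show ?thesis
    unfolding lower_set_code[OF P]
  proof (unfold_locales, goal_cases)
    case (1 x y) then show ?case using restr by (force simp: alg_simps)
  next
    case (2 x y) then show ?case by (auto simp: alg_simps intro!: imageI map_add_le_mapI)
  next
    case 3 then show ?case by (auto simp: alg_simps)
  next
    case 4 then show ?case using P by (auto simp: alg_simps)
  next
    case (14 x)
    then obtain Q where Q: "x = \<iota> Q" "Q \<in> \<C>" "Q \<subseteq>\<^sub>m P" by auto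
    have mem': "\<iota> (P |` (- dom Q)) \<in> \<iota> ` {Q \<in> \<C>. Q \<subseteq>\<^sub>m P}"
      using P Q by (auto simp: mem map_le_def)
    have "Q |` dom (P |` (- dom Q)) = Map.empty"
      by (auto simp: restrict_map_def fun_eq_iff dom_def)
    moreover have "(Q ++ P |` (- dom Q)) y = P y" for y
      using le_cases[OF Q(3), of y] by (auto simp: map_add_def restrict_map_def dom_def split: option.split)
    then have "Q ++ P |` (- dom Q) = P" ..
    ultimately have "meet S x (\<iota> (P |` (- dom Q))) = \<zero>\<^bsub>S\<^esub>" "join S x (\<iota> (P |` (- dom Q))) = \<iota> P"
      using P Q by (simp_all only: zero_map_algebra ops_map_algebra mem)
    then show ?case using mem' by blast
  next
    case (11 x y z)
    then obtain Q R T where Q: "x = \<iota> Q" "y = \<iota> R" "z = \<iota> T" "Q \<in> \<C>" "R \<in> \<C>" "T \<in> \<C>"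
      by auto
    have "Q |` dom (R ++ T) = Q |` dom R ++ Q |` dom T"
      by (auto simp: map_add_def restrict_map_def fun_eq_iff split: option.split)
    then show ?case using Q by (simp only: ops_map_algebra mem)
  next
    case (7 x y)
    then obtain Q R where Q: "x = \<iota> Q" "y = \<iota> R" "Q \<in> \<C>" "R \<in> \<C>" "Q \<subseteq>\<^sub>m P" "R \<subseteq>\<^sub>m P" by auto
    have "(Q |` dom R) z = (R |` dom Q) z" for z
      using le_cases[OF Q(5), of z] le_cases[OF Q(6), of z] by (auto simp: restrict_map_def dom_def)
    then have "Q |` dom R = R |` dom Q" ..
    then show ?case using Q by (simp only: ops_map_algebra mem)
  next
    case (8 x y)
    then obtain Q R where Q: "x = \<iota> Q" "y = \<iota> R" "Q \<in> \<C>" "R \<in> \<C>" "Q \<subseteq>\<^sub>m P" "R \<subseteq>\<^sub>m P" by auto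
    have "(Q ++ R) z = (R ++ Q) z" for z
      using le_cases[OF Q(5), of z] le_cases[OF Q(6), of z] by (auto simp: map_add_def split: option.split)
    then have "Q ++ R = R ++ Q" ..
    then show ?case using Q by (simp only: ops_map_algebra mem)
  next
    case (13 x)
    then obtain Q where Q: "x = \<iota> Q" "Q \<in> \<C>" "Q \<subseteq>\<^sub>m P" by auto
    have "(Q |` dom P) z = Q z" for z
      using le_cases[OF Q(3), of z] by (auto simp: restrict_map_def dom_def)
    then have "Q |` dom P = Q" ..
    then show ?case using Q P by (simp only: ops_map_algebra mem)
  qed ((elim imageE CollectE conjE, simp only: ops_map_algebra mem zero_map_algebra,
      rule arg_cong[where f = \<iota>], rule ext,
      simp add: map_op_defs split: option.split)[1])+
qed

sublocale skew_boolean_cap_algebra S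
proof intro_locales
  show "boolean_skew_lattice_axioms S"
  proof (rule boolean_skew_lattice_axioms.intro, goal_cases)
    case (1 x y)
    then show ?case
      by (clarsimp simp: alg_simps) (force simp: map_op_defs split: option.splits)
  next
    case (5 x) then show ?case
      unfolding carrier_map_algebra by (elim imageE, hypsubst) (rule boolean_lattice_lower_set)
  qed (auto simp: alg_simps)
  show "skew_boolean_algebra_axioms S"
  proof (rule skew_boolean_algebra_axioms.intro, goal_cases)
    case (1 a b) then show ?case
      by (auto simp: carrier_map_algebra lower_set_code ops_map_algebra mem intro!: imageI)
        (auto simp: map_le_def restrict_map_def split: if_splits)
  next
    case (2 a b) then show ?case
      unfolding carrier_map_algebra
      by (elim imageE; simp only: ops_map_algebra mem zero_map_algebra; intro arg_cong[where f = \<iota>] ext)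
        (simp add: map_op_defs split: option.split)
  next
    case (3 a b) then show ?case
      unfolding carrier_map_algebra
      by (elim imageE; simp only: ops_map_algebra mem zero_map_algebra; intro arg_cong[where f = \<iota>] ext)
        (simp add: map_op_defs split: option.split)
  qed
  show "skew_boolean_cap_algebra_axioms S"
  proof (rule skew_boolean_cap_algebra_axioms.intro, goal_cases)
    case cap: (2 a b)
    then obtain P Q where PQ: "a = \<iota> P" "b = \<iota> Q" "P \<in> \<C>" "Q \<in> \<C>" by (auto simp: carrier_map_algebra)
    have "R \<subseteq>\<^sub>m P \<and> R \<subseteq>\<^sub>m Q \<longleftrightarrow> R \<subseteq>\<^sub>m map_cap P Q" for R
      unfolding map_le_def map_cap_def dom_def by (auto split: if_splits)
    then show ?case using PQ
      by (auto simp: is_glb_def alg_simps natural_le_code)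
  next
    \<comment> \<open>Finite sets are reduced to pairs: the bounds below \<open>x\<close> and below
      a greatest lower bound of the rest are the bounds below their \<open>map_cap\<close>.\<close>
    case (1 A)
    then show ?case
    proof (induction A rule: finite_ne_induct)
      case (singleton x)
      then have "is_glb S {x} x" by (auto simp: is_glb_def natural_le_def meet_idem)
      then show ?case by blast
    next
      case (insert x A)
      then obtain g where g: "is_glb S A g" by auto
      then obtain P Q where PQ: "x = \<iota> P" "g = \<iota> Q" "P \<in> \<C>" "Q \<in> \<C>"
        using insert.prems by (auto simp: carrier_map_algebra is_glb_def)
      have *: "R \<subseteq>\<^sub>m P \<and> R \<subseteq>\<^sub>m Q \<longleftrightarrow> R \<subseteq>\<^sub>m map_cap P Q" for R
        unfolding map_le_def map_cap_def dom_def by (auto split: if_splits)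
      have "is_glb S (insert x A) (\<iota> (map_cap P Q))"
        unfolding is_glb_def
      proof (intro conjI ballI impI)
        have le: "map_cap P Q \<subseteq>\<^sub>m P" "map_cap P Q \<subseteq>\<^sub>m Q" using *[of "map_cap P Q"] by simp_all
        show "\<iota> (map_cap P Q) \<in> carrier S" using PQ by (simp add: alg_simps)
        show "natural_le S (\<iota> (map_cap P Q)) a" if "a \<in> insert x A" for a
        proof (cases "a = x")
          case False
          then have "natural_le S g a" "a \<in> carrier S" using that g insert.prems by (auto simp: is_glb_def)
          then show ?thesis using PQ le
            by (auto simp: carrier_map_algebra natural_le_code cap_mem intro: map_le_trans)
        qed (use PQ le in \<open>simp add: natural_le_code cap_mem\<close>)
        show "natural_le S h (\<iota> (map_cap P Q))"
          if h: "h \<in> carrier S" "\<forall>a \<in> insert x A. natural_le S h a" for h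
        proof -
          have "natural_le S h g" using g that by (auto simp: is_glb_def)
          moreover obtain R where "R \<in> \<C>" "h = \<iota> R" using h(1) by (auto simp: carrier_map_algebra)
          ultimately show ?thesis using h PQ *[of R] by (simp add: natural_le_code cap_mem)
        qed
      qed
      then show ?case by blast
    qed
  qed
qed

sublocale left_handed_cap_algebra S
proof
  show "left_handed S"
    unfolding left_handed_def carrier_map_algebra
    by (intro ballI conjI; elim imageE; simp only: ops_map_algebra mem;
        rule arg_cong[where f = \<iota>], rule ext)
      (simp_all add: map_op_defs split: option.split)
qed

lemma pre_le_code:
  assumes "P \<in> \<C>" "Q \<in> \<C>" shows "pre_le S (\<iota> P) (\<iota> Q) \<longleftrightarrow> dom P \<subseteq> dom Q"
proof -
  have "P |` dom Q = P \<longleftrightarrow> dom P \<subseteq> dom Q"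
  proof
    show "dom P \<subseteq> dom Q" if "P |` dom Q = P"
      using arg_cong[OF that, of dom] by auto
    show "P |` dom Q = P" if "dom P \<subseteq> dom Q"
      using that by (force simp: restrict_map_def fun_eq_iff)
  qed
  then show ?thesis using assms by (simp add: pre_le_def alg_simps)
qed

text \<open>By \<open>pre_le_code\<close> two members are \<open>\<D>\<close>-related exactly when
  their domains are equal, so the quotient is a lattice of sets. Complements are taken in the domain
  of the global member \<open>M\<close>.\<close>

lemma boolean_lattice_image: "boolean_lattice_image S"
proof -
  obtain M where M: "M \<in> \<C>" "\<And>P. P \<in> \<C> \<Longrightarrow> dom P \<subseteq> dom M" using ex_global by auto
  let ?cl = "\<lambda>P. D_class (\<iota> P)"
  have carrier: "\<iota> P \<in> carrier S" if "P \<in> \<C>" for P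
    using that by (simp add: carrier_map_algebra)
  have eq: "?cl P = ?cl Q \<longleftrightarrow> dom P = dom Q" if "P \<in> \<C>" "Q \<in> \<C>" for P Q
    using that by (auto simp: D_class_eq_iff carrier pre_le_code)
  have ops: "D_meet S (?cl P) (?cl Q) = ?cl (P |` dom Q)"
      "D_join S (?cl P) (?cl Q) = ?cl (P ++ Q)" if "P \<in> \<C>" "Q \<in> \<C>" for P Q
    using that by (simp_all add: D_meet_class D_join_class carrier ops_map_algebra)
  have quot: "D_quot S = ?cl ` \<C>"
    by (auto simp: D_quot_eq carrier_map_algebra)
  have "boolean_lattice (D_quot S) (D_meet S) (D_join S) (?cl Map.empty) (?cl M)"
    unfolding quot
  proof (rule boolean_lattice.intro, goal_cases)
    case (1 x y) then show ?case by (elim imageE, hypsubst, simp only: ops) (intro imageI mem)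
  next
    case (2 x y) then show ?case by (elim imageE, hypsubst, simp only: ops) (intro imageI mem)
  next
    case 3 show ?case by (intro imageI mem)
  next
    case 4 show ?case by (intro imageI M)
  next
    case (13 x)
    then show ?case using M by (elim imageE, hypsubst, simp only: ops mem eq) auto
  next
    case (14 x)
    then obtain P where P: "x = ?cl P" "P \<in> \<C>" by auto
    then have "D_meet S x (?cl (M |` (- dom P))) = ?cl Map.empty"
      "D_join S x (?cl (M |` (- dom P))) = ?cl M"
      using M(1) by (simp_all only: ops mem eq) (use P M in auto)
    then show ?case using P M by (meson imageI mem)
  qed ((elim imageE, hypsubst, simp only: ops mem eq, auto)[1])+
  then show ?thesis unfolding boolean_lattice_image_def by blast
qed

end

section \<open>Clopen sections of an etale space\<close>

lemma clopenin_simps: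
  shows "clopenin X {}"
    and "\<lbrakk>clopenin X U; clopenin X V\<rbrakk> \<Longrightarrow> clopenin X (U \<inter> V)"
    and "\<lbrakk>clopenin X U; clopenin X V\<rbrakk> \<Longrightarrow> clopenin X (U \<union> V)"
    and "\<lbrakk>clopenin X U; clopenin X V\<rbrakk> \<Longrightarrow> clopenin X (U - V)"
  by (auto simp: clopenin_def openin_diff closedin_diff)

lemma clopenin_subset: "clopenin X U \<Longrightarrow> U \<subseteq> topspace X"
  by (simp add: clopenin_def openin_subset)

lemma clopenin_preimage:
  "\<lbrakk>continuous_map X Y f; clopenin Y U\<rbrakk> \<Longrightarrow> clopenin X {x \<in> topspace X. f x \<in> U}"
  by (simp add: clopenin_def openin_continuous_map_preimage closedin_continuous_map_preimage)

lemma section_over_iff: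
  assumes U: "openin (base A) U"
  shows "section_over A U s \<longleftrightarrow> (\<forall>x\<in>U. s x \<in> stalk A x) \<and>
     (\<forall>V. openin (total A) V \<longrightarrow> openin (base A) {x \<in> U. s x \<in> V})"
proof -
  have "topspace (subtopology (base A) U) = U"
    using openin_subset[OF U] by (simp add: topspace_subtopology Int_absorb1)
  moreover have "openin (subtopology (base A) U) W \<longleftrightarrow> openin (base A) W" if "W \<subseteq> U" for W
    using openin_open_subtopology[OF U] that by simp
  ultimately show ?thesis
    by (auto simp: section_over_def continuous_map_def stalk_def)
qed

lemma section_over_cong:
  assumes "openin (base A) U" "\<And>x. x \<in> U \<Longrightarrow> s x = t x"
  shows "section_over A U s \<longleftrightarrow> section_over A U t"
proof -
  have "{x \<in> U. s x \<in> V} = {x \<in> U. t x \<in> V}" for V using assms by auto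
  then show ?thesis using assms by (simp add: section_over_iff)
qed

text \<open>The last condition is continuity, in a form that the operations on partial maps visibly preserve.\<close>

definition csections :: "('e, 'x) etale \<Rightarrow> ('x \<rightharpoonup> 'e) set" where
  "csections A = {P. clopenin (base A) (dom P) \<and> (\<forall>x e. P x = Some e \<longrightarrow> e \<in> stalk A x) \<and>
     (\<forall>V. openin (total A) V \<longrightarrow> openin (base A) {x. \<exists>e\<in>V. P x = Some e})}"

lemma csectionsD:
  assumes "P \<in> csections A"
  shows "clopenin (base A) (dom P)" "P x = Some e \<Longrightarrow> e \<in> stalk A x"
    and "openin (total A) V \<Longrightarrow> openin (base A) {x. \<exists>e\<in>V. P x = Some e}"
  using assms by (auto simp: csections_def)

lemma csections_section_over:
  assumes "P \<in> csections A" shows "section_over A (dom P) (\<lambda>x. the (P x))"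
proof -
  have "{x \<in> dom P. the (P x) \<in> V} = {x. \<exists>e\<in>V. P x = Some e}" for V by auto
  then show ?thesis
    using assms csectionsD(2)[OF assms]
    by (auto simp: section_over_iff csections_def clopenin_def)
qed

lemma section_over_csections:
  assumes "clopenin (base A) U" "section_over A U s"
  shows "(\<lambda>x. if x \<in> U then Some (s x) else None) \<in> csections A"
proof -
  have "{x. \<exists>e\<in>V. (if x \<in> U then Some (s x) else None) = Some e} = {x \<in> U. s x \<in> V}" for V
    by auto
  moreover have "dom (\<lambda>x. if x \<in> U then Some (s x) else None) = U" by (auto simp: dom_def)
  ultimately show ?thesis
    using assms by (auto simp: csections_def section_over_iff clopenin_def split: if_splits)
qed

lemma csections_empty: "Map.empty \<in> csections A"
  by (simp add: csections_def clopenin_simps)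

lemma csections_restrict:
  assumes "P \<in> csections A" "clopenin (base A) U"
  shows "P |` U \<in> csections A"
proof -
  have "{x. \<exists>e\<in>V. (P |` U) x = Some e} = {x. \<exists>e\<in>V. P x = Some e} \<inter> U" for V
    by (auto simp: restrict_map_def split: if_splits)
  moreover have "(P |` U) x = Some e \<Longrightarrow> e \<in> stalk A x" for x e
    using csectionsD(2)[OF assms(1)] by (auto simp: restrict_map_def split: if_splits)
  ultimately show ?thesis using assms
    by (auto simp: csections_def clopenin_simps dom_restrict clopenin_def)
qed

lemma csections_restrict_compl:
  assumes "P \<in> csections A" "clopenin (base A) U"
  shows "P |` (- U) \<in> csections A"
proof -
  \<comment> \<open>\<open>- U\<close> is a complement in the whole type and may leave the space;
    \<open>dom P - U\<close> is clopen.\<close>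
  have "P |` (- U) = P |` (dom P - U)" by (auto simp: restrict_map_def fun_eq_iff dom_def)
  then show ?thesis using assms by (metis csectionsD(1) csections_restrict clopenin_simps(4))
qed

lemma csections_add:
  assumes "P \<in> csections A" "Q \<in> csections A"
  shows "P ++ Q \<in> csections A"
proof -
  \<comment> \<open>Off \<open>dom Q\<close> the values come from \<open>P\<close>; removing
    \<open>dom Q\<close> keeps the set open because \<open>dom Q\<close> is closed.\<close>
  have "{x. \<exists>e\<in>V. (P ++ Q) x = Some e}
      = {x. \<exists>e\<in>V. Q x = Some e} \<union> ({x. \<exists>e\<in>V. P x = Some e} - dom Q)" for V
    by (auto simp: map_add_def split: option.splits)
  then show ?thesis using assms
    by (auto simp: csections_def clopenin_simps Un_commute map_add_Some_iff)
      (auto simp: clopenin_def intro!: openin_Un openin_diff)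
qed

text \<open>The predicate \<open>T\<close> rides along with the gluing: it is trivial for the
  construction of a global section, and for Stone duality it records that the homomorphic image
  stays undefined at a given point.\<close>

lemma csections_finite_union:
  assumes "finite \<F>" "\<F> \<subseteq> csections A"
    and "T Map.empty" "\<And>P Q. \<lbrakk>P \<in> csections A; Q \<in> csections A; T P; T Q\<rbrakk> \<Longrightarrow> T (P ++ Q)"
      "\<And>P. P \<in> \<F> \<Longrightarrow> T P"
  shows "\<exists>M \<in> csections A. dom M = \<Union> (dom ` \<F>) \<and> T M"
  using assms(1,2,5)
proof (induction \<F> rule: finite_induct)
  case empty then show ?case using assms(3) csections_empty by (intro bexI[of _ Map.empty]) auto
next
  case (insert P \<F>)
  then obtain M where "M \<in> csections A" "dom M = \<Union> (dom ` \<F>)" "T M" by auto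
  then show ?case using insert.prems assms(4)
    by (intro bexI[of _ "M ++ P"]) (auto intro: csections_add)
qed

text \<open>The projection recovers the argument from the value, so sections can be counted by their
  images in the total space.\<close>

lemma csections_ran_inject:
  assumes "P \<in> csections A" "Q \<in> csections A" "ran P = ran Q" shows "P = Q"
proof -
  have *: "P x = Some e \<longleftrightarrow> e \<in> ran P \<and> proj A e = x" if "P \<in> csections A" for P x e
    using csectionsD(2)[OF that] by (auto simp: ran_def stalk_def)
  show ?thesis
  proof
    fix x show "P x = Q x"
      using *[OF assms(1), of x] *[OF assms(2), of x] assms(3)
      by (metis not_None_eq)
  qed
qed

text \<open>Stratified by cardinality: a set of size \<open>n + 1\<close> is a set of size
  \<open>n\<close> with one element of \<open>A\<close> inserted, and a union of at most
  \<open>|A|\<close> sets, each of size at most \<open>|A|\<close>, does not exceed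
  \<open>|A|\<close> when \<open>A\<close> is infinite.\<close>

lemma Fpow_lepoll:
  includes cardinal_syntax
  assumes "infinite A" shows "Fpow A \<lesssim> A"
proof -
  define F where "F n = {X \<in> Fpow A. card X = n}" for n
  have nat: "|UNIV :: nat set| \<le>o |A|" using assms by (simp add: infinite_iff_card_of_nat)
  have "|F n| \<le>o |A|" for n
  proof (induction n)
    case 0
    have "F 0 = {{}}" by (auto simp: F_def Fpow_def)
    then show ?case using assms by (simp add: card_of_singl_ordLeq infinite_imp_nonempty)
  next
    case (Suc n)
    have "F (Suc n) \<subseteq> (\<Union>a\<in>A. insert a ` F n)"
      by (auto simp: F_def Fpow_def card_Suc_eq_finite image_iff)
    then have "|F (Suc n)| \<le>o |\<Union>a\<in>A. insert a ` F n|" by (rule card_of_mono1)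
    also have "|\<Union>a\<in>A. insert a ` F n| \<le>o |A|"
    proof (rule card_of_UNION_ordLeq_infinite[OF assms])
      show "|A| \<le>o |A|" by (rule card_of_mono1) simp
      show "\<forall>a\<in>A. |insert a ` F n| \<le>o |A|"
        using Suc card_of_image ordLeq_transitive by blast
    qed
    finally show ?case .
  qed
  then have "|\<Union>n. F n| \<le>o |A|"
    by (intro card_of_UNION_ordLeq_infinite[OF assms nat]) simp
  moreover have "(\<Union>n. F n) = Fpow A" by (auto simp: F_def)
  ultimately show ?thesis by (simp add: lepoll_def card_of_ordLeq)
qed

lemma ran_eq_image: "ran P = (\<lambda>x. the (P x)) ` dom P"
proof
  show "ran P \<subseteq> (\<lambda>x. the (P x)) ` dom P"
  proof
    fix e assume "e \<in> ran P"
    then obtain x where "P x = Some e" by (auto simp: ran_def)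
    then show "e \<in> (\<lambda>x. the (P x)) ` dom P" by (intro image_eqI[of _ _ x]) auto
  qed
qed (auto simp: ran_def)

section \<open>Etale spaces over Boolean spaces\<close>

locale boolean_etale =
  fixes A :: "('e, 'x) etale"
  assumes etale: "etale_space A" and boolean: "boolean_space (base A)"
begin

lemma clopen_nbhd:
  assumes "openin (base A) U" "x \<in> U"
  obtains W where "clopenin (base A) W" "x \<in> W" "W \<subseteq> U"
  using assms boolean unfolding boolean_space_def open_base_def by blast

lemma local_inverse:
  assumes "e \<in> topspace (total A)"
  obtains V g where "openin (total A) V" "e \<in> V" "openin (base A) (proj A ` V)"
    "section_over A (proj A ` V) g" "\<And>e. e \<in> V \<Longrightarrow> g (proj A e) = e" "inj_on (proj A) V"
proof -
  let ?p = "proj A"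
  obtain V where V: "openin (total A) V" "e \<in> V" "openin (base A) (?p ` V)"
    and hom: "homeomorphic_map (subtopology (total A) V) (subtopology (base A) (?p ` V)) ?p"
    using assms etale unfolding etale_space_def local_homeomorphism_def by blast
  have sub: "V \<subseteq> topspace (total A)" "?p ` V \<subseteq> topspace (base A)"
    using V by (auto dest: openin_subset)
  obtain g where g: "homeomorphic_maps (subtopology (total A) V) (subtopology (base A) (?p ` V)) ?p g"
    using hom homeomorphic_map_maps by blast
  then have gV: "continuous_map (subtopology (base A) (?p ` V)) (subtopology (total A) V) g"
    and inv: "\<And>e. e \<in> V \<Longrightarrow> g (?p e) = e"
    using sub by (auto simp: homeomorphic_maps_def topspace_subtopology)
  have "section_over A (?p ` V) g"
    unfolding section_over_def using gV inv by (auto simp: continuous_map_in_subtopology)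
  moreover have "inj_on ?p V" by (rule inj_on_inverseI) (rule inv)
  ultimately show ?thesis using that V inv by blast
qed

text \<open>A local inverse of the projection around \<open>e\<close>, cut down to a clopen
  neighbourhood of \<open>x\<close> inside \<open>U\<close>.\<close>

lemma ex_csection_through:
  assumes e: "e \<in> stalk A x" and U: "openin (base A) U" "x \<in> U"
  obtains P where "P \<in> csections A" "P x = Some e" "dom P \<subseteq> U"
proof -
  have e': "e \<in> topspace (total A)" "proj A e = x" using e by (auto simp: stalk_def)
  obtain V g where V: "openin (total A) V" "e \<in> V" "openin (base A) (proj A ` V)"
    and g: "section_over A (proj A ` V) g" "\<And>e. e \<in> V \<Longrightarrow> g (proj A e) = e"
    using local_inverse[OF e'(1)] by metis
  have "openin (base A) (proj A ` V \<inter> U)" "x \<in> proj A ` V \<inter> U"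
    using V U e' by auto
  then obtain W where W: "clopenin (base A) W" "x \<in> W" "W \<subseteq> proj A ` V \<inter> U"
    by (rule clopen_nbhd)
  have "section_over A W g"
    using g(1) W unfolding section_over_def by (auto intro: continuous_map_from_subtopology_mono)
  from section_over_csections[OF W(1) this] show thesis
    by (rule that) (use W V g e' in \<open>auto split: if_splits\<close>)
qed

text \<open>By compactness finitely many domains of clopen sections cover the base. Overwriting
  glues them without any agreement on overlaps, which works because the domains are clopen.\<close>

lemma ex_global_csection:
  obtains M where "M \<in> csections A" "dom M = topspace (base A)"
proof -
  have "\<exists>P \<in> csections A. x \<in> dom P" if x: "x \<in> topspace (base A)" for x
  proof -
    obtain e where "e \<in> stalk A x"
      using etale x unfolding etale_space_def stalk_def by force
    from ex_csection_through[OF this openin_topspace x] obtain P where "P \<in> csections A" "P x = Some e" .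
    then show ?thesis by auto
  qed
  then have "topspace (base A) \<subseteq> \<Union> (dom ` csections A)" by auto
  moreover have "\<forall>U \<in> dom ` csections A. openin (base A) U"
    using csectionsD(1) by (auto simp: clopenin_def)
  ultimately obtain \<F> where "finite \<F>" "\<F> \<subseteq> dom ` csections A" "topspace (base A) \<subseteq> \<Union>\<F>"
    using boolean unfolding boolean_space_def compact_space_alt by meson
  then obtain \<G> where \<G>: "finite \<G>" "\<G> \<subseteq> csections A" "topspace (base A) \<subseteq> \<Union> (dom ` \<G>)"
    by (metis finite_subset_image)
  then obtain M where "M \<in> csections A" "dom M = \<Union> (dom ` \<G>)"
    using csections_finite_union[of \<G> A "\<lambda>_. True"] by auto
  then show thesis
    using \<G>(3) clopenin_subset[OF csectionsD(1), of M A] by (intro that[of M] antisym) auto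
qed

text \<open>Around a point of the image the projection is injective on some open \<open>V\<close>. A
  point of \<open>V\<close> lying over a place where \<open>P\<close> takes a value in
  \<open>V\<close> must therefore be that value.\<close>

lemma openin_ran_csection:
  assumes P: "P \<in> csections A" shows "openin (total A) (ran P)"
proof (subst openin_subopen, intro ballI)
  fix e assume "e \<in> ran P"
  then obtain x where x: "P x = Some e" by (auto simp: ran_def)
  then have e: "e \<in> topspace (total A)" "proj A e = x"
    using csectionsD(2)[OF P x] by (auto simp: stalk_def)
  obtain V where V: "openin (total A) V" "e \<in> V" "openin (base A) (proj A ` V)"
    and hom: "homeomorphic_map (subtopology (total A) V) (subtopology (base A) (proj A ` V)) (proj A)"
    using e etale unfolding etale_space_def local_homeomorphism_def by blast
  have sub: "V \<subseteq> topspace (total A)" "proj A ` V \<subseteq> topspace (base A)"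
    using V by (auto dest: openin_subset)
  define W where "W = {x. \<exists>e\<in>V. P x = Some e}"
  have W: "openin (base A) W" "W \<subseteq> proj A ` V"
    using csectionsD(3)[OF P V(1)] csectionsD(2)[OF P] by (auto simp: W_def stalk_def)
  have "openin (subtopology (total A) V) {e' \<in> topspace (subtopology (total A) V). proj A e' \<in> W}"
    using W openin_open_subtopology[OF V(3)]
    by (intro openin_continuous_map_preimage[OF homeomorphic_imp_continuous_map[OF hom]]) auto
  then have "openin (total A) {e' \<in> V. proj A e' \<in> W}"
    using sub V(1) by (auto simp: openin_open_subtopology topspace_subtopology Int_absorb1)
  moreover have "e \<in> {e' \<in> V. proj A e' \<in> W}"
    using V e x by (auto simp: W_def)
  moreover have "{e' \<in> V. proj A e' \<in> W} \<subseteq> ran P"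
  proof clarify
    fix e' assume e': "e' \<in> V" "proj A e' \<in> W"
    then obtain e'' where e'': "e'' \<in> V" "P (proj A e') = Some e''" by (auto simp: W_def)
    then have "proj A e'' = proj A e'" using csectionsD(2)[OF P e''(2)] by (auto simp: stalk_def)
    moreover have "inj_on (proj A) V"
      using homeomorphic_imp_injective_map[OF hom] sub by (simp add: topspace_subtopology Int_absorb1)
    ultimately have "e'' = e'" using e' e'' by (auto dest: inj_onD)
    then show "e' \<in> ran P" using e'' by (auto simp: ran_def)
  qed
  ultimately show "\<exists>T. openin (total A) T \<and> e \<in> T \<and> T \<subseteq> ran P" by blast
qed

lemma compactin_ran_csection:
  assumes P: "P \<in> csections A" shows "compactin (total A) (ran P)"
proof -
  have cont: "continuous_map (subtopology (base A) (dom P)) (total A) (\<lambda>x. the (P x))"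
    using csections_section_over[OF P] by (simp add: section_over_def)
  have "compactin (base A) (dom P)"
    using csectionsD(1)[OF P] boolean unfolding boolean_space_def clopenin_def
    by (blast intro: closedin_compact_space)
  then have "compactin (subtopology (base A) (dom P)) (dom P)"
    by (simp add: compactin_subtopology)
  from image_compactin[OF this cont] show ?thesis
    by (simp only: ran_eq_image)
qed

lemma small_csections:
  assumes inf: "infinite (UNIV :: 'u set)" and \<B>: "open_base (total A) \<B>" "small TYPE('u) \<B>"
  shows "small TYPE('u) (csections A)"
proof -
  have "ran ` csections A \<subseteq> Union ` Fpow \<B>"
  proof clarify
    fix P assume P: "P \<in> csections A"
    let ?U = "{B \<in> \<B>. B \<subseteq> ran P}"
    have "ran P \<subseteq> \<Union>?U"
      using openin_ran_csection[OF P] \<B>(1) unfolding open_base_def by blast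
    moreover have "\<forall>B \<in> ?U. openin (total A) B" using \<B>(1) by (auto simp: open_base_def)
    ultimately obtain \<F> where "finite \<F>" "\<F> \<subseteq> ?U" "ran P \<subseteq> \<Union>\<F>"
      using compactin_ran_csection[OF P] unfolding compactin_def by meson
    then show "ran P \<in> Union ` Fpow \<B>"
      by (intro image_eqI[of _ _ \<F>]) (auto simp: Fpow_def)
  qed
  then have "ran ` csections A \<lesssim> Fpow \<B>" by (rule subset_image_lepoll)
  moreover have "inj_on ran (csections A)" by (rule inj_onI) (rule csections_ran_inject)
  ultimately have "csections A \<lesssim> Fpow \<B>" by simp
  \<comment> \<open>The bound by \<open>\<B>\<close> itself concerns an infinite base; a finite base
    has finitely many subsets, and then infinity of \<open>'u\<close> is used.\<close>
  also have "Fpow \<B> \<prec> (UNIV :: 'u set)"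
  proof (cases "finite \<B>")
    case True
    then have "finite (Fpow \<B>)" by (simp add: Fpow_Pow_finite)
    with inf show ?thesis by (rule finite_lesspoll_infinite)
  next
    case False
    then have "Fpow \<B> \<lesssim> \<B>" by (rule Fpow_lepoll)
    also have "\<B> \<prec> (UNIV :: 'u set)" using \<B>(2) by (simp add: small_def)
    finally show ?thesis .
  qed
  finally show ?thesis by (simp add: small_def)
qed

end

locale etale_object = boolean_etale +
  assumes equalizers: "clopen_equalizers A"
begin

text \<open>The equalizer condition speaks of images in the total space. The projection turns the
  intersection of two images into the locus of agreement, which is thus the clopen set
  \<open>W\<close>, and \<open>map_cap P Q\<close> is the restriction of \<open>P\<close> to
  it.\<close>

lemma csections_cap:
  assumes P: "P \<in> csections A" and Q: "Q \<in> csections A"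
  shows "map_cap P Q \<in> csections A"
proof -
  have img: "ran P \<in> section_images A (dom P)" if "P \<in> csections A" for P
  proof -
    show ?thesis using ran_eq_image[of P] csections_section_over[OF that] by (auto simp: section_images_def)
  qed
  obtain W where W: "clopenin (base A) W" "ran P \<inter> ran Q \<in> section_images A W"
    using equalizers csectionsD(1)[OF P] csectionsD(1)[OF Q] img[OF P] img[OF Q]
    unfolding clopen_equalizers_def by blast
  then obtain s where s: "section_over A W s" "ran P \<inter> ran Q = s ` W" by (auto simp: section_images_def)
  have "dom (map_cap P Q) = proj A ` (ran P \<inter> ran Q)"
  proof
    show "dom (map_cap P Q) \<subseteq> proj A ` (ran P \<inter> ran Q)"
    proof
      fix x assume "x \<in> dom (map_cap P Q)"
      then obtain e where "P x = Some e" "Q x = Some e" by (auto simp: map_cap_def split: if_splits) metis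
      then show "x \<in> proj A ` (ran P \<inter> ran Q)"
        using csectionsD(2)[OF P, of x e] by (intro image_eqI[of _ _ e]) (auto simp: ran_def stalk_def)
    qed
    show "proj A ` (ran P \<inter> ran Q) \<subseteq> dom (map_cap P Q)"
      using csectionsD(2)[OF P] csectionsD(2)[OF Q]
      by (fastforce simp: map_cap_def dom_def ran_def stalk_def)
  qed
  also have "\<dots> = W" using s by (force simp: section_over_def image_image)
  finally have "map_cap P Q = P |` W"
    by (auto simp: map_cap_def restrict_map_def fun_eq_iff dom_def split: if_splits)
  then show ?thesis using csections_restrict[OF P W(1)] by simp
qed

lemma partial_map_family_csections:
  assumes "inj_on \<iota> (csections A)" shows "partial_map_family (csections A) \<iota>"
proof
  obtain M where "M \<in> csections A" "dom M = topspace (base A)" by (rule ex_global_csection)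
  then show "\<exists>M \<in> csections A. \<forall>P \<in> csections A. dom P \<subseteq> dom M"
    using clopenin_subset[OF csectionsD(1)] by metis
qed (auto intro: assms csections_empty csections_restrict csections_restrict_compl csections_add
    csections_cap csectionsD(1))

end

section \<open>The two categories\<close>

lemma (in left_handed_skew_lattice) pre_le_hom:
  assumes "cap_homomorphism S T f" "x \<in> carrier S" "y \<in> carrier S" "pre_le S x y"
  shows "pre_le T (f x) (f y)"
proof -
  have "meet T (f x) (f y) = f (x \<sqinter> y)" using assms by (simp add: cap_homomorphism_def)
  then show ?thesis using assms by (simp add: pre_le_def)
qed

text \<open>Every class has a representative and the induced map sends the class of \<open>b\<close>
  to that of \<open>f b\<close>, so properness can be tested on elements with the preorder.\<close>

lemma proper_hom_iff:
  assumes S: "left_handed_skew_lattice S" and T: "left_handed_skew_lattice T"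
    and f: "cap_homomorphism S T f"
  shows "proper_hom S T f \<longleftrightarrow> (\<forall>c \<in> carrier T. \<exists>b \<in> carrier S. pre_le T c (f b))"
proof -
  interpret S: left_handed_skew_lattice S by (rule S)
  interpret T: left_handed_skew_lattice T by (rule T)
  have fc: "f b \<in> carrier T" if "b \<in> carrier S" for b using f that by (auto simp: cap_homomorphism_def)
  have ind: "induced_hom T f (S.D_class b) = T.D_class (f b)" if b: "b \<in> carrier S" for b
  proof -
    have "(f b, f b') \<in> D_rel T" if "(b, b') \<in> D_rel S" for b'
      using that S.pre_le_hom[OF f] fc by (auto simp: S.D_rel_iff T.D_rel_iff)
    then have "T.D_class (f b') = T.D_class (f b)" if "(b, b') \<in> D_rel S" for b'
      using that equiv_class_eq[OF T.equiv_D_rel] by blast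
    moreover have "(b, b) \<in> D_rel S" using b by (simp add: S.D_rel_iff S.pre_le_refl)
    ultimately show ?thesis unfolding induced_hom_def by blast
  qed
  have "D_meet T (T.D_class c) (T.D_class (f b)) = T.D_class c \<longleftrightarrow> pre_le T c (f b)"
    if "c \<in> carrier T" "b \<in> carrier S" for b c
  proof -
    have "T.D_class (meet T c (f b)) = T.D_class c \<longleftrightarrow> pre_le T c (meet T c (f b))"
      using that fc by (simp add: T.D_class_eq_iff T.meet_closed T.meet_pre_le1)
    also have "\<dots> \<longleftrightarrow> pre_le T c (f b)"
      using that fc[of b] T.meet_pre_le2[of c "f b"] T.pre_le_trans[of c "meet T c (f b)" "f b"]
        T.pre_le_meet[of c "f b" c] T.pre_le_refl[of c] T.meet_closed[of c "f b"] by blast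
    finally show ?thesis using that fc by (simp add: T.D_meet_class)
  qed
  then show ?thesis
    by (simp add: proper_hom_def S.D_quot_eq T.D_quot_eq ind)
qed

lemma BLSBIA_ObjD:
  assumes "S \<in> Obj (BLSBIA :: ('u skew_algebra, 'u \<Rightarrow> 'u) category)"
  shows "left_handed_cap_algebra S" "left_handed_skew_lattice S"
proof -
  interpret skew_boolean_cap_algebra S using assms by (simp add: BLSBIA_def)
  show "left_handed_cap_algebra S" by unfold_locales (use assms in \<open>simp add: BLSBIA_def\<close>)
  then interpret left_handed_cap_algebra S .
  show "left_handed_skew_lattice S" ..
qed

lemma cap_homomorphism_compose:
  assumes "cap_homomorphism S T f" "cap_homomorphism T R g"
    "skew_boolean_cap_algebra S"
  shows "cap_homomorphism S R (compose (carrier S) g f)"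
proof -
  interpret skew_boolean_cap_algebra S by (rule assms(3))
  have "cap S x y \<in> carrier S" if "x \<in> carrier S" "y \<in> carrier S" for x y
    using cap_is_glb[OF that] by (simp add: is_glb_def)
  moreover have "diff S x y \<in> carrier S" if "x \<in> carrier S" "y \<in> carrier S" for x y
    using diff_in_lower_set[OF that] by (simp add: lower_set_def)
  ultimately show ?thesis
    using assms(1,2)
    by (simp add: cap_homomorphism_def compose_def Pi_iff meet_closed join_closed zero_closed)
qed

lemma category_BLSBIA: "is_category (BLSBIA :: ('u skew_algebra, 'u \<Rightarrow> 'u) category)" (is "is_category ?C")
proof
  fix S assume S: "S \<in> Obj ?C"
  interpret left_handed_cap_algebra S using BLSBIA_ObjD(1)[OF S] .
  have hom: "cap_homomorphism S S (restrict (\<lambda>x. x) (carrier S))"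
    by (auto simp: cap_homomorphism_def meet_closed join_closed diff_closed cap_closed zero_closed)
  have "proper_hom S S (restrict (\<lambda>x. x) (carrier S))"
    using left_handed_skew_lattice_axioms pre_le_refl
    by (auto simp: proper_hom_iff[OF _ _ hom])
  with hom show "Ident ?C S \<in> Hom ?C S S" by (simp add: BLSBIA_def)
next
  fix S T R f g
  assume ob: "S \<in> Obj ?C" "T \<in> Obj ?C" "R \<in> Obj ?C" and fg: "f \<in> Hom ?C S T" "g \<in> Hom ?C T R"
  note S = BLSBIA_ObjD(2)[OF ob(1)] and T = BLSBIA_ObjD(2)[OF ob(2)] and R = BLSBIA_ObjD(2)[OF ob(3)]
  interpret T: left_handed_skew_lattice T by (rule T)
  interpret R: left_handed_skew_lattice R by (rule R)
  have f: "cap_homomorphism S T f" and g: "cap_homomorphism T R g"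
    and pr: "proper_hom S T f" "proper_hom T R g"
    using fg by (auto simp: BLSBIA_def)
  have fc: "f b \<in> carrier T" if "b \<in> carrier S" for b using f that by (auto simp: cap_homomorphism_def)
  have gc: "g b \<in> carrier R" if "b \<in> carrier T" for b using g that by (auto simp: cap_homomorphism_def)
  have gf: "cap_homomorphism S R (compose (carrier S) g f)"
    using ob by (intro cap_homomorphism_compose[OF f g]) (simp add: BLSBIA_def)
  have "\<exists>b \<in> carrier S. pre_le R c (compose (carrier S) g f b)" if c: "c \<in> carrier R" for c
  proof -
    obtain d where d: "d \<in> carrier T" "pre_le R c (g d)"
      using pr(2) c by (auto simp: proper_hom_iff[OF T R g])
    then obtain b where b: "b \<in> carrier S" "pre_le T d (f b)"
      using pr(1) by (auto simp: proper_hom_iff[OF S T f])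
    have "pre_le R c (g (f b))"
      using R.pre_le_trans[OF c gc gc d(2) T.pre_le_hom[OF g d(1) fc b(2)]] b d fc by blast
    then show ?thesis using b by (auto simp: compose_def)
  qed
  then have "proper_hom S R (compose (carrier S) g f)"
    by (simp add: proper_hom_iff[OF S R gf])
  with gf show "Comp ?C S T R g f \<in> Hom ?C S R" by (simp add: BLSBIA_def)
next
  fix S T f assume "S \<in> Obj ?C" "T \<in> Obj ?C" "f \<in> Hom ?C S T"
  then show "Comp ?C S S T f (Ident ?C S) = f"
    by (auto simp: BLSBIA_def compose_def fun_eq_iff extensional_def)
next
  fix S T f assume "S \<in> Obj ?C" "T \<in> Obj ?C" "f \<in> Hom ?C S T"
  then show "Comp ?C S T T (Ident ?C T) f = f"
    by (auto simp: BLSBIA_def compose_def fun_eq_iff extensional_def cap_homomorphism_def)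
next
  fix S T R Q f g h
  assume "f \<in> Hom ?C S T"
  then show "Comp ?C S R Q h (Comp ?C S T R g f) = Comp ?C S T Q (Comp ?C T R Q h g) f"
    by (auto simp: BLSBIA_def compose_def fun_eq_iff cap_homomorphism_def)
qed

section \<open>Etale spaces and injective cohomomorphisms\<close>

lemma ESBSE_ObjD:
  assumes "A \<in> Obj ESBSE" shows "etale_object A"
  using assms by unfold_locales (auto simp: ESBSE_def)

lemma Hom_ESBSE_iff:
  "(f, k) \<in> Hom ESBSE B A \<longleftrightarrow> injective_cohomomorphism B A f k \<and>
     f \<in> extensional (topspace (base A)) \<and> k \<in> extensional (topspace (base A)) \<and>
     (\<forall>x \<in> topspace (base A). k x \<in> extensional (stalk B (f x)))"
  by (simp add: ESBSE_def)

lemma injective_cohomomorphismD: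
  assumes "injective_cohomomorphism B A f k"
  shows "continuous_map (base A) (base B) f"
    and "x \<in> topspace (base A) \<Longrightarrow> f x \<in> topspace (base B)"
    and "\<lbrakk>x \<in> topspace (base A); e \<in> stalk B (f x)\<rbrakk> \<Longrightarrow> k x e \<in> stalk A x"
    and "\<lbrakk>openin (base B) U; section_over B U s\<rbrakk> \<Longrightarrow>
      section_over A {x \<in> topspace (base A). f x \<in> U} (\<lambda>x. k x (s (f x)))"
    and "x \<in> topspace (base A) \<Longrightarrow> inj_on (k x) (stalk B (f x))"
  using assms by (auto simp: injective_cohomomorphism_def cohomomorphism_def continuous_map_def)

lemma injective_cohomomorphism_compose:
  assumes fk: "injective_cohomomorphism B A f k" and el: "injective_cohomomorphism A C e l"
  shows "injective_cohomomorphism B C (compose (topspace (base C)) f e)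
     (restrict (\<lambda>w. compose (stalk B (f (e w))) (l w) (k (e w))) (topspace (base C)))"
    (is "injective_cohomomorphism B C ?f ?k")
proof -
  note fk' = injective_cohomomorphismD[OF fk] and el' = injective_cohomomorphismD[OF el]
  have cont: "continuous_map (base C) (base B) ?f"
    by (rule continuous_map_eq[OF continuous_map_compose[OF el'(1) fk'(1)]]) (simp add: compose_def)
  moreover have "?k w \<in> stalk B (?f w) \<rightarrow> stalk C w" if "w \<in> topspace (base C)" for w
    using that fk'(2,3) el'(2,3) by (auto simp: compose_def)
  moreover have "section_over C {x \<in> topspace (base C). ?f x \<in> U} (\<lambda>x. ?k x (s (?f x)))"
    if U: "openin (base B) U" and s: "section_over B U s" for U s
  proof -
    have "section_over C {w \<in> topspace (base C). e w \<in> {x \<in> topspace (base A). f x \<in> U}}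
        (\<lambda>w. l w (k (e w) (s (f (e w)))))"
      using el'(4)[OF openin_continuous_map_preimage[OF fk'(1) U] fk'(4)[OF U s]] .
    moreover have "{w \<in> topspace (base C). e w \<in> {x \<in> topspace (base A). f x \<in> U}}
        = {x \<in> topspace (base C). ?f x \<in> U}"
      using el'(2) by (auto simp: compose_def)
    \<comment> \<open>The extensional composite agrees with the plain one on the relevant points and
      stalks only; this is enough, since \<open>s\<close> takes its values in the stalks.\<close>
    moreover have "section_over C {x \<in> topspace (base C). ?f x \<in> U} (\<lambda>w. l w (k (e w) (s (f (e w)))))
      \<longleftrightarrow> section_over C {x \<in> topspace (base C). ?f x \<in> U} (\<lambda>x. ?k x (s (?f x)))"
      using s U by (intro section_over_cong openin_continuous_map_preimage[OF cont])
        (auto simp: compose_def section_over_iff)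
    ultimately show ?thesis by simp
  qed
  moreover have "inj_on (?k w) (stalk B (?f w))" if w: "w \<in> topspace (base C)" for w
  proof -
    have "inj_on (l w \<circ> k (e w)) (stalk B (f (e w)))"
      using w fk'(2,3,5)[of "e w"] el'(2,5)[of w]
      by (intro comp_inj_on) (auto elim: inj_on_subset)
    then show ?thesis using w by (auto simp: inj_on_def compose_def)
  qed
  ultimately show ?thesis by (simp add: injective_cohomomorphism_def cohomomorphism_def)
qed

lemma category_ESBSE:
  "is_category (ESBSE :: (('u set, 'u set) etale, ('u set, 'u set) etale_mor) category)"
  (is "is_category ?C")
proof
  fix A :: "('u set, 'u set) etale" assume "A \<in> Obj ?C"
  let ?X = "topspace (base A)"
  let ?f = "restrict (\<lambda>x. x) ?X" and ?k = "restrict (\<lambda>x. restrict (\<lambda>e. e) (stalk A x)) ?X"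
  have "section_over A {x \<in> ?X. ?f x \<in> U} (\<lambda>x. ?k x (s (?f x)))"
    if U: "openin (base A) U" and s: "section_over A U s" for U s
  proof -
    have *: "{x \<in> ?X. ?f x \<in> U} = U" using openin_subset[OF U] by auto
    have "section_over A U s \<longleftrightarrow> section_over A U (\<lambda>x. ?k x (s (?f x)))"
      using U s openin_subset[OF U] by (intro section_over_cong) (auto simp: section_over_iff)
    then show ?thesis using s unfolding * by simp
  qed
  moreover have "continuous_map (base A) (base A) ?f"
    by (rule continuous_map_eq[OF continuous_map_id]) simp
  ultimately show "Ident ?C A \<in> Hom ?C A A"
    by (simp add: ESBSE_def injective_cohomomorphism_def cohomomorphism_def inj_on_def)
next
  fix B A C :: "('u set, 'u set) etale" and m n
  assume "m \<in> Hom ?C B A" "n \<in> Hom ?C A C"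
  moreover obtain f k e l where "m = (f, k)" "n = (e, l)" by (cases m; cases n) auto
  ultimately show "Comp ?C B A C n m \<in> Hom ?C B C"
    using injective_cohomomorphism_compose[of B A f k C e l]
    by (simp add: ESBSE_def compose_extensional compose_eq)
next
  fix B A :: "('u set, 'u set) etale" and m
  assume "m \<in> Hom ?C B A"
  then obtain f k where m: "m = (f, k)" "(f, k) \<in> Hom ?C B A" by (cases m) auto
  note h = m(2)[unfolded Hom_ESBSE_iff]
  note h' = injective_cohomomorphismD[OF conjunct1[OF h]]
  show "Comp ?C B B A m (Ident ?C B) = m"
    using h h'(2) by (auto simp: ESBSE_def m(1) compose_def fun_eq_iff extensional_def)
  show "Comp ?C B A A (Ident ?C A) m = m"
    using h h'(2,3) by (auto simp: ESBSE_def m(1) compose_def fun_eq_iff extensional_def)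
next
  fix B A C D :: "('u set, 'u set) etale" and m n p
  assume hom: "m \<in> Hom ?C B A" "n \<in> Hom ?C A C" "p \<in> Hom ?C C D"
  obtain f k e l d j where eq: "m = (f, k)" "n = (e, l)" "p = (d, j)" by (cases m; cases n; cases p) auto
  have "injective_cohomomorphism B A f k" "injective_cohomomorphism A C e l" "injective_cohomomorphism C D d j"
    using hom by (simp_all add: eq Hom_ESBSE_iff)
  note h = injective_cohomomorphismD[OF this(1)] injective_cohomomorphismD[OF this(2)]
    injective_cohomomorphismD[OF this(3)]
  show "Comp ?C B C D p (Comp ?C B A C n m) = Comp ?C B A D (Comp ?C A C D p n) m"
    using h(2,3,7,8,12,13) by (auto simp: ESBSE_def eq compose_def fun_eq_iff)
qed

section \<open>The functor of clopen sections\<close>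

text \<open>The guard is needed because outside the base space \<open>f\<close> has an unspecified
  value, which may happen to lie in \<open>dom P\<close>.\<close>

definition pull_section ::
    "('d, 'x) etale \<Rightarrow> ('x \<Rightarrow> 'y) \<Rightarrow> ('x \<Rightarrow> 'e \<Rightarrow> 'd) \<Rightarrow> ('y \<rightharpoonup> 'e) \<Rightarrow> ('x \<rightharpoonup> 'd)" where
  "pull_section A f k P = (\<lambda>x. if x \<in> topspace (base A) then map_option (k x) (P (f x)) else None)"

lemma dom_pull_section: "dom (pull_section A f k P) = {x \<in> topspace (base A). f x \<in> dom P}"
  by (auto simp: pull_section_def split: if_splits)

lemma restrict_map_superset: "dom P \<subseteq> U \<Longrightarrow> P |` U = P"
  by (rule ext) (metis domIff restrict_in restrict_out subsetD)

lemma pull_section_csections: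
  assumes fk: "injective_cohomomorphism B A f k" and P: "P \<in> csections B"
  shows "pull_section A f k P \<in> csections A"
proof -
  have "pull_section A f k P =
      (\<lambda>x. if x \<in> {x \<in> topspace (base A). f x \<in> dom P} then Some (k x (the (P (f x)))) else None)"
    by (auto simp: pull_section_def fun_eq_iff)
  also have "\<dots> \<in> csections A"
    using injective_cohomomorphismD(1,4)[OF fk] csectionsD(1)[OF P] csections_section_over[OF P]
    by (intro section_over_csections clopenin_preimage) (auto simp: clopenin_def)
  finally show ?thesis .
qed

lemma pull_section_ops:
  "pull_section A f k (P |` dom Q) = pull_section A f k P |` dom (pull_section A f k Q)"
  "pull_section A f k (P |` (- dom Q)) = pull_section A f k P |` (- dom (pull_section A f k Q))"
  "pull_section A f k (P ++ Q) = pull_section A f k P ++ pull_section A f k Q"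
  "pull_section A f k Map.empty = Map.empty"
  by (auto simp: pull_section_def restrict_map_def map_add_def fun_eq_iff dom_def split: option.split)

text \<open>Here injectivity on stalks enters: the pulled back sections may agree at
  \<open>x\<close> only if the original ones agree at \<open>f x\<close>.\<close>

lemma pull_section_cap:
  assumes fk: "injective_cohomomorphism B A f k" and P: "P \<in> csections B" and Q: "Q \<in> csections B"
  shows "pull_section A f k (map_cap P Q) = map_cap (pull_section A f k P) (pull_section A f k Q)"
proof
  fix x
  have "P (f x) = Q (f x)" if x: "x \<in> topspace (base A)"
    "map_option (k x) (P (f x)) = map_option (k x) (Q (f x))"
  proof (cases "P (f x)")
    case (Some e)
    then obtain e' where "Q (f x) = Some e'" "k x e = k x e'" using x by (cases "Q (f x)") auto
    then show ?thesis
      using injective_cohomomorphismD(5)[OF fk x(1)] csectionsD(2)[OF P Some] csectionsD(2)[OF Q] Some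
      by (auto dest: inj_onD)
  qed (use x in auto)
  then show "pull_section A f k (map_cap P Q) x = map_cap (pull_section A f k P) (pull_section A f k Q) x"
    by (auto simp: pull_section_def map_cap_def)
qed

text \<open>The domains of the pulled back sections tell which clopen sections are defined at
  \<open>f x\<close>, and in a Hausdorff space with enough clopen sections this determines the
  point. The value of \<open>k x\<close> at \<open>e\<close> is then read off from a section through
  \<open>e\<close>.\<close>

lemma pull_section_inject:
  assumes B: "boolean_etale B"
    and fk: "injective_cohomomorphism B A f k" and fk': "injective_cohomomorphism B A f' k'"
    and eq: "\<And>P. P \<in> csections B \<Longrightarrow> pull_section A f k P = pull_section A f' k' P"
    and x: "x \<in> topspace (base A)"
  shows "f x = f' x" and "e \<in> stalk B (f x) \<Longrightarrow> k x e = k' x e"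
proof -
  interpret B: boolean_etale B by (rule B)
  have in_top: "f x \<in> topspace (base B)" "f' x \<in> topspace (base B)"
    using x injective_cohomomorphismD(2)[OF fk] injective_cohomomorphismD(2)[OF fk'] by auto
  have dom_eq: "f x \<in> dom P \<longleftrightarrow> f' x \<in> dom P" if "P \<in> csections B" for P
    using arg_cong[OF eq[OF that], of dom] x by (auto simp: dom_pull_section)
  show f: "f x = f' x"
  proof (rule ccontr)
    assume "f x \<noteq> f' x"
    then obtain U where U: "openin (base B) U" "f x \<in> U" "f' x \<notin> U"
      using B.boolean in_top unfolding boolean_space_def Hausdorff_space_def disjnt_def by blast
    obtain e where "e \<in> stalk B (f x)"
      using B.etale in_top(1) unfolding etale_space_def stalk_def by force
    then obtain P where "P \<in> csections B" "P (f x) = Some e" "dom P \<subseteq> U"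
      using B.ex_csection_through U by blast
    with dom_eq[of P] U(3) show False by blast
  qed
  show "k x e = k' x e" if e: "e \<in> stalk B (f x)"
  proof -
    obtain P where "P \<in> csections B" "P (f x) = Some e"
      using B.ex_csection_through[OF e openin_topspace in_top(1)] by blast
    then show ?thesis using fun_cong[OF eq[of P], of x] x f by (simp add: pull_section_def)
  qed
qed

section \<open>From homomorphisms of section algebras to cohomomorphisms\<close>

text \<open>A homomorphism with the codes stripped off; \<open>H_proper\<close> is properness seen
  at a single point.\<close>

locale section_hom = A: etale_object A + B: etale_object B
  for B :: "('e, 'y) etale" and A :: "('d, 'x) etale" +
  fixes H :: "('y \<rightharpoonup> 'e) \<Rightarrow> ('x \<rightharpoonup> 'd)"
  assumes H_mem: "P \<in> csections B \<Longrightarrow> H P \<in> csections A"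
    and H_meet: "\<lbrakk>P \<in> csections B; Q \<in> csections B\<rbrakk> \<Longrightarrow> H (P |` dom Q) = H P |` dom (H Q)"
    and H_join: "\<lbrakk>P \<in> csections B; Q \<in> csections B\<rbrakk> \<Longrightarrow> H (P ++ Q) = H P ++ H Q"
    and H_diff: "\<lbrakk>P \<in> csections B; Q \<in> csections B\<rbrakk> \<Longrightarrow> H (P |` (- dom Q)) = H P |` (- dom (H Q))"
    and H_cap: "\<lbrakk>P \<in> csections B; Q \<in> csections B\<rbrakk> \<Longrightarrow> H (map_cap P Q) = map_cap (H P) (H Q)"
    and H_empty: "H Map.empty = Map.empty"
    and H_proper: "x \<in> topspace (base A) \<Longrightarrow> \<exists>P \<in> csections B. x \<in> dom (H P)"
begin

text \<open>If no \<open>y\<close> works, the domains of the sections whose image is undefined at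
  \<open>x\<close> cover the base of \<open>B\<close>: a witness \<open>P\<close> against
  \<open>y\<close> either is such a section or becomes one on replacing it by its complement in a
  global section \<open>M\<close>. Compactness glues finitely many of them into one section defined
  everywhere with image undefined at \<open>x\<close>, and then the image of \<open>M\<close> is
  undefined at \<open>x\<close> too, against properness.\<close>

lemma ex_dual_point:
  assumes x: "x \<in> topspace (base A)"
  shows "\<exists>y \<in> topspace (base B). \<forall>P \<in> csections B. x \<in> dom (H P) \<longleftrightarrow> y \<in> dom P"
proof (rule ccontr)
  assume contra: "\<not> ?thesis"
  obtain M where M: "M \<in> csections B" "dom M = topspace (base B)" by (rule B.ex_global_csection)
  \<comment> \<open>Properness only gives some section whose image is defined at \<open>x\<close>;
    the global section dominates it.\<close>
  have le_M: "x \<in> dom (H M)" if "P \<in> csections B" "x \<in> dom (H P)" for P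
  proof -
    have "P |` dom M = P"
      using clopenin_subset[OF csectionsD(1)[OF that(1)]] M(2) by (simp add: restrict_map_superset)
    then show ?thesis using H_meet[OF that(1) M(1)] that(2)
      by (metis Int_iff dom_restrict)
  qed
  have xM: "x \<in> dom (H M)" using H_proper[OF x] le_M by blast
  let ?\<N> = "{P \<in> csections B. x \<notin> dom (H P)}"
  have "\<exists>P \<in> ?\<N>. y \<in> dom P" if y: "y \<in> topspace (base B)" for y
  proof -
    obtain P where P: "P \<in> csections B" "(x \<in> dom (H P)) \<noteq> (y \<in> dom P)" using contra y by blast
    show ?thesis
    proof (cases "x \<in> dom (H P)")
      case True
      then have "M |` (- dom P) \<in> ?\<N>" "y \<in> dom (M |` (- dom P))"
        using P(1,2) M True y H_diff[OF M(1) P(1)] csections_restrict_compl[OF M(1) csectionsD(1)[OF P(1)]]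
        by (simp_all add: dom_restrict)
      then show ?thesis by blast
    qed (use P in blast)
  qed
  then have "topspace (base B) \<subseteq> \<Union> (dom ` ?\<N>)" by auto
  moreover have "\<forall>U \<in> dom ` ?\<N>. openin (base B) U"
    using csectionsD(1) by (auto simp: clopenin_def)
  ultimately obtain \<F> where \<F>: "finite \<F>" "\<F> \<subseteq> dom ` ?\<N>" "topspace (base B) \<subseteq> \<Union>\<F>"
    using B.boolean unfolding boolean_space_def compact_space_alt by meson
  obtain \<G> where \<G>: "finite \<G>" "\<G> \<subseteq> ?\<N>" "topspace (base B) \<subseteq> \<Union> (dom ` \<G>)"
    using finite_subset_image[OF \<F>(1,2)] \<F>(3) by auto
  have "\<exists>P \<in> csections B. dom P = \<Union> (dom ` \<G>) \<and> x \<notin> dom (H P)"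
    by (rule csections_finite_union[OF \<G>(1)]) (use \<G>(2) in \<open>auto simp: H_empty H_join\<close>)
  then obtain P where P: "P \<in> csections B" "dom P = \<Union> (dom ` \<G>)" "x \<notin> dom (H P)" by blast
  have "M |` dom P = M"
    using \<G>(3) M(2) P(2) by (simp add: restrict_map_superset)
  then show False using H_meet[OF M(1) P(1)] xM P(3) by (metis Int_iff dom_restrict)
qed

definition dual where
  "dual = (\<lambda>x \<in> topspace (base A). SOME y. y \<in> topspace (base B) \<and>
     (\<forall>P \<in> csections B. x \<in> dom (H P) \<longleftrightarrow> y \<in> dom P))"

lemma dual:
  assumes "x \<in> topspace (base A)"
  shows dual_in: "dual x \<in> topspace (base B)"
    and dual_dom: "P \<in> csections B \<Longrightarrow> dual x \<in> dom P \<longleftrightarrow> x \<in> dom (H P)"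
  using someI_ex[OF ex_dual_point[OF assms, unfolded Bex_def]] assms by (auto simp: dual_def)

lemma H_subset: "P \<in> csections B \<Longrightarrow> x \<in> dom (H P) \<Longrightarrow> x \<in> topspace (base A)"
  using clopenin_subset[OF csectionsD(1)[OF H_mem]] by blast

text \<open>Agreement at a point is membership in the domain of \<open>map_cap\<close>, and
  \<open>dual\<close> transfers domains. From right to left this makes \<open>fibre_map\<close>
  independent of the chosen section, from left to right it makes it injective.\<close>

lemma H_eq_iff:
  assumes x: "x \<in> topspace (base A)" and P: "P \<in> csections B" "P (dual x) = Some e"
    and Q: "Q \<in> csections B" "Q (dual x) = Some e'"
  shows "H P x = H Q x \<longleftrightarrow> e = e'"
proof -
  have "e = e' \<longleftrightarrow> dual x \<in> dom (map_cap P Q)"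
    using P(2) Q(2) by (auto simp: map_cap_def dom_def)
  also have "\<dots> \<longleftrightarrow> x \<in> dom (map_cap (H P) (H Q))"
    using dual_dom[OF x B.csections_cap[OF P(1) Q(1)]] H_cap[OF P(1) Q(1)] by simp
  also have "\<dots> \<longleftrightarrow> H P x = H Q x"
    using dual_dom[OF x P(1)] P(2) by (auto simp: map_cap_def dom_def)
  finally show ?thesis by simp
qed

definition fibre_map where
  "fibre_map = (\<lambda>x \<in> topspace (base A). \<lambda>e \<in> stalk B (dual x).
     the (H (SOME P. P \<in> csections B \<and> P (dual x) = Some e) x))"

lemma fibre_map:
  assumes x: "x \<in> topspace (base A)" and P: "P \<in> csections B" "P (dual x) = Some e"
  shows "H P x = Some (fibre_map x e)"
proof -
  let ?Q = "SOME P. P \<in> csections B \<and> P (dual x) = Some e"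
  have Q: "?Q \<in> csections B" "?Q (dual x) = Some e"
    using someI_ex[of "\<lambda>P. P \<in> csections B \<and> P (dual x) = Some e"] P by blast+
  have "x \<in> dom (H P)" using dual_dom[OF x P(1)] P(2) by blast
  moreover have "H P x = H ?Q x" using H_eq_iff[OF x P Q] by simp
  moreover have "fibre_map x e = the (H ?Q x)"
    using x csectionsD(2)[OF P] by (simp add: fibre_map_def)
  ultimately show ?thesis by (metis domD option.sel)
qed

lemma pull_section_dual:
  assumes P: "P \<in> csections B" shows "pull_section A dual fibre_map P = H P"
proof
  fix x
  show "pull_section A dual fibre_map P x = H P x"
  proof (cases "x \<in> topspace (base A)")
    case True
    then show ?thesis
      using dual_dom[OF True P] fibre_map[OF True P]
      by (cases "P (dual x)") (auto simp: pull_section_def)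
  next
    case False
    then show ?thesis using H_subset[OF P, of x] by (cases "H P x") (auto simp: pull_section_def)
  qed
qed

text \<open>\<open>H\<close> knows only clopen sections, whereas a cohomomorphism is tested on
  sections over arbitrary open sets. Continuity is local, so it suffices to restrict
  \<open>s\<close> to a clopen neighbourhood of \<open>dual x\<close> and use the image of that
  restriction under \<open>H\<close>. Continuity of \<open>dual\<close> follows likewise:
  \<open>dom (H P)\<close> is an open set that \<open>dual\<close> maps into
  \<open>dom P\<close>.\<close>

lemma cohomomorphism_dual: "injective_cohomomorphism B A dual fibre_map"
  unfolding injective_cohomomorphism_def cohomomorphism_def
proof (intro conjI ballI allI impI)
  let ?X = "topspace (base A)"
  have pre: "\<exists>W. openin (base A) W \<and> x \<in> W \<and> W \<subseteq> {x \<in> ?X. dual x \<in> U}"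
    if U: "openin (base B) U" and x: "x \<in> ?X" "dual x \<in> U" for U x
  proof -
    obtain e where "e \<in> stalk B (dual x)"
      using B.etale dual_in[OF x(1)] unfolding etale_space_def stalk_def by force
    then obtain P where P: "P \<in> csections B" "P (dual x) = Some e" "dom P \<subseteq> U"
      using B.ex_csection_through[OF _ U x(2)] by blast
    have "openin (base A) (dom (H P))" using csectionsD(1)[OF H_mem[OF P(1)]] by (simp add: clopenin_def)
    moreover have "x \<in> dom (H P)" using dual_dom[OF x(1) P(1)] P(2) by blast
    moreover have "dom (H P) \<subseteq> {x \<in> ?X. dual x \<in> U}"
      using dual_dom[OF _ P(1)] H_subset[OF P(1)] P(3) by blast
    ultimately show ?thesis by blast
  qed
  have open_pre: "openin (base A) {x \<in> ?X. dual x \<in> U}" if "openin (base B) U" for U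
    using pre[OF that] by (subst openin_subopen) blast
  then show "continuous_map (base A) (base B) dual"
    using dual_in by (simp add: continuous_map_def)
  have thru: "\<exists>P. P \<in> csections B \<and> P (dual x) = Some e" if "x \<in> ?X" "e \<in> stalk B (dual x)" for x e
    using B.ex_csection_through[OF that(2) openin_topspace dual_in[OF that(1)]] by blast
  show "fibre_map x \<in> stalk B (dual x) \<rightarrow> stalk A x" if x: "x \<in> ?X" for x
  proof
    fix e assume "e \<in> stalk B (dual x)"
    then obtain P where P: "P \<in> csections B" "P (dual x) = Some e" using thru x by blast
    from csectionsD(2)[OF H_mem[OF P(1)] fibre_map[OF x P]] show "fibre_map x e \<in> stalk A x" .
  qed
  show "inj_on (fibre_map x) (stalk B (dual x))" if x: "x \<in> ?X" for x
  proof (rule inj_onI)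
    fix e e' assume "e \<in> stalk B (dual x)" "e' \<in> stalk B (dual x)" and eq: "fibre_map x e = fibre_map x e'"
    then obtain P Q where P: "P \<in> csections B" "P (dual x) = Some e"
      and Q: "Q \<in> csections B" "Q (dual x) = Some e'" using thru x by blast
    show "e = e'" using H_eq_iff[OF x P Q] fibre_map[OF x P] fibre_map[OF x Q] eq by simp
  qed
  show "section_over A {x \<in> ?X. dual x \<in> U} (\<lambda>x. fibre_map x (s (dual x)))"
    if "openin (base B) U \<and> section_over B U s" for U s
  proof -
    have U: "openin (base B) U" and s: "section_over B U s" using that by auto
    have st: "s y \<in> stalk B y" if "y \<in> U" for y using s that U by (simp add: section_over_iff)
    have loc: "\<exists>P W. P \<in> csections B \<and> openin (base A) W \<and> x \<in> W \<and>
        (\<forall>x'\<in>W. x' \<in> ?X \<and> dual x' \<in> U \<and> H P x' = Some (fibre_map x' (s (dual x'))))"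
      if x: "x \<in> ?X" "dual x \<in> U" for x
    proof -
      obtain V where V: "clopenin (base B) V" "dual x \<in> V" "V \<subseteq> U" using B.clopen_nbhd[OF U x(2)] .
      let ?P = "\<lambda>y. if y \<in> V then Some (s y) else None"
      have "section_over B V s" using s V(3)
        unfolding section_over_def by (auto intro: continuous_map_from_subtopology_mono)
      then have P: "?P \<in> csections B" using section_over_csections V(1) by blast
      let ?W = "{x \<in> ?X. dual x \<in> V}"
      have "openin (base A) ?W" using V(1) open_pre by (simp add: clopenin_def)
      moreover have "\<forall>x'\<in>?W. H ?P x' = Some (fibre_map x' (s (dual x')))"
        using fibre_map[OF _ P] by simp
      ultimately show ?thesis using P x V by (intro exI[of _ ?P] exI[of _ ?W]) auto
    qed
    have "fibre_map x (s (dual x)) \<in> stalk A x" if x: "x \<in> ?X" "dual x \<in> U" for x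
      using loc[OF x] csectionsD(2)[OF H_mem] by blast
    moreover have "openin (base A) {x \<in> {x \<in> ?X. dual x \<in> U}. fibre_map x (s (dual x)) \<in> V}"
      if V: "openin (total A) V" for V
    proof (subst openin_subopen, intro ballI)
      fix x assume x: "x \<in> {x \<in> {x \<in> ?X. dual x \<in> U}. fibre_map x (s (dual x)) \<in> V}"
      then obtain P W where P: "P \<in> csections B" and W: "openin (base A) W" "x \<in> W"
        "\<forall>x'\<in>W. x' \<in> ?X \<and> dual x' \<in> U \<and> H P x' = Some (fibre_map x' (s (dual x')))"
        using loc by blast
      have "openin (base A) ({x. \<exists>e\<in>V. H P x = Some e} \<inter> W)"
        using csectionsD(3)[OF H_mem[OF P] V] W(1) by (rule openin_Int)
      moreover have "x \<in> {x. \<exists>e\<in>V. H P x = Some e} \<inter> W" using x W by auto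
      moreover have "{x. \<exists>e\<in>V. H P x = Some e} \<inter> W
          \<subseteq> {x \<in> {x \<in> ?X. dual x \<in> U}. fibre_map x (s (dual x)) \<in> V}"
        using W(3) by auto
      ultimately show "\<exists>T. openin (base A) T \<and> x \<in> T \<and>
          T \<subseteq> {x \<in> {x \<in> ?X. dual x \<in> U}. fibre_map x (s (dual x)) \<in> V}" by blast
    qed
    ultimately show ?thesis using open_pre[OF U] by (simp add: section_over_iff)
  qed
qed

end

section \<open>Transport to the universe, functoriality and full faithfulness\<close>

text \<open>The injection is chosen once for each space, so that homomorphisms into and out of its
  algebra use the same code.\<close>

definition section_code :: "('e, 'x) etale \<Rightarrow> ('x \<rightharpoonup> 'e) \<Rightarrow> 'u" where
  "section_code A = (SOME \<iota>. inj_on \<iota> (csections A))"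

definition section_algebra :: "('e, 'x) etale \<Rightarrow> 'u skew_algebra" where
  "section_algebra A = map_algebra (csections A) (section_code A)"

definition sections_functor ::
    "(('u set, 'u set) etale, ('u set, 'u set) etale_mor, 'u skew_algebra, 'u \<Rightarrow> 'u) cat_functor" where
  "sections_functor = \<lparr>onObj = section_algebra,
     onHom = (\<lambda>B A (f, k). \<lambda>a \<in> carrier (section_algebra B :: 'u skew_algebra).
       section_code A (pull_section A f k (inv_into (csections B) (section_code B) a)))\<rparr>"

context
  assumes inf: "infinite (UNIV :: 'u set)"
begin

lemma partial_map_family_section_code:
  assumes A: "A \<in> Obj (ESBSE :: (('u set, 'u set) etale, ('u set, 'u set) etale_mor) category)"
  shows "partial_map_family (csections A) (section_code A :: _ \<Rightarrow> 'u)"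
    and "small TYPE('u) (csections A)"
proof -
  interpret etale_object A using A by (rule ESBSE_ObjD)
  show small: "small TYPE('u) (csections A)"
    using A small_csections[OF inf] by (auto simp: ESBSE_def)
  then obtain \<iota> :: "_ \<Rightarrow> 'u" where "inj_on \<iota> (csections A)"
    by (auto simp: small_def lesspoll_def lepoll_def)
  then have "inj_on (section_code A :: _ \<Rightarrow> 'u) (csections A)"
    unfolding section_code_def by (rule someI[of "\<lambda>\<iota>. inj_on \<iota> (csections A)"])
  then show "partial_map_family (csections A) (section_code A :: _ \<Rightarrow> 'u)"
    by (rule partial_map_family_csections)
qed

lemma section_algebra_Obj:
  assumes A: "A \<in> Obj (ESBSE :: (('u set, 'u set) etale, ('u set, 'u set) etale_mor) category)"
  shows "section_algebra A \<in> Obj (BLSBIA :: ('u skew_algebra, 'u \<Rightarrow> 'u) category)"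
proof -
  interpret partial_map_family "csections A" "section_code A :: _ \<Rightarrow> 'u"
    using A by (rule partial_map_family_section_code)
  have "small TYPE('u) (carrier S)"
    using partial_map_family_section_code(2)[OF A] inj_code
    by (simp add: carrier_map_algebra small_def)
  then show ?thesis
    by (simp add: BLSBIA_def section_algebra_def boolean_lattice_image left_handed
        skew_boolean_cap_algebra_axioms)
qed

lemma sections_functor_hom:
  fixes A B :: "('u set, 'u set) etale"
  assumes B: "B \<in> Obj ESBSE" and fk: "injective_cohomomorphism B A f k" and P: "P \<in> csections B"
  shows "onHom sections_functor B A (f, k) (section_code B P) = section_code A (pull_section A f k P)"
proof -
  interpret partial_map_family "csections B" "section_code B :: _ \<Rightarrow> 'u"
    using B by (rule partial_map_family_section_code)
  show ?thesis using P by (simp add: sections_functor_def section_algebra_def carrier_map_algebra decode)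
qed

lemma functor_sections:
  "is_functor (ESBSE :: (('u set, 'u set) etale, ('u set, 'u set) etale_mor) category)
     (BLSBIA :: ('u skew_algebra, 'u \<Rightarrow> 'u) category) sections_functor"
proof
  fix A :: "('u set, 'u set) etale" assume A: "A \<in> Obj ESBSE"
  show "onObj sections_functor A \<in> Obj (BLSBIA :: ('u skew_algebra, 'u \<Rightarrow> 'u) category)"
    using section_algebra_Obj[OF A] by (simp add: sections_functor_def)
  interpret partial_map_family "csections A" "section_code A :: _ \<Rightarrow> 'u"
    using A by (rule partial_map_family_section_code)
  have id: "pull_section A (\<lambda>x \<in> topspace (base A). x)
      (\<lambda>x \<in> topspace (base A). \<lambda>e \<in> stalk A x. e) P = P" if P: "P \<in> csections A" for P
  proof
    fix x show "pull_section A (\<lambda>x \<in> topspace (base A). x)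
      (\<lambda>x \<in> topspace (base A). \<lambda>e \<in> stalk A x. e) P x = P x"
      using csectionsD(2)[OF P, of x] clopenin_subset[OF csectionsD(1)[OF P]]
      by (cases "P x") (auto simp: pull_section_def)
  qed
  show "onHom sections_functor A A (Ident ESBSE A)
      = Ident (BLSBIA :: ('u skew_algebra, 'u \<Rightarrow> 'u) category) (onObj sections_functor A)"
    by (auto simp: sections_functor_def ESBSE_def BLSBIA_def section_algebra_def
        carrier_map_algebra decode id fun_eq_iff)
next
  fix B A :: "('u set, 'u set) etale" and m
  assume B: "B \<in> Obj ESBSE" and A: "A \<in> Obj ESBSE" and m: "m \<in> Hom ESBSE B A"
  obtain f k where m': "m = (f, k)" by (cases m)
  have fk: "injective_cohomomorphism B A f k" using m by (simp add: m' Hom_ESBSE_iff)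
  interpret A: partial_map_family "csections A" "section_code A :: _ \<Rightarrow> 'u"
    using A by (rule partial_map_family_section_code)
  interpret B: partial_map_family "csections B" "section_code B :: _ \<Rightarrow> 'u"
    using B by (rule partial_map_family_section_code)
  let ?h = "onHom sections_functor B A m"
  note app = sections_functor_hom[OF B fk, folded m'] and mem = pull_section_csections[OF fk]
  have hom: "cap_homomorphism B.S A.S ?h"
    unfolding cap_homomorphism_def
    by (auto simp: B.carrier_map_algebra A.carrier_map_algebra B.zero_map_algebra A.zero_map_algebra
        app mem B.ops_map_algebra A.ops_map_algebra B.mem pull_section_ops
        pull_section_cap[OF fk] simp del: dom_restrict restrict_restrict)
  obtain M where M: "M \<in> csections B" "dom M = topspace (base B)"
    using boolean_etale.ex_global_csection etale_object.axioms(1)[OF ESBSE_ObjD[OF B]] by blast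
  have "proper_hom B.S A.S ?h"
    unfolding proper_hom_iff[OF B.left_handed_skew_lattice_axioms A.left_handed_skew_lattice_axioms hom]
  proof
    fix c assume "c \<in> carrier A.S"
    then obtain P where P: "c = section_code A P" "P \<in> csections A" by (auto simp: A.carrier_map_algebra)
    \<comment> \<open>A global section pulls back to a global section, so one element of the source
      algebra dominates the whole target.\<close>
    have "dom P \<subseteq> dom (pull_section A f k M)"
      using clopenin_subset[OF csectionsD(1)[OF P(2)]] injective_cohomomorphismD(2)[OF fk] M(2)
      by (auto simp: dom_pull_section)
    then show "\<exists>b \<in> carrier B.S. pre_le A.S c (?h b)"
      using M(1) P by (intro bexI[of _ "section_code B M"])
        (simp_all add: app A.pre_le_code mem B.carrier_map_algebra)
  qed
  moreover have "?h \<in> extensional (carrier B.S)"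
    by (simp add: m' sections_functor_def section_algebra_def)
  ultimately show "onHom sections_functor B A m \<in> Hom (BLSBIA :: ('u skew_algebra, 'u \<Rightarrow> 'u) category)
      (onObj sections_functor B) (onObj sections_functor A)"
    using hom by (simp add: BLSBIA_def section_algebra_def) (simp add: sections_functor_def section_algebra_def)
next
  fix B A C :: "('u set, 'u set) etale" and m n
  assume ob: "B \<in> Obj ESBSE" "A \<in> Obj ESBSE" "C \<in> Obj ESBSE"
    and hom: "m \<in> Hom ESBSE B A" "n \<in> Hom ESBSE A C"
  obtain f k e l where eq: "m = (f, k)" "n = (e, l)" by (cases m; cases n)
  have fk: "injective_cohomomorphism B A f k" and el: "injective_cohomomorphism A C e l"
    using hom by (simp_all add: eq Hom_ESBSE_iff)
  interpret B: partial_map_family "csections B" "section_code B :: _ \<Rightarrow> 'u"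
    using ob(1) by (rule partial_map_family_section_code)
  obtain g j where gj: "Comp ESBSE B A C n m = (g, j)" by (cases "Comp ESBSE B A C n m")
  have gj': "g = compose (topspace (base C)) f e"
      "j = restrict (\<lambda>w. compose (stalk B (f (e w))) (l w) (k (e w))) (topspace (base C))"
    using gj by (simp_all add: ESBSE_def eq)
  have inj: "injective_cohomomorphism B C g j"
    unfolding gj' using fk el by (rule injective_cohomomorphism_compose)
  have pull: "pull_section C g j P = pull_section C e l (pull_section A f k P)"
    if P: "P \<in> csections B" for P
  proof
    fix w
    show "pull_section C g j P w = pull_section C e l (pull_section A f k P) w"
      using injective_cohomomorphismD(2)[OF el] csectionsD(2)[OF P, of "f (e w)"]
      by (cases "P (f (e w))") (auto simp: pull_section_def gj' compose_def)
  qed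
  show "onHom sections_functor B C (Comp ESBSE B A C n m) =
      Comp (BLSBIA :: ('u skew_algebra, 'u \<Rightarrow> 'u) category) (onObj sections_functor B)
        (onObj sections_functor A) (onObj sections_functor C)
        (onHom sections_functor A C n) (onHom sections_functor B A m)"
  proof
    fix a
    show "onHom sections_functor B C (Comp ESBSE B A C n m) a =
      Comp (BLSBIA :: ('u skew_algebra, 'u \<Rightarrow> 'u) category) (onObj sections_functor B)
        (onObj sections_functor A) (onObj sections_functor C)
        (onHom sections_functor A C n) (onHom sections_functor B A m) a"
    proof (cases "a \<in> carrier B.S")
      case True
      then obtain P where "a = section_code B P" "P \<in> csections B" by (auto simp: B.carrier_map_algebra)
      moreover have "Comp (BLSBIA :: ('u skew_algebra, 'u \<Rightarrow> 'u) category) (onObj sections_functor B)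
        (onObj sections_functor A) (onObj sections_functor C)
        (onHom sections_functor A C n) (onHom sections_functor B A m) a
        = onHom sections_functor A C n (onHom sections_functor B A m a)"
        using True by (simp add: BLSBIA_def compose_def sections_functor_def section_algebra_def)
      ultimately show ?thesis
        by (simp add: gj[unfolded eq] eq sections_functor_hom[OF ob(1) inj] sections_functor_hom[OF ob(1) fk]
            sections_functor_hom[OF ob(2) el] pull_section_csections[OF fk] pull)
    next
      case False
      then show ?thesis
        by (simp add: gj BLSBIA_def compose_def sections_functor_def section_algebra_def)
    qed
  qed
qed

lemma sections_functor_faithful:
  fixes A B :: "('u set, 'u set) etale"
  assumes ob: "B \<in> Obj ESBSE" "A \<in> Obj ESBSE" and hom: "m \<in> Hom ESBSE B A" "n \<in> Hom ESBSE B A"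
    and eq: "onHom sections_functor B A m = onHom sections_functor B A n"
  shows "m = n"
proof -
  obtain f k f' k' where mn: "m = (f, k)" "n = (f', k')" by (cases m; cases n)
  have fk: "injective_cohomomorphism B A f k" and fk': "injective_cohomomorphism B A f' k'"
    and ext: "f \<in> extensional (topspace (base A))" "f' \<in> extensional (topspace (base A))"
      "k \<in> extensional (topspace (base A))" "k' \<in> extensional (topspace (base A))"
      "\<And>x. x \<in> topspace (base A) \<Longrightarrow> k x \<in> extensional (stalk B (f x))"
      "\<And>x. x \<in> topspace (base A) \<Longrightarrow> k' x \<in> extensional (stalk B (f' x))"
    using hom by (simp_all add: mn Hom_ESBSE_iff)
  interpret A: partial_map_family "csections A" "section_code A :: _ \<Rightarrow> 'u"
    using ob(2) by (rule partial_map_family_section_code)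
  have pull: "pull_section A f k P = pull_section A f' k' P" if P: "P \<in> csections B" for P
    using fun_cong[OF eq, of "section_code B P"] P
    by (simp add: mn sections_functor_hom[OF ob(1) fk] sections_functor_hom[OF ob(1) fk']
        A.code_eq_iff pull_section_csections[OF fk] pull_section_csections[OF fk'])
  note inj = pull_section_inject[OF etale_object.axioms(1)[OF ESBSE_ObjD[OF ob(1)]] fk fk' pull]
  have "f = f'" by (rule extensionalityI[OF ext(1,2)]) (rule inj(1))
  moreover have "k = k'"
  proof (rule extensionalityI[OF ext(3,4)])
    fix x assume x: "x \<in> topspace (base A)"
    show "k x = k' x"
      using ext(5,6)[OF x] inj[OF _ x] \<open>f = f'\<close> by (intro extensionalityI[of _ "stalk B (f x)"]) auto
  qed
  ultimately show ?thesis by (simp add: mn)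
qed

lemma sections_functor_full:
  fixes A B :: "('u set, 'u set) etale"
  assumes ob: "B \<in> Obj ESBSE" "A \<in> Obj ESBSE"
    and h: "h \<in> Hom (BLSBIA :: ('u skew_algebra, 'u \<Rightarrow> 'u) category)
      (onObj sections_functor B) (onObj sections_functor A)"
  shows "\<exists>m \<in> Hom ESBSE B A. onHom sections_functor B A m = h"
proof -
  interpret A: partial_map_family "csections A" "section_code A :: _ \<Rightarrow> 'u"
    using ob(2) by (rule partial_map_family_section_code)
  interpret B: partial_map_family "csections B" "section_code B :: _ \<Rightarrow> 'u"
    using ob(1) by (rule partial_map_family_section_code)
  have hom: "cap_homomorphism B.S A.S h" and pr: "proper_hom B.S A.S h"
    and ext: "h \<in> extensional (carrier B.S)"
    using h by (simp_all add: BLSBIA_def sections_functor_def section_algebra_def)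
  define H where "H P = inv_into (csections A) (section_code A) (h (section_code B P))" for P
  have H: "H P \<in> csections A" "h (section_code B P) = section_code A (H P)"
    if "P \<in> csections B" for P
  proof -
    have "h (section_code B P) \<in> section_code A ` csections A"
      using hom that by (auto simp: cap_homomorphism_def B.carrier_map_algebra A.carrier_map_algebra)
    then show "H P \<in> csections A" "h (section_code B P) = section_code A (H P)"
      unfolding H_def by (auto simp: A.decode)
  qed
  have HI: "H P = Q" if "P \<in> csections B" "Q \<in> csections A" "h (section_code B P) = section_code A Q" for P Q
    using that H by (metis A.code_eq_iff)
  interpret H: section_hom B A H
  proof (intro section_hom.intro section_hom_axioms.intro ESBSE_ObjD ob, goal_cases)
    case (1 P) then show ?case by (rule H(1))
  next
    case (2 P Q) then show ?case
      using hom H[of P] H[of Q] by (intro HI A.mem B.mem)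
        (auto simp: cap_homomorphism_def B.carrier_map_algebra simp flip: B.ops_map_algebra A.ops_map_algebra)
  next
    case (3 P Q) then show ?case
      using hom H[of P] H[of Q] by (intro HI A.mem B.mem)
        (auto simp: cap_homomorphism_def B.carrier_map_algebra simp flip: B.ops_map_algebra A.ops_map_algebra)
  next
    case (4 P Q) then show ?case
      using hom H[of P] H[of Q] by (intro HI A.mem B.mem)
        (auto simp: cap_homomorphism_def B.carrier_map_algebra simp flip: B.ops_map_algebra A.ops_map_algebra)
  next
    case (5 P Q) then show ?case
      using hom H[of P] H[of Q] by (intro HI A.mem B.mem)
        (auto simp: cap_homomorphism_def B.carrier_map_algebra simp flip: B.ops_map_algebra A.ops_map_algebra)
  next
    case 6 show ?case
      using hom by (intro HI A.mem B.mem)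
        (simp add: cap_homomorphism_def B.zero_map_algebra A.zero_map_algebra)
  next
    case (7 x)
    \<comment> \<open>Properness applied to a global section of \<open>A\<close> yields one
      \<open>P\<close> whose image is defined at every point.\<close>
    obtain M where M: "M \<in> csections A" "dom M = topspace (base A)"
      using boolean_etale.ex_global_csection etale_object.axioms(1)[OF ESBSE_ObjD[OF ob(2)]] by blast
    have "section_code A M \<in> carrier A.S" using M by (simp add: A.carrier_map_algebra)
    then obtain b where b: "b \<in> carrier B.S" "pre_le A.S (section_code A M) (h b)"
      using pr proper_hom_iff[OF B.left_handed_skew_lattice_axioms A.left_handed_skew_lattice_axioms hom]
      by blast
    then obtain P where P: "b = section_code B P" "P \<in> csections B" by (auto simp: B.carrier_map_algebra)
    then have "dom M \<subseteq> dom (H P)" using b H[OF P(2)] M(1) by (simp add: A.pre_le_code)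
    then show ?case using M 7 P by blast
  qed
  have "(H.dual, H.fibre_map) \<in> Hom ESBSE B A"
    using H.cohomomorphism_dual by (simp add: Hom_ESBSE_iff H.dual_def H.fibre_map_def)
  moreover have "onHom sections_functor B A (H.dual, H.fibre_map) = h"
  proof (rule extensionalityI[OF _ ext])
    show "onHom sections_functor B A (H.dual, H.fibre_map) \<in> extensional (carrier B.S)"
      by (simp add: sections_functor_def section_algebra_def)
    fix a assume "a \<in> carrier B.S"
    then obtain P where "a = section_code B P" "P \<in> csections B" by (auto simp: B.carrier_map_algebra)
    then show "onHom sections_functor B A (H.dual, H.fibre_map) a = h a"
      by (simp add: sections_functor_hom[OF ob(1) H.cohomomorphism_dual] H.pull_section_dual H)
  qed
  ultimately show ?thesis by blast
qed

end

section \<open>The spectrum of an algebra\<close>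

text \<open>This is a topology once \<open>\<B>\<close> is closed under binary intersections; its
  space is then the union of \<open>\<B>\<close>.\<close>

definition base_topology :: "'a set set \<Rightarrow> 'a topology" where
  "base_topology \<B> = topology (\<lambda>U. \<forall>x\<in>U. \<exists>B\<in>\<B>. x \<in> B \<and> B \<subseteq> U)"

lemma openin_base_topology:
  assumes "\<And>B C. \<lbrakk>B \<in> \<B>; C \<in> \<B>\<rbrakk> \<Longrightarrow> B \<inter> C \<in> \<B>"
  shows "openin (base_topology \<B>) U \<longleftrightarrow> (\<forall>x\<in>U. \<exists>B\<in>\<B>. x \<in> B \<and> B \<subseteq> U)"
proof -
  have "istopology (\<lambda>U. \<forall>x\<in>U. \<exists>B\<in>\<B>. x \<in> B \<and> B \<subseteq> U)"
    unfolding istopology_def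
  proof (intro conjI allI impI ballI)
    fix S T x
    assume "\<forall>x\<in>S. \<exists>B\<in>\<B>. x \<in> B \<and> B \<subseteq> S" "\<forall>x\<in>T. \<exists>B\<in>\<B>. x \<in> B \<and> B \<subseteq> T" "x \<in> S \<inter> T"
    then obtain B C where "B \<in> \<B>" "x \<in> B" "B \<subseteq> S" "C \<in> \<B>" "x \<in> C" "C \<subseteq> T" by (meson IntD1 IntD2)
    then show "\<exists>B\<in>\<B>. x \<in> B \<and> B \<subseteq> S \<inter> T" using assms by (intro bexI[of _ "B \<inter> C"]) auto
  next
    fix \<K> :: "'a set set" and x
    assume \<K>: "\<forall>K\<in>\<K>. \<forall>x\<in>K. \<exists>B\<in>\<B>. x \<in> B \<and> B \<subseteq> K" and "x \<in> \<Union>\<K>"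
    then obtain K where K: "K \<in> \<K>" "x \<in> K" by auto
    with \<K> obtain B where "B \<in> \<B>" "x \<in> B" "B \<subseteq> K" by blast
    with K show "\<exists>B\<in>\<B>. x \<in> B \<and> B \<subseteq> \<Union>\<K>" by blast
  qed
  then show ?thesis by (simp add: base_topology_def topology_inverse')
qed

locale spectral_algebra = left_handed_cap_algebra +
  assumes lattice_image: "boolean_lattice_image S"
begin

lemma ex_top: "\<exists>m \<in> carrier S. \<forall>a \<in> carrier S. pre_le S a m"
proof -
  obtain bot top where "boolean_lattice (D_quot S) (D_meet S) (D_join S) bot top"
    using lattice_image unfolding boolean_lattice_image_def by blast
  then interpret B: boolean_lattice "D_quot S" "D_meet S" "D_join S" bot top .
  obtain m where m: "m \<in> carrier S" "top = D_class m" using B.top_in by (auto simp: D_quot_eq)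
  have "pre_le S a m" if a: "a \<in> carrier S" for a
  proof -
    have "D_class (a \<sqinter> m) = D_class a"
      using B.top_greatest[of "D_class a"] a m by (simp add: D_quot_eq D_meet_class)
    then have "pre_le S a (a \<sqinter> m)" using a m by (simp add: D_class_eq_iff meet_closed)
    then show ?thesis using a m meet_pre_le2[of a m] pre_le_trans[of a "a \<sqinter> m" m] by (simp add: meet_closed)
  qed
  with m show ?thesis by blast
qed

text \<open>A representative of the top of \<open>S/\<D>\<close>, the abstract counterpart of a
  global section.\<close>

definition unit_elt where "unit_elt = (SOME m. m \<in> carrier S \<and> (\<forall>a \<in> carrier S. pre_le S a m))"

lemma unit_elt: "unit_elt \<in> carrier S" "a \<in> carrier S \<Longrightarrow> pre_le S a unit_elt"
proof -
  have "unit_elt \<in> carrier S \<and> (\<forall>a \<in> carrier S. pre_le S a unit_elt)"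
    unfolding unit_elt_def by (rule someI_ex) (use ex_top in blast)
  then show "unit_elt \<in> carrier S" "a \<in> carrier S \<Longrightarrow> pre_le S a unit_elt" by auto
qed

text \<open>Read off from the Boolean lattice image, hence stated for the preorder only. It is what
  makes maximal ideals prime.\<close>

lemma distributive:
  assumes "x \<in> carrier S" "y \<in> carrier S" "z \<in> carrier S"
  shows "pre_le S (x \<sqinter> (y \<squnion> z)) ((x \<sqinter> y) \<squnion> (x \<sqinter> z))"
proof -
  obtain bot top where "boolean_lattice (D_quot S) (D_meet S) (D_join S) bot top"
    using lattice_image unfolding boolean_lattice_image_def by blast
  then interpret B: boolean_lattice "D_quot S" "D_meet S" "D_join S" bot top .
  have "D_class (x \<sqinter> (y \<squnion> z)) = D_class ((x \<sqinter> y) \<squnion> (x \<sqinter> z))"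
    using B.distrib[of "D_class x" "D_class y" "D_class z"] assms
    by (simp add: D_quot_eq D_meet_class D_join_class meet_closed join_closed)
  then show ?thesis using assms by (simp add: D_class_eq_iff meet_closed join_closed)
qed

lemma zero_pre_le: "a \<in> carrier S \<Longrightarrow> pre_le S \<zero> a"
  by (simp add: pre_le_def zero_left)

lemma meet_mono:
  assumes "x \<in> carrier S" "x' \<in> carrier S" "y \<in> carrier S" "y' \<in> carrier S" "pre_le S x x'" "pre_le S y y'"
  shows "pre_le S (x \<sqinter> y) (x' \<sqinter> y')"
proof (rule pre_le_meet)
  show "pre_le S (x \<sqinter> y) x'" using assms by (intro pre_le_trans[OF _ _ _ meet_pre_le1] meet_closed)
  show "pre_le S (x \<sqinter> y) y'" using assms by (intro pre_le_trans[OF _ _ _ meet_pre_le2] meet_closed)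
qed (use assms in \<open>auto intro: meet_closed\<close>)

lemma join_mono:
  assumes "x \<in> carrier S" "x' \<in> carrier S" "y \<in> carrier S" "y' \<in> carrier S" "pre_le S x x'" "pre_le S y y'"
  shows "pre_le S (x \<squnion> y) (x' \<squnion> y')"
proof (rule join_pre_le)
  show "pre_le S x (x' \<squnion> y')" using assms by (intro pre_le_trans[OF _ _ _ _ join_pre_le1] join_closed)
  show "pre_le S y (x' \<squnion> y')" using assms by (intro pre_le_trans[OF _ _ _ _ join_pre_le2] join_closed)
qed (use assms in \<open>auto intro: join_closed\<close>)

lemma meet_commute_pre_le:
  "\<lbrakk>x \<in> carrier S; y \<in> carrier S\<rbrakk> \<Longrightarrow> pre_le S (x \<sqinter> y) (y \<sqinter> x)"
  by (intro pre_le_meet meet_pre_le1 meet_pre_le2 meet_closed)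

section \<open>Ideals and prime filters\<close>

text \<open>The preimage in \<open>S\<close> of an ideal of \<open>S/\<D>\<close>: closure under the
  preorder makes it a union of \<open>\<D>\<close>-classes.\<close>

definition ideal :: "'a set \<Rightarrow> bool" where
  "ideal I \<longleftrightarrow> I \<subseteq> carrier S \<and> \<zero> \<in> I \<and>
     (\<forall>a \<in> I. \<forall>b \<in> carrier S. pre_le S b a \<longrightarrow> b \<in> I) \<and> (\<forall>a \<in> I. \<forall>b \<in> I. a \<squnion> b \<in> I)"

lemma idealD:
  assumes "ideal I"
  shows "a \<in> I \<Longrightarrow> a \<in> carrier S" "\<zero> \<in> I" "\<lbrakk>a \<in> I; b \<in> carrier S; pre_le S b a\<rbrakk> \<Longrightarrow> b \<in> I"
    "\<lbrakk>a \<in> I; b \<in> I\<rbrakk> \<Longrightarrow> a \<squnion> b \<in> I"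
  using assms by (auto simp: ideal_def)

text \<open>Prime filters of the lattice \<open>S/\<D>\<close>, lifted to \<open>S\<close>.\<close>

definition points :: "'a set set" where
  "points = {F. F \<subseteq> carrier S \<and> F \<noteq> {} \<and> \<zero> \<notin> F \<and>
     (\<forall>a \<in> carrier S. \<forall>b \<in> carrier S.
        (a \<sqinter> b \<in> F \<longleftrightarrow> a \<in> F \<and> b \<in> F) \<and> (a \<squnion> b \<in> F \<longleftrightarrow> a \<in> F \<or> b \<in> F))}"

text \<open>The ideal generated by \<open>J\<close> and \<open>a\<close>.\<close>

lemma ideal_insert:
  assumes J: "ideal J" and a: "a \<in> carrier S"
  shows "ideal {c \<in> carrier S. \<exists>i \<in> J. pre_le S c (i \<squnion> a)}"
    and "insert a J \<subseteq> {c \<in> carrier S. \<exists>i \<in> J. pre_le S c (i \<squnion> a)}"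
proof -
  note J' = idealD[OF J]
  show "ideal {c \<in> carrier S. \<exists>i \<in> J. pre_le S c (i \<squnion> a)}"
    unfolding ideal_def
  proof (intro conjI ballI impI; (elim CollectE conjE bexE)?)
    show "\<zero> \<in> {c \<in> carrier S. \<exists>i \<in> J. pre_le S c (i \<squnion> a)}"
      using J'(2) zero_pre_le[OF join_closed[OF zero_closed a]] zero_closed by blast
    show "b \<in> {c \<in> carrier S. \<exists>i \<in> J. pre_le S c (i \<squnion> a)}"
      if "b \<in> carrier S" "pre_le S b c" "c \<in> carrier S" "i \<in> J" "pre_le S c (i \<squnion> a)" for b c i
      using that pre_le_trans[OF that(1,3) join_closed[OF J'(1)[OF that(4)] a] that(2,5)] by blast
    show "b \<squnion> c \<in> {c \<in> carrier S. \<exists>i \<in> J. pre_le S c (i \<squnion> a)}"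
      if "b \<in> carrier S" "c \<in> carrier S" "i \<in> J" "j \<in> J" "pre_le S b (i \<squnion> a)" "pre_le S c (j \<squnion> a)" for b c i j
    proof -
      note ij = J'(1)[OF that(3)] J'(1)[OF that(4)] J'(4)[OF that(3,4)]
      have "pre_le S b ((i \<squnion> j) \<squnion> a)"
        by (rule pre_le_trans[OF that(1) _ _ that(5)])
          (use that ij a in \<open>auto intro!: join_mono join_closed join_pre_le1 pre_le_refl\<close>)
      moreover have "pre_le S c ((i \<squnion> j) \<squnion> a)"
        by (rule pre_le_trans[OF that(2) _ _ that(6)])
          (use that ij a in \<open>auto intro!: join_mono join_closed join_pre_le2 pre_le_refl\<close>)
      ultimately have "pre_le S (b \<squnion> c) ((i \<squnion> j) \<squnion> a)"
        using that ij a by (intro join_pre_le join_closed)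
      then show ?thesis using that ij by (blast intro: join_closed)
    qed
  qed blast
  show "insert a J \<subseteq> {c \<in> carrier S. \<exists>i \<in> J. pre_le S c (i \<squnion> a)}"
    using J' a join_pre_le1 join_pre_le2 by blast
qed

text \<open>The prime ideal theorem: by Zorn there is an ideal maximal among those that contain
  \<open>I\<close> and omit \<open>unit_elt\<close>, and its complement is a prime filter.\<close>

lemma ex_prime_filter:
  assumes I: "ideal I" "unit_elt \<notin> I"
  shows "\<exists>F \<in> points. unit_elt \<in> F \<and> F \<inter> I = {}"
proof -
  let ?\<A> = "{J. ideal J \<and> I \<subseteq> J \<and> unit_elt \<notin> J}"
  have "\<exists>J \<in> ?\<A>. \<forall>K \<in> ?\<A>. J \<subseteq> K \<longrightarrow> K = J"
  proof (rule subset_Zorn_nonempty)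
    show "?\<A> \<noteq> {}" using I by blast
    fix \<K> assume \<K>: "\<K> \<noteq> {}" "subset.chain ?\<A> \<K>"
    then have id: "ideal J" "I \<subseteq> J" "unit_elt \<notin> J" if "J \<in> \<K>" for J
      using that by (auto simp: subset.chain_def)
    have "ideal (\<Union>\<K>)"
      unfolding ideal_def
    proof (intro conjI ballI impI)
      show "\<Union>\<K> \<subseteq> carrier S" using id(1) idealD(1) by blast
      show "\<zero> \<in> \<Union>\<K>" using \<K>(1) id(1) idealD(2) by blast
      show "b \<in> \<Union>\<K>" if "a \<in> \<Union>\<K>" "b \<in> carrier S" "pre_le S b a" for a b
        using that id(1) idealD(3) by blast
      fix a b assume "a \<in> \<Union>\<K>" "b \<in> \<Union>\<K>"
      then obtain J K where JK: "J \<in> \<K>" "K \<in> \<K>" "a \<in> J" "b \<in> K" by blast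
      then have "J \<subseteq> K \<or> K \<subseteq> J" using \<K>(2) by (auto simp: subset.chain_def)
      then show "a \<squnion> b \<in> \<Union>\<K>" using JK id(1) idealD(4) by (metis UnionI subsetD)
    qed
    moreover have "I \<subseteq> \<Union>\<K>" using \<K>(1) id(2) by blast
    ultimately show "\<Union>\<K> \<in> ?\<A>" using id(3) by blast
  qed
  then obtain J where "J \<in> ?\<A>" and max': "\<forall>K \<in> ?\<A>. J \<subseteq> K \<longrightarrow> K = J" ..
  then have J: "ideal J" "I \<subseteq> J" "unit_elt \<notin> J" by simp_all
  have max: "K = J" if "ideal K" "J \<subseteq> K" "unit_elt \<notin> K" for K
    using bspec[OF max', of K] that subset_trans[OF J(2) that(2)] by simp
  note J' = idealD[OF J(1)]
  let ?F = "carrier S - J"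
  have ext: "\<exists>i \<in> J. pre_le S unit_elt (i \<squnion> a)" if a: "a \<in> carrier S" "a \<notin> J" for a
    using max[OF ideal_insert(1)[OF J(1) a(1)]] ideal_insert(2)[OF J(1) a(1)] a(2) by blast
  \<comment> \<open>With \<open>unit_elt\<close> below \<open>i \<squnion> a\<close> and
    \<open>j \<squnion> b\<close>, distributivity puts it below
    \<open>j \<squnion> ((i \<squnion> a) \<sqinter> b)\<close>, and puts
    \<open>(i \<squnion> a) \<sqinter> b\<close> below \<open>i \<squnion> (a \<sqinter> b)\<close>.
    So \<open>a \<sqinter> b \<in> J\<close> would force \<open>unit_elt \<in> J\<close>.\<close>
  have meet: "a \<sqinter> b \<notin> J" if ab: "a \<in> carrier S" "b \<in> carrier S" "a \<notin> J" "b \<notin> J" for a b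
  proof
    assume abJ: "a \<sqinter> b \<in> J"
    obtain i j where i: "i \<in> J" "pre_le S unit_elt (i \<squnion> a)" and j: "j \<in> J" "pre_le S unit_elt (j \<squnion> b)"
      using ext[OF ab(1,3)] ext[OF ab(2,4)] by blast
    note ij = J'(1)[OF i(1)] J'(1)[OF j(1)]
    note c = ab(1,2) ij unit_elt(1) join_closed[OF ij(1) ab(1)] join_closed[OF ij(2) ab(2)]
    have "b \<sqinter> (i \<squnion> a) \<in> J"
    proof (rule J'(3))
      show "i \<squnion> (a \<sqinter> b) \<in> J" using i abJ J'(4) by blast
      show "pre_le S (b \<sqinter> (i \<squnion> a)) (i \<squnion> (a \<sqinter> b))"
        by (rule pre_le_trans[OF _ _ _ distributive])
          (use c in \<open>auto intro!: join_mono meet_closed join_closed meet_pre_le2 meet_commute_pre_le\<close>)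
    qed (use c in \<open>auto intro: meet_closed join_closed\<close>)
    then have "(i \<squnion> a) \<sqinter> b \<in> J"
      by (rule J'(3)) (use c in \<open>auto intro: meet_closed join_closed meet_commute_pre_le\<close>)
    then have "j \<squnion> ((i \<squnion> a) \<sqinter> b) \<in> J" using j J'(4) by blast
    then have "unit_elt \<in> J"
    proof (rule J'(3)[OF _ unit_elt(1)])
      have le: "pre_le S unit_elt ((i \<squnion> a) \<sqinter> (j \<squnion> b))" using i j c by (intro pre_le_meet)
      have le': "pre_le S ((i \<squnion> a) \<sqinter> (j \<squnion> b)) (((i \<squnion> a) \<sqinter> j) \<squnion> ((i \<squnion> a) \<sqinter> b))"
        using c by (intro distributive)
      have le'': "pre_le S (((i \<squnion> a) \<sqinter> j) \<squnion> ((i \<squnion> a) \<sqinter> b)) (j \<squnion> ((i \<squnion> a) \<sqinter> b))"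
        using c by (intro join_mono meet_pre_le2 pre_le_refl meet_closed)
      show "pre_le S unit_elt (j \<squnion> ((i \<squnion> a) \<sqinter> b))"
        by (rule pre_le_trans[OF _ _ _ le pre_le_trans[OF _ _ _ le' le'']])
          (use c in \<open>simp_all add: meet_closed join_closed\<close>)
    qed
    with J(3) show False ..
  qed
  have "?F \<in> points"
    unfolding points_def
  proof (intro CollectI conjI ballI)
    show "?F \<noteq> {}" using J(3) unit_elt(1) by blast
    fix a b assume ab: "a \<in> carrier S" "b \<in> carrier S"
    note ab' = ab meet_closed[OF ab] join_closed[OF ab]
    show "a \<sqinter> b \<in> ?F \<longleftrightarrow> a \<in> ?F \<and> b \<in> ?F"
      using ab' meet J'(3) meet_pre_le1[OF ab] meet_pre_le2[OF ab] by blast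
    show "a \<squnion> b \<in> ?F \<longleftrightarrow> a \<in> ?F \<or> b \<in> ?F"
      using ab' J'(3,4) join_pre_le1[OF ab] join_pre_le2[OF ab] by blast
  qed (use J'(2) in auto)
  then show ?thesis using J unit_elt(1) by (intro bexI[of _ ?F]) auto
qed

lemma points:
  assumes "F \<in> points"
  shows point_subset: "a \<in> F \<Longrightarrow> a \<in> carrier S" and point_zero: "\<zero> \<notin> F"
    and point_meet: "\<lbrakk>a \<in> carrier S; b \<in> carrier S\<rbrakk> \<Longrightarrow> a \<sqinter> b \<in> F \<longleftrightarrow> a \<in> F \<and> b \<in> F"
    and point_join: "\<lbrakk>a \<in> carrier S; b \<in> carrier S\<rbrakk> \<Longrightarrow> a \<squnion> b \<in> F \<longleftrightarrow> a \<in> F \<or> b \<in> F"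
  using assms by (auto simp: points_def)

lemma point_up:
  assumes "F \<in> points" "a \<in> F" "b \<in> carrier S" "pre_le S a b" shows "b \<in> F"
  using assms point_meet[OF assms(1), of a b] point_subset[OF assms(1)] by (simp add: pre_le_def)

lemma point_unit: "F \<in> points \<Longrightarrow> unit_elt \<in> F"
  using point_up point_subset unit_elt by (metis (mono_tags, lifting) all_not_in_conv mem_Collect_eq points_def)

lemma point_le: "\<lbrakk>F \<in> points; a \<in> F; b \<in> carrier S; natural_le S a b\<rbrakk> \<Longrightarrow> b \<in> F"
  using point_up natural_le_D(1) point_subset by blast

text \<open>\<open>a\<close> is the join of the disjoint elements \<open>a \<sqinter> b\<close> and
  \<open>diff S a b\<close>, so a prime filter containing \<open>a\<close> contains exactly one of
  them.\<close>

lemma point_diff: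
  assumes F: "F \<in> points" and ab: "a \<in> carrier S" "b \<in> carrier S"
  shows "diff S a b \<in> F \<longleftrightarrow> a \<in> F \<and> b \<notin> F"
proof
  assume d: "diff S a b \<in> F"
  show "a \<in> F \<and> b \<notin> F"
    using point_le[OF F d ab(1) diff_le[OF ab]] point_meet[OF F diff_closed[OF ab] ab(2)] d
      diff_meet_right[OF ab] point_zero[OF F] by auto
next
  assume "a \<in> F \<and> b \<notin> F"
  then show "diff S a b \<in> F"
    using point_join[OF F meet_closed[OF ab] diff_closed[OF ab]] point_meet[OF F ab] diff_join'[OF ab] by auto
qed

text \<open>There are enough points: the elements whose meet with \<open>a\<close> lies below
  \<open>b\<close> form an ideal, which omits the unit when \<open>a\<close> is not below
  \<open>b\<close>. A prime filter avoiding it avoids \<open>b\<close>, and contains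
  \<open>a\<close> because the complement of \<open>a\<close> is in the ideal.\<close>

lemma pre_le_if_points:
  assumes ab: "a \<in> carrier S" "b \<in> carrier S" and sub: "\<And>F. \<lbrakk>F \<in> points; a \<in> F\<rbrakk> \<Longrightarrow> b \<in> F"
  shows "pre_le S a b"
proof (rule ccontr)
  assume nle: "\<not> pre_le S a b"
  let ?I = "{c \<in> carrier S. pre_le S (c \<sqinter> a) b}"
  have id: "ideal ?I"
    unfolding ideal_def
  proof (intro conjI ballI impI; (elim CollectE conjE)?)
    show "\<zero> \<in> ?I" using ab by (simp add: zero_closed zero_left zero_pre_le)
    show "d \<in> ?I" if "d \<in> carrier S" "pre_le S d c" "c \<in> carrier S" "pre_le S (c \<sqinter> a) b" for c d
      using that ab pre_le_trans[OF _ _ _ meet_mono[of d c a a]] by (simp add: meet_closed pre_le_refl)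
    show "c \<squnion> d \<in> ?I"
      if cd: "c \<in> carrier S" "pre_le S (c \<sqinter> a) b" "d \<in> carrier S" "pre_le S (d \<sqinter> a) b" for c d
    proof -
      note cl = ab cd(1,3) join_closed[OF cd(1,3)]
      have "pre_le S (a \<sqinter> c) b" "pre_le S (a \<sqinter> d) b"
        by (rule pre_le_trans[OF _ _ _ meet_commute_pre_le]; use cl cd in \<open>simp add: meet_closed\<close>)+
      then have "pre_le S ((a \<sqinter> c) \<squnion> (a \<sqinter> d)) b"
        using cl by (intro join_pre_le meet_closed)
      then have "pre_le S (a \<sqinter> (c \<squnion> d)) b"
        by (rule pre_le_trans[rotated -1]) (use cl in \<open>auto intro: distributive meet_closed join_closed\<close>)
      then have "pre_le S ((c \<squnion> d) \<sqinter> a) b"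
        by (rule pre_le_trans[rotated -1]) (use cl in \<open>auto intro: meet_commute_pre_le meet_closed\<close>)
      then show ?thesis using cl by simp
    qed
  qed blast
  have "unit_elt \<notin> ?I"
  proof
    assume "unit_elt \<in> ?I"
    moreover have "pre_le S a (unit_elt \<sqinter> a)" using ab unit_elt by (intro pre_le_meet pre_le_refl)
    ultimately show False using nle ab unit_elt pre_le_trans[of a "unit_elt \<sqinter> a" b] by (simp add: meet_closed)
  qed
  then obtain F where F: "F \<in> points" "unit_elt \<in> F" "F \<inter> ?I = {}"
    using ex_prime_filter[OF id] by blast
  have "diff S unit_elt a \<in> ?I"
    using ab unit_elt(1) by (simp add: diff_closed diff_meet_right zero_pre_le)
  then have "a \<in> F" using F ab unit_elt(1) point_diff[OF F(1), of unit_elt a] by blast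
  moreover have "b \<in> ?I" using ab by (simp add: meet_pre_le1)
  ultimately show False using sub F by blast
qed

section \<open>Germs of elements at prime filters\<close>

definition basic :: "'a \<Rightarrow> 'a set set" where "basic a = {F \<in> points. a \<in> F}"

text \<open>\<open>cap S a b \<in> F\<close> says that \<open>a\<close> and \<open>b\<close> agree at \<open>F\<close>.\<close>

definition germ :: "'a set \<Rightarrow> 'a \<Rightarrow> 'a set" where "germ F a = {b \<in> carrier S. cap S a b \<in> F}"

definition germs :: "'a \<Rightarrow> 'a set set" where "germs a = (\<lambda>F. germ F a) ` basic a"

text \<open>A germ carries no label for its base point, but it generates the filter, so the
  projection is the upward closure. Points and germs are both subsets of the carrier, which fits the
  types of \<open>ESBSE\<close>.\<close>

definition spec :: "('a set, 'a set) etale" where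
  "spec = \<lparr>total = base_topology (germs ` carrier S), base = base_topology (basic ` carrier S),
     proj = (\<lambda>P. {c \<in> carrier S. \<exists>b \<in> P. pre_le S b c})\<rparr>"

lemma cap_mem_point:
  assumes "F \<in> points" "a \<in> carrier S" "b \<in> carrier S" "cap S a b \<in> F" shows "a \<in> F" "b \<in> F"
  using assms point_le[OF assms(1,4)] by (auto intro: cap_le1 cap_le2)

lemma self_germ: "\<lbrakk>F \<in> points; a \<in> F\<rbrakk> \<Longrightarrow> a \<in> germ F a"
  using point_subset[of F a] by (simp add: germ_def cap_absorb natural_le_def meet_idem)

text \<open>The two intersections lie below \<open>b\<close> and therefore commute; their meet lies
  in \<open>F\<close> and below both \<open>a\<close> and \<open>c\<close>, hence below
  \<open>cap S a c\<close>.\<close>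

lemma cap_mem_trans:
  assumes F: "F \<in> points" and abc: "a \<in> carrier S" "b \<in> carrier S" "c \<in> carrier S"
    and "cap S a b \<in> F" "cap S b c \<in> F"
  shows "cap S a c \<in> F"
proof -
  let ?x = "cap S a b" and ?y = "cap S b c"
  note cl = abc cap_closed[OF abc(1,2)] cap_closed[OF abc(2,3)]
  note cl' = cl meet_closed[OF cl(4,5)]
  have comm: "?x \<sqinter> ?y = ?y \<sqinter> ?x"
    using cl by (intro natural_le_meet_comm[of _ _ b] cap_le1 cap_le2)
  have "natural_le S (?x \<sqinter> ?y) a"
    by (rule natural_le_trans[OF _ _ _ meet_natural_le cap_le1]) (use cl' in auto)
  moreover have "natural_le S (?y \<sqinter> ?x) c"
    by (rule natural_le_trans[OF _ _ _ meet_natural_le cap_le2]) (use cl' comm in auto)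
  ultimately have "natural_le S (?x \<sqinter> ?y) (cap S a c)"
    using cl' comm by (intro cap_greatest) auto
  moreover have "?x \<sqinter> ?y \<in> F" using F cl assms point_meet by simp
  ultimately show ?thesis using F abc point_le cap_closed by blast
qed

lemma germ_eq_iff:
  assumes F: "F \<in> points" and ab: "a \<in> carrier S" "b \<in> F"
  shows "germ F a = germ F b \<longleftrightarrow> cap S a b \<in> F"
proof
  assume "germ F a = germ F b"
  then have "b \<in> germ F a" using self_germ[OF F ab(2)] by simp
  then show "cap S a b \<in> F" by (simp add: germ_def)
next
  assume "cap S a b \<in> F"
  moreover from this have "cap S b a \<in> F" using cap_comm ab F point_subset by metis
  ultimately show "germ F a = germ F b"
    using cap_mem_trans[OF F] ab point_subset[OF F] unfolding germ_def by blast
qed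

lemma germ_le:
  assumes "F \<in> points" "a \<in> F" "b \<in> carrier S" "natural_le S a b"
  shows "germ F a = germ F b"
  using assms germ_eq_iff[OF assms(1) point_subset[OF assms(1,2)] point_le[OF assms]]
    cap_absorb[OF point_subset[OF assms(1,2)] assms(3,4)] by simp

text \<open>An element \<open>c\<close> of \<open>F\<close> dominates \<open>a \<sqinter> c\<close>,
  which belongs to the germ because it is a restriction of \<open>a\<close>.\<close>

lemma proj_germ:
  assumes F: "F \<in> points" and a: "a \<in> F" shows "proj spec (germ F a) = F"
proof
  show "proj spec (germ F a) \<subseteq> F"
    using cap_mem_point(2)[OF F point_subset[OF F a]] point_up[OF F] by (auto simp: spec_def germ_def)
  show "F \<subseteq> proj spec (germ F a)"
  proof
    fix c assume c: "c \<in> F"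
    note cl = point_subset[OF F a] point_subset[OF F c]
    have "a \<sqinter> c \<in> F" using F cl a c point_meet by simp
    then have "a \<sqinter> c \<in> germ F a"
      using self_germ[OF F, of "a \<sqinter> c"] germ_le[OF F _ cl(1) meet_natural_le[OF cl]] by simp
    then show "c \<in> proj spec (germ F a)" using cl meet_pre_le2 by (auto simp: spec_def)
  qed
qed

lemma basic_ops:
  assumes "a \<in> carrier S" "b \<in> carrier S"
  shows "basic (a \<sqinter> b) = basic a \<inter> basic b" "basic (a \<squnion> b) = basic a \<union> basic b"
    "basic (diff S a b) = basic a - basic b"
  using assms by (auto simp: basic_def point_meet point_join point_diff)

lemma basic_unit: "basic unit_elt = points"
  by (auto simp: basic_def point_unit)

lemma basic_zero: "basic \<zero> = {}"
  by (auto simp: basic_def point_zero)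

lemma basic_mono: "\<lbrakk>a \<in> carrier S; b \<in> carrier S; pre_le S a b\<rbrakk> \<Longrightarrow> basic a \<subseteq> basic b"
  by (auto simp: basic_def point_up)

lemma germs_mem_iff:
  assumes "F \<in> points" "a \<in> F" "b \<in> carrier S"
  shows "germ F a \<in> germs b \<longleftrightarrow> cap S a b \<in> F"
proof
  assume "germ F a \<in> germs b"
  then obtain G where G: "G \<in> points" "b \<in> G" "germ F a = germ G b" by (auto simp: germs_def basic_def)
  then have "G = F" using proj_germ[OF assms(1,2)] proj_germ[OF G(1,2)] by simp
  then show "cap S a b \<in> F" using G germ_eq_iff[OF assms(1) point_subset[OF assms(1,2)]] by simp
next
  assume c: "cap S a b \<in> F"
  then have "b \<in> F" using cap_mem_point assms point_subset by blast
  moreover from this have "germ F a = germ F b" using c germ_eq_iff[OF assms(1) point_subset[OF assms(1,2)]] by simp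
  ultimately show "germ F a \<in> germs b" using assms by (auto simp: germs_def basic_def)
qed

text \<open>This makes the sets \<open>germs a\<close> a base of a topology, and later yields clopen
  equalizers.\<close>

lemma germs_cap:
  assumes ab: "a \<in> carrier S" "b \<in> carrier S" shows "germs (cap S a b) = germs a \<inter> germs b"
proof
  show "germs (cap S a b) \<subseteq> germs a \<inter> germs b"
  proof
    fix e assume "e \<in> germs (cap S a b)"
    then obtain F where F: "F \<in> points" "cap S a b \<in> F" "e = germ F (cap S a b)" by (auto simp: germs_def basic_def)
    then have "e = germ F a" "e = germ F b" "a \<in> F" "b \<in> F"
      using germ_le[OF F(1,2)] ab cap_le1[OF ab] cap_le2[OF ab] cap_mem_point[OF F(1) ab] by auto
    then show "e \<in> germs a \<inter> germs b" using F(1) by (auto simp: germs_def basic_def)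
  qed
  show "germs a \<inter> germs b \<subseteq> germs (cap S a b)"
  proof
    fix e assume e: "e \<in> germs a \<inter> germs b"
    then obtain F where F: "F \<in> points" "a \<in> F" "e = germ F a" by (auto simp: germs_def basic_def)
    then have c: "cap S a b \<in> F" using e germs_mem_iff[OF F(1,2) ab(2)] by simp
    then have "e = germ F (cap S a b)" using F germ_le[OF F(1) c ab(1) cap_le1[OF ab]] by simp
    then show "e \<in> germs (cap S a b)" using F c by (auto simp: germs_def basic_def)
  qed
qed

section \<open>The spectrum as an etale space over a Boolean space\<close>

lemma openin_base_spec:
  "openin (base spec) U \<longleftrightarrow> (\<forall>F \<in> U. \<exists>a \<in> carrier S. F \<in> basic a \<and> basic a \<subseteq> U)"
proof -
  have "openin (base spec) U \<longleftrightarrow> (\<forall>F \<in> U. \<exists>B \<in> basic ` carrier S. F \<in> B \<and> B \<subseteq> U)"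
    unfolding spec_def etale.simps
  proof (rule openin_base_topology)
    fix B C assume "B \<in> basic ` carrier S" "C \<in> basic ` carrier S"
    then obtain a b where ab: "a \<in> carrier S" "b \<in> carrier S" and eq: "B = basic a" "C = basic b" by blast
    show "B \<inter> C \<in> basic ` carrier S"
      unfolding eq basic_ops(1)[OF ab, symmetric] by (rule imageI) (rule meet_closed[OF ab])
  qed
  then show ?thesis by simp
qed

lemma openin_total_spec:
  "openin (total spec) U \<longleftrightarrow> (\<forall>e \<in> U. \<exists>a \<in> carrier S. e \<in> germs a \<and> germs a \<subseteq> U)"
proof -
  have "openin (total spec) U \<longleftrightarrow> (\<forall>e \<in> U. \<exists>B \<in> germs ` carrier S. e \<in> B \<and> B \<subseteq> U)"
    unfolding spec_def etale.simps
  proof (rule openin_base_topology)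
    fix B C assume "B \<in> germs ` carrier S" "C \<in> germs ` carrier S"
    then obtain a b where ab: "a \<in> carrier S" "b \<in> carrier S" and eq: "B = germs a" "C = germs b" by blast
    show "B \<inter> C \<in> germs ` carrier S"
      unfolding eq germs_cap[OF ab, symmetric] by (rule imageI) (rule cap_closed[OF ab])
  qed
  then show ?thesis by simp
qed

lemma openin_basic: "a \<in> carrier S \<Longrightarrow> openin (base spec) (basic a)"
  by (auto simp: openin_base_spec)

lemma openin_germs: "a \<in> carrier S \<Longrightarrow> openin (total spec) (germs a)"
  by (auto simp: openin_total_spec)

lemma topspace_base_spec: "topspace (base spec) = points"
proof
  show "topspace (base spec) \<subseteq> points"
    using openin_topspace[of "base spec"] unfolding openin_base_spec basic_def by blast
  show "points \<subseteq> topspace (base spec)"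
    using openin_subset[OF openin_basic[OF unit_elt(1)]] by (simp add: basic_unit)
qed

lemma topspace_total_spec: "topspace (total spec) = {germ F a |F a. F \<in> points \<and> a \<in> F}"
proof
  show "topspace (total spec) \<subseteq> {germ F a |F a. F \<in> points \<and> a \<in> F}"
  proof
    fix e assume "e \<in> topspace (total spec)"
    then obtain a where "e \<in> germs a"
      using openin_topspace[of "total spec"] unfolding openin_total_spec by blast
    then show "e \<in> {germ F a |F a. F \<in> points \<and> a \<in> F}" by (auto simp: germs_def basic_def)
  qed
  show "{germ F a |F a. F \<in> points \<and> a \<in> F} \<subseteq> topspace (total spec)"
    using openin_subset[OF openin_germs] point_subset by (fastforce simp: germs_def basic_def)
qed

lemma stalk_spec: "F \<in> points \<Longrightarrow> stalk spec F = germ F ` F"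
  by (auto simp: stalk_def topspace_total_spec proj_germ)

lemma clopenin_basic: "a \<in> carrier S \<Longrightarrow> clopenin (base spec) (basic a)"
proof -
  assume a: "a \<in> carrier S"
  have "points - basic a = basic (diff S unit_elt a)"
    using a unit_elt(1) by (simp add: basic_ops basic_unit)
  then show ?thesis
    using a openin_basic[OF a] openin_basic[OF diff_closed[OF unit_elt(1) a]] openin_subset[OF openin_basic[OF a]]
    by (simp add: clopenin_def closedin_def topspace_base_spec)
qed

text \<open>The elements whose basic set has a finite subcover form an ideal. If it omitted the
  unit, some prime filter would be disjoint from it; but that filter lies in a member of the cover,
  hence in a basic set inside that member, whose element is in the ideal.\<close>

lemma compact_space_base_spec: "compact_space (base spec)"
  unfolding compact_space_alt
proof (intro allI impI, elim conjE)
  fix \<U> assume \<U>: "\<forall>U\<in>\<U>. openin (base spec) U" and cover: "topspace (base spec) \<subseteq> \<Union>\<U>"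
  let ?I = "{c \<in> carrier S. \<exists>\<V>. finite \<V> \<and> \<V> \<subseteq> \<U> \<and> basic c \<subseteq> \<Union>\<V>}"
  define I where "I = ?I"
  have "ideal I"
    unfolding ideal_def I_def
  proof (intro conjI ballI impI)
    show "\<zero> \<in> ?I" using zero_closed by (auto simp: basic_zero)
    show "b \<in> ?I" if "a \<in> ?I" "b \<in> carrier S" "pre_le S b a" for a b
      using that basic_mono[of b a] by blast
    fix a b assume "a \<in> ?I" "b \<in> ?I"
    then obtain \<V> \<W> where "a \<in> carrier S" "b \<in> carrier S" "finite \<V>" "\<V> \<subseteq> \<U>" "basic a \<subseteq> \<Union>\<V>"
      "finite \<W>" "\<W> \<subseteq> \<U>" "basic b \<subseteq> \<Union>\<W>" by blast
    then show "a \<squnion> b \<in> ?I"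
      by (auto simp: join_closed basic_ops intro!: exI[of _ "\<V> \<union> \<W>"])
  qed blast
  have "unit_elt \<in> I"
  proof (rule ccontr)
    assume "unit_elt \<notin> I"
    then obtain F where F: "F \<in> points" "F \<inter> I = {}" using ex_prime_filter[OF \<open>ideal I\<close>] by blast
    then obtain U where U: "U \<in> \<U>" "F \<in> U" using cover by (auto simp: topspace_base_spec)
    have "openin (base spec) U" using \<U> U(1) by blast
    then obtain a where a: "a \<in> carrier S" "F \<in> basic a" "basic a \<subseteq> U"
      using U(2) unfolding openin_base_spec by blast
    have "a \<in> I" unfolding I_def using a U by (intro CollectI conjI exI[of _ "{U}"]) auto
    then show False using a F by (auto simp: basic_def)
  qed
  then show "\<exists>\<F>. finite \<F> \<and> \<F> \<subseteq> \<U> \<and> topspace (base spec) \<subseteq> \<Union>\<F>"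
    by (simp add: I_def basic_unit topspace_base_spec)
qed

lemma boolean_space_base_spec: "boolean_space (base spec)"
  unfolding boolean_space_def
proof (intro conjI)
  show "compact_space (base spec)" by (rule compact_space_base_spec)
  have sep: "\<exists>U V. openin (base spec) U \<and> openin (base spec) V \<and> F \<in> U \<and> G \<in> V \<and> disjnt U V"
    if FG: "F \<in> points" "G \<in> points" and a: "a \<in> F" "a \<notin> G" for F G a
  proof -
    note c = point_subset[OF FG(1) a(1)]
    have "F \<in> basic a" "G \<in> basic (diff S unit_elt a)" "disjnt (basic a) (basic (diff S unit_elt a))"
      using FG a c unit_elt(1) by (auto simp: basic_ops basic_unit disjnt_def) (auto simp: basic_def)
    then show ?thesis using c unit_elt(1) openin_basic diff_closed by blast
  qed
  show "Hausdorff_space (base spec)"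
    unfolding Hausdorff_space_def topspace_base_spec
  proof (intro allI impI, elim conjE)
    fix F G assume FG: "F \<in> points" "G \<in> points" "F \<noteq> G"
    then consider a where "a \<in> F" "a \<notin> G" | a where "a \<in> G" "a \<notin> F" by blast
    then show "\<exists>U V. openin (base spec) U \<and> openin (base spec) V \<and> F \<in> U \<and> G \<in> V \<and> disjnt U V"
    proof cases
      case 1 then show ?thesis using sep FG by blast
    next
      case 2
      obtain U V where "openin (base spec) U" "openin (base spec) V" "G \<in> U" "F \<in> V" "disjnt U V"
        using sep[OF FG(2,1) 2] by blast
      then show ?thesis by (intro exI[of _ V] exI[of _ U]) (simp add: disjnt_sym)
    qed
  qed
  show "open_base (base spec) {U. clopenin (base spec) U}"
    unfolding open_base_def
  proof (intro conjI ballI allI impI; (elim conjE)?)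
    fix U F assume "openin (base spec) U" "F \<in> U"
    then obtain a where "a \<in> carrier S" "F \<in> basic a" "basic a \<subseteq> U" unfolding openin_base_spec by blast
    then show "\<exists>B\<in>{U. clopenin (base spec) U}. F \<in> B \<and> B \<subseteq> U"
      by (intro bexI[of _ "basic a"]) (simp_all add: clopenin_basic)
  qed (simp add: clopenin_def)
qed

section \<open>Elements as clopen sections of the spectrum\<close>

definition elt_section :: "'a \<Rightarrow> 'a set \<rightharpoonup> 'a set" where
  "elt_section a = (\<lambda>F. if F \<in> basic a then Some (germ F a) else None)"

lemma dom_elt_section: "dom (elt_section a) = basic a"
  by (auto simp: elt_section_def dom_def)

lemma elt_section_csections:
  assumes a: "a \<in> carrier S" shows "elt_section a \<in> csections spec"
  unfolding csections_def
proof (intro CollectI conjI allI impI)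
  show "clopenin (base spec) (dom (elt_section a))" using a by (simp add: dom_elt_section clopenin_basic)
  show "e \<in> stalk spec F" if "elt_section a F = Some e" for F e
    using that by (auto simp: elt_section_def basic_def stalk_spec split: if_splits)
  fix V assume V: "openin (total spec) V"
  show "openin (base spec) {F. \<exists>e\<in>V. elt_section a F = Some e}"
    unfolding openin_base_spec
  proof
    fix F assume "F \<in> {F. \<exists>e\<in>V. elt_section a F = Some e}"
    then have F: "F \<in> points" "a \<in> F" "germ F a \<in> V" by (auto simp: elt_section_def basic_def split: if_splits)
    then obtain b where b: "b \<in> carrier S" "germ F a \<in> germs b" "germs b \<subseteq> V"
      using V unfolding openin_total_spec by blast
    \<comment> \<open>On the basic set of the intersection the germs of \<open>a\<close> are germs
      of \<open>b\<close>, hence in \<open>V\<close>.\<close>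
    let ?c = "cap S a b"
    have c: "?c \<in> carrier S" "?c \<in> F" using a b F germs_mem_iff cap_closed by auto
    have "G \<in> {F. \<exists>e\<in>V. elt_section a F = Some e}" if "G \<in> basic ?c" for G
    proof -
      have G: "G \<in> points" "?c \<in> G" using that by (auto simp: basic_def)
      note aG = cap_mem_point[OF G(1) a b(1) G(2)]
      have "germ G a \<in> germs b" using germs_mem_iff[OF G(1) aG(1) b(1)] G by simp
      then show ?thesis using G aG b(3) by (auto simp: elt_section_def basic_def)
    qed
    then show "\<exists>c\<in>carrier S. F \<in> basic c \<and> basic c \<subseteq> {F. \<exists>e\<in>V. elt_section a F = Some e}"
      using c F(1) by (intro bexI[of _ ?c]) (auto simp: basic_def)
  qed
qed

lemma section_over_germ:
  assumes a: "a \<in> carrier S" shows "section_over spec (basic a) (\<lambda>F. germ F a)"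
proof -
  have "section_over spec (basic a) (\<lambda>F. the (elt_section a F))"
    using csections_section_over[OF elt_section_csections[OF a]] by (simp add: dom_elt_section)
  then show ?thesis
    by (rule section_over_cong[OF openin_basic[OF a], THEN iffD1, rotated]) (simp add: elt_section_def)
qed

lemma continuous_proj_spec: "continuous_map (total spec) (base spec) (proj spec)"
  unfolding continuous_map_def
proof (intro conjI allI impI)
  show "proj spec \<in> topspace (total spec) \<rightarrow> topspace (base spec)"
    by (auto simp: topspace_total_spec topspace_base_spec proj_germ)
  fix U assume U: "openin (base spec) U"
  show "openin (total spec) {e \<in> topspace (total spec). proj spec e \<in> U}"
    unfolding openin_total_spec
  proof
    fix e assume e: "e \<in> {e \<in> topspace (total spec). proj spec e \<in> U}"
    then obtain F a where F: "F \<in> points" "a \<in> F" "e = germ F a" by (auto simp: topspace_total_spec)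
    then have "F \<in> U" using e by (simp add: proj_germ)
    then obtain b where b: "b \<in> carrier S" "F \<in> basic b" "basic b \<subseteq> U" using U unfolding openin_base_spec by blast
    note a = point_subset[OF F(1,2)]
    \<comment> \<open>Restricting \<open>a\<close> to \<open>b\<close> keeps the germ at
      \<open>F\<close> and moves the domain inside \<open>U\<close>.\<close>
    let ?c = "a \<sqinter> b"
    have c: "?c \<in> carrier S" "?c \<in> F" using a b F by (auto simp: meet_closed point_meet basic_def)
    have "e = germ F ?c" using germ_le[OF F(1) c(2) a meet_natural_le[OF a b(1)]] F by simp
    then have "e \<in> germs ?c" using F c by (auto simp: germs_def basic_def)
    moreover have "germs ?c \<subseteq> {e \<in> topspace (total spec). proj spec e \<in> U}"
      using b a by (auto simp: germs_def topspace_total_spec basic_def proj_germ point_meet)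
    ultimately show "\<exists>c\<in>carrier S. e \<in> germs c \<and> germs c \<subseteq> {e \<in> topspace (total spec). proj spec e \<in> U}"
      using c by blast
  qed
qed

lemma proj_germs: "proj spec ` germs a = basic a"
  by (force simp: germs_def basic_def proj_germ image_image)

lemma etale_space_spec: "etale_space spec"
  unfolding etale_space_def local_homeomorphism_def
proof (intro conjI ballI)
  show proj: "proj spec \<in> topspace (total spec) \<rightarrow> topspace (base spec)"
    by (auto simp: topspace_total_spec topspace_base_spec proj_germ)
  show "proj spec ` topspace (total spec) = topspace (base spec)"
  proof
    show "topspace (base spec) \<subseteq> proj spec ` topspace (total spec)"
    proof
      fix F assume "F \<in> topspace (base spec)"
      then have F: "F \<in> points" by (simp add: topspace_base_spec)
      then have "F = proj spec (germ F unit_elt)" using proj_germ point_unit by simp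
      moreover have "germ F unit_elt \<in> topspace (total spec)"
        using F point_unit by (auto simp: topspace_total_spec)
      ultimately show "F \<in> proj spec ` topspace (total spec)" by blast
    qed
  qed (use proj in auto)
  fix e assume "e \<in> topspace (total spec)"
  then obtain F a where F: "F \<in> points" "a \<in> F" "e = germ F a" by (auto simp: topspace_total_spec)
  note a = point_subset[OF F(1,2)]
  have sub: "basic a \<subseteq> topspace (base spec)" "germs a \<subseteq> topspace (total spec)"
    using openin_subset openin_basic[OF a] openin_germs[OF a] by auto
  have "homeomorphic_maps (subtopology (total spec) (germs a)) (subtopology (base spec) (basic a))
      (proj spec) (\<lambda>F. germ F a)"
    unfolding homeomorphic_maps_def
  proof (intro conjI ballI)
    show "continuous_map (subtopology (total spec) (germs a)) (subtopology (base spec) (basic a)) (proj spec)"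
      using continuous_proj_spec proj_germs[of a]
      by (auto simp: continuous_map_in_subtopology continuous_map_from_subtopology)
    show "continuous_map (subtopology (base spec) (basic a)) (subtopology (total spec) (germs a)) (\<lambda>F. germ F a)"
      using section_over_germ[OF a]
      by (auto simp: section_over_def continuous_map_in_subtopology germs_def)
  qed (use sub in \<open>auto simp: germs_def basic_def proj_germ\<close>)
  then have "homeomorphic_map (subtopology (total spec) (germs a)) (subtopology (base spec) (basic a)) (proj spec)"
    using homeomorphic_map_maps by blast
  then show "\<exists>V. openin (total spec) V \<and> e \<in> V \<and> openin (base spec) (proj spec ` V) \<and>
      homeomorphic_map (subtopology (total spec) V) (subtopology (base spec) (proj spec ` V)) (proj spec)"
    using F openin_germs[OF a] openin_basic[OF a]
    by (intro exI[of _ "germs a"]) (auto simp: proj_germs, auto simp: germs_def basic_def)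
qed

text \<open>The device behind \<open>elt_section_ops\<close>: passing to a smaller element of the
  natural order that is still in the filter leaves the germ unchanged.\<close>

lemma elt_section_le:
  assumes "a \<in> carrier S" "b \<in> carrier S" "natural_le S a b" "F \<in> basic a"
  shows "elt_section b F = elt_section a F"
proof -
  have "F \<in> points" "a \<in> F" using assms(4) by (auto simp: basic_def)
  then show ?thesis
    using germ_le[of F a b] point_le[of F a b] assms by (simp add: elt_section_def basic_def)
qed

lemma elt_section_ops:
  assumes ab: "a \<in> carrier S" "b \<in> carrier S"
  shows "elt_section (a \<sqinter> b) = elt_section a |` dom (elt_section b)"
    and "elt_section (a \<squnion> b) = elt_section a ++ elt_section b"
    and "elt_section (diff S a b) = elt_section a |` (- dom (elt_section b))"
    and "elt_section (cap S a b) = map_cap (elt_section a) (elt_section b)"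
    and "elt_section \<zero> = Map.empty"
proof -
  have none: "elt_section c F = None" if "F \<notin> basic c" for c F using that by (simp add: elt_section_def)
  note cl = meet_closed[OF ab] join_closed[OF ab] diff_closed[OF ab] cap_closed[OF ab]
  show "elt_section (a \<sqinter> b) = elt_section a |` dom (elt_section b)"
  proof
    fix F show "elt_section (a \<sqinter> b) F = (elt_section a |` dom (elt_section b)) F"
    proof (cases "F \<in> basic a \<inter> basic b")
      case True
      then have "F \<in> basic (a \<sqinter> b)" by (simp only: basic_ops(1)[OF ab])
      from elt_section_le[OF cl(1) ab(1) meet_natural_le[OF ab] this] True show ?thesis
        by (simp add: dom_elt_section)
    next
      case False
      then have "F \<notin> basic (a \<sqinter> b)" by (simp only: basic_ops(1)[OF ab] not_False_eq_True)
      from none[OF this] False none[of F a] show ?thesis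
        by (auto simp: dom_elt_section restrict_map_def)
    qed
  qed
  show "elt_section (diff S a b) = elt_section a |` (- dom (elt_section b))"
  proof
    fix F show "elt_section (diff S a b) F = (elt_section a |` (- dom (elt_section b))) F"
    proof (cases "F \<in> basic a - basic b")
      case True
      then have "F \<in> basic (diff S a b)" by (simp only: basic_ops(3)[OF ab])
      from elt_section_le[OF cl(3) ab(1) diff_le[OF ab] this] True show ?thesis
        by (simp add: dom_elt_section)
    next
      case False
      then have "F \<notin> basic (diff S a b)" by (simp only: basic_ops(3)[OF ab] not_False_eq_True)
      from none[OF this] False none[of F a] show ?thesis
        by (auto simp: dom_elt_section restrict_map_def)
    qed
  qed
  show "elt_section (a \<squnion> b) = elt_section a ++ elt_section b"
  proof
    fix F
    \<comment> \<open>Outside \<open>b\<close> the join takes the germ of \<open>a\<close>. As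
      \<open>a\<close> need not lie below the join, the comparison goes through
      \<open>diff S a b\<close>, which lies below both.\<close>
    consider "F \<in> basic b" | "F \<in> basic (diff S a b)" "F \<notin> basic b" "F \<in> basic a" | "F \<notin> basic a" "F \<notin> basic b"
      using basic_ops(3)[OF ab] by blast
    then show "elt_section (a \<squnion> b) F = (elt_section a ++ elt_section b) F"
    proof cases
      case 1
      then have "elt_section b F = Some (germ F b)" by (simp add: elt_section_def)
      then show ?thesis using elt_section_le[OF ab(2) cl(2) join_natural_le[OF ab] 1] by simp
    next
      case 2
      then show ?thesis
        using elt_section_le[OF cl(3,2) diff_le_join[OF ab]] elt_section_le[OF cl(3) ab(1) diff_le[OF ab]]
          none[OF 2(2)] by (simp add: map_add_def)
    next
      case 3
      then show ?thesis using none basic_ops(2)[OF ab] by (simp add: map_add_def)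
    qed
  qed
  show "elt_section (cap S a b) = map_cap (elt_section a) (elt_section b)"
  proof
    fix F
    show "elt_section (cap S a b) F = map_cap (elt_section a) (elt_section b) F"
    proof (cases "F \<in> basic (cap S a b)")
      case True
      then show ?thesis
        using elt_section_le[OF cl(4) ab(1) cap_le1[OF ab]] elt_section_le[OF cl(4) ab(2) cap_le2[OF ab]]
        by (simp add: map_cap_def)
    next
      case False
      have "elt_section a F \<noteq> elt_section b F" if F: "F \<in> basic a"
        using that False germ_eq_iff[of F a b] ab by (auto simp: elt_section_def basic_def)
      then show ?thesis using none[OF False] none[of F a] by (cases "F \<in> basic a") (auto simp: map_cap_def)
    qed
  qed
  show "elt_section \<zero> = Map.empty" by (simp add: elt_section_def basic_zero)
qed

text \<open>Equal germs put \<open>cap S a b\<close> into every prime filter containing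
  \<open>a\<close>. With enough points \<open>a\<close> lies below it in the preorder, and since it
  lies below \<open>a\<close> in the natural order the two are equal.\<close>

lemma elt_section_inject:
  assumes ab: "a \<in> carrier S" "b \<in> carrier S" and eq: "elt_section a = elt_section b" shows "a = b"
proof -
  have "a = cap S a b" if ab: "a \<in> carrier S" "b \<in> carrier S" and eq: "elt_section a = elt_section b" for a b
  proof -
    have "pre_le S a (cap S a b)"
    proof (rule pre_le_if_points[OF ab(1) cap_closed[OF ab]])
      fix F assume F: "F \<in> points" "a \<in> F"
      then show "cap S a b \<in> F"
        using fun_cong[OF eq, of F] germ_eq_iff[OF F(1) ab(1), of b]
        by (auto simp: elt_section_def basic_def split: if_splits)
    qed
    then show ?thesis using natural_le_eq[OF cap_closed[OF ab] ab(1) cap_le1[OF ab]] by simp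
  qed
  from this[OF ab eq] this[OF ab(2,1) eq[symmetric]] show ?thesis using cap_comm[OF ab] by simp
qed

text \<open>Elements whose sections are contained in \<open>P\<close> agree with each other on
  overlaps, so by \<open>compatible_join\<close> they are closed under joins. Their basic sets cover
  \<open>dom P\<close>, and by compactness a join of finitely many of them is already
  \<open>P\<close>.\<close>

lemma csection_eq_elt_section:
  assumes P: "P \<in> csections spec" shows "\<exists>a \<in> carrier S. P = elt_section a"
proof -
  let ?\<G> = "{d \<in> carrier S. elt_section d \<subseteq>\<^sub>m P}"
  have le: "P F = Some (germ F d)" if "d \<in> ?\<G>" "F \<in> points" "d \<in> F" for d F
    using that by (force simp: map_le_def dom_elt_section elt_section_def basic_def)
  have join: "c \<squnion> d \<in> ?\<G>" if c: "c \<in> ?\<G>" and d: "d \<in> ?\<G>" for c d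
  proof -
    have cd: "c \<in> carrier S" "d \<in> carrier S" using c d by auto
    have "pre_le S (c \<sqinter> d) (cap S c d)"
    proof (rule pre_le_if_points[OF meet_closed[OF cd] cap_closed[OF cd]])
      fix F assume F: "F \<in> points" "c \<sqinter> d \<in> F"
      then have "c \<in> F" "d \<in> F" using cd by (auto simp: point_meet)
      then show "cap S c d \<in> F" using le[OF c F(1)] le[OF d F(1)] germ_eq_iff[OF F(1) cd(1), of d] by simp
    qed
    then have le_cd: "natural_le S c (c \<squnion> d)" by (rule compatible_join[OF cd])
    have "elt_section (c \<squnion> d) F = P F" if F: "F \<in> basic (c \<squnion> d)" for F
    proof -
      have "F \<in> basic c \<or> F \<in> basic d" using F basic_ops(2)[OF cd] by blast
      then have "elt_section (c \<squnion> d) F = elt_section c F \<and> F \<in> basic c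
          \<or> elt_section (c \<squnion> d) F = elt_section d F \<and> F \<in> basic d"
        using elt_section_le[OF cd(1) join_closed[OF cd] le_cd]
          elt_section_le[OF cd(2) join_closed[OF cd] join_natural_le[OF cd]] by blast
      then show ?thesis using c d by (auto simp: map_le_def dom_elt_section)
    qed
    then show ?thesis using cd by (simp add: map_le_def dom_elt_section join_closed)
  qed
  have cover: "dom P \<subseteq> \<Union> (basic ` ?\<G>)"
  proof
    fix F assume F: "F \<in> dom P"
    then have pt: "F \<in> points"
      using clopenin_subset[OF csectionsD(1)[OF P]] by (auto simp: topspace_base_spec)
    from F obtain e where e: "P F = Some e" by auto
    then obtain b where b: "b \<in> F" "e = germ F b"
      using csectionsD(2)[OF P e] stalk_spec[OF pt] by auto
    note bc = point_subset[OF pt b(1)]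
    have "openin (base spec) {G. \<exists>e\<in>germs b. P G = Some e}"
      by (rule csectionsD(3)[OF P openin_germs[OF bc]])
    moreover have "F \<in> {G. \<exists>e\<in>germs b. P G = Some e}" using e b pt by (auto simp: germs_def basic_def)
    ultimately obtain c where c: "c \<in> carrier S" "F \<in> basic c" "basic c \<subseteq> {G. \<exists>e\<in>germs b. P G = Some e}"
      unfolding openin_base_spec by blast
    \<comment> \<open>\<open>b\<close> has the right germ at \<open>F\<close>, and \<open>c\<close>
      cuts its domain down to where \<open>P\<close> takes values among the germs of
      \<open>b\<close>. There \<open>P\<close> equals the section of \<open>b\<close>, because the
      projection forces the value over \<open>G\<close> to be the germ at \<open>G\<close>.\<close>
    let ?d = "b \<sqinter> c"
    have "elt_section ?d G = P G" if G: "G \<in> basic ?d" for G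
    proof -
      have G': "G \<in> points" "b \<in> G" "c \<in> G" using G bc c by (auto simp: basic_def point_meet)
      then obtain e' where e': "e' \<in> germs b" "P G = Some e'" using c(3) by (auto simp: basic_def)
      then obtain G'' where "G'' \<in> points" "b \<in> G''" "e' = germ G'' b" by (auto simp: germs_def basic_def)
      moreover have "proj spec e' = G" using csectionsD(2)[OF P e'(2)] by (simp add: stalk_def)
      ultimately have "e' = germ G b" by (simp add: proj_germ)
      then show ?thesis using elt_section_le[OF meet_closed[OF bc c(1)] bc meet_natural_le[OF bc c(1)] G] e' G'
        by (simp add: elt_section_def basic_def)
    qed
    then have "?d \<in> ?\<G>" using bc c by (simp add: map_le_def dom_elt_section meet_closed)
    moreover have "F \<in> basic ?d" using pt b bc c by (auto simp: basic_def point_meet)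
    ultimately show "F \<in> \<Union> (basic ` ?\<G>)" by blast
  qed
  have "compactin (base spec) (dom P)"
    using csectionsD(1)[OF P] compact_space_base_spec unfolding clopenin_def
    by (blast intro: closedin_compact_space)
  moreover have "\<forall>U \<in> basic ` ?\<G>. openin (base spec) U" using openin_basic by blast
  ultimately obtain \<F> where \<F>: "finite \<F>" "\<F> \<subseteq> basic ` ?\<G>" "dom P \<subseteq> \<Union>\<F>"
    using cover unfolding compactin_def by meson
  have fin: "\<exists>a \<in> ?\<G>. \<Union> (basic ` \<H>) \<subseteq> basic a" if "finite \<H>" "\<H> \<subseteq> ?\<G>" for \<H>
    using that
  proof (induction \<H> rule: finite_induct)
    case empty
    have "\<zero> \<in> ?\<G>" by (simp add: zero_closed map_le_def dom_elt_section basic_zero)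
    then show ?case by auto
  next
    case (insert d \<H>)
    then obtain a where a: "a \<in> ?\<G>" "\<Union> (basic ` \<H>) \<subseteq> basic a" by auto
    have d: "d \<in> ?\<G>" using insert.prems by blast
    show ?case using join[OF a(1) d] a d basic_ops(2)[of a d] by (intro bexI[of _ "a \<squnion> d"]) auto
  qed
  obtain \<H> where \<H>: "finite \<H>" "\<H> \<subseteq> ?\<G>" "dom P \<subseteq> \<Union> (basic ` \<H>)"
    using finite_subset_image[OF \<F>(1,2)] \<F>(3) by auto
  obtain a where "a \<in> ?\<G>" "\<Union> (basic ` \<H>) \<subseteq> basic a" using fin[OF \<H>(1,2)] ..
  then have a: "a \<in> ?\<G>" "dom P \<subseteq> basic a" using subset_trans[OF \<H>(3)] by simp_all
  have "P = elt_section a"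
  proof
    fix F show "P F = elt_section a F"
    proof (cases "F \<in> basic a")
      case True then show ?thesis using a(1) by (auto simp: map_le_def dom_elt_section)
    next
      case False
      then have "F \<notin> dom P" using a(2) by blast
      then show ?thesis using False by (simp add: elt_section_def domIff)
    qed
  qed
  with a show ?thesis by blast
qed

lemma csections_spec: "csections spec = elt_section ` carrier S"
  using csection_eq_elt_section elt_section_csections by blast

text \<open>All sections over clopen sets come from elements, so their images are sets
  \<open>germs a\<close>, and \<open>germs_cap\<close> shows that the equalizer is the basic set of
  the intersection.\<close>

lemma clopen_equalizers_spec: "clopen_equalizers spec"
  unfolding clopen_equalizers_def
proof (intro allI impI ballI)
  fix U V P Q
  assume U: "clopenin (base spec) U" and V: "clopenin (base spec) V"
    and P: "P \<in> section_images spec U" and Q: "Q \<in> section_images spec V"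
  have img: "\<exists>a \<in> carrier S. P = germs a" if U: "clopenin (base spec) U" and P: "P \<in> section_images spec U" for U P
  proof -
    obtain s where s: "section_over spec U s" "P = s ` U" using P by (auto simp: section_images_def)
    obtain a where a: "a \<in> carrier S" "(\<lambda>x. if x \<in> U then Some (s x) else None) = elt_section a"
      using csection_eq_elt_section[OF section_over_csections[OF U s(1)]] by blast
    have "P = ran (\<lambda>x. if x \<in> U then Some (s x) else None)" by (auto simp: s(2) ran_def)
    also have "\<dots> = germs a" unfolding a(2) by (auto simp: ran_def elt_section_def germs_def split: if_splits)
    finally show ?thesis using a(1) by blast
  qed
  obtain a b where ab: "a \<in> carrier S" "P = germs a" "b \<in> carrier S" "Q = germs b"
    using img[OF U P] img[OF V Q] by blast
  then have "P \<inter> Q = (\<lambda>F. germ F (cap S a b)) ` basic (cap S a b)"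
    using germs_cap[of a b] by (simp add: germs_def)
  then show "\<exists>W. clopenin (base spec) W \<and> P \<inter> Q \<in> section_images spec W"
    using ab section_over_germ[OF cap_closed[of a b]] clopenin_basic[OF cap_closed[of a b]]
    by (auto simp: section_images_def)
qed

lemma open_base_total_spec: "open_base (total spec) (germs ` carrier S)"
  using openin_germs unfolding open_base_def openin_total_spec by blast

end

lemma BLSBIA_spectral:
  assumes "S \<in> Obj (BLSBIA :: ('u skew_algebra, 'u \<Rightarrow> 'u) category)"
  shows "spectral_algebra S"
  using BLSBIA_ObjD(1)[OF assms] assms by (simp add: spectral_algebra_def spectral_algebra_axioms_def BLSBIA_def)

text \<open>The isomorphism runs against \<open>f\<close> because essential surjectivity asks for
  one from the algebra of sections to \<open>S\<close>, whereas the representation map starts at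
  \<open>S\<close>.\<close>

lemma isomorphism_inv_BLSBIA:
  fixes S T :: "'u skew_algebra"
  assumes S: "S \<in> Obj BLSBIA" and T: "T \<in> Obj BLSBIA"
    and f: "cap_homomorphism S T f" and bij: "bij_betw f (carrier S) (carrier T)"
  shows "isomorphism_in BLSBIA T S (restrict (inv_into (carrier S) f) (carrier T))"
proof -
  interpret S: left_handed_cap_algebra S by (rule BLSBIA_ObjD[OF S])
  interpret T: left_handed_cap_algebra T by (rule BLSBIA_ObjD[OF T])
  let ?f = "restrict f (carrier S)" and ?g = "restrict (inv_into (carrier S) f) (carrier T)"
  have g: "?g y \<in> carrier S" "f (?g y) = y" if "y \<in> carrier T" for y
    using that bij by (auto simp: bij_betw_def inv_into_into f_inv_into_f)
  have gf: "?g (f x) = x" if "x \<in> carrier S" for x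
    using that bij by (auto simp: bij_betw_def)
  have fc: "f x \<in> carrier T" if "x \<in> carrier S" for x using that bij by (auto simp: bij_betw_def)
  note opsS = S.meet_closed S.join_closed S.diff_closed S.cap_closed S.zero_closed
  note opsT = T.meet_closed T.join_closed T.diff_closed T.cap_closed T.zero_closed
  have homf: "cap_homomorphism S T ?f"
    using f opsS by (auto simp: cap_homomorphism_def)
  have homg: "cap_homomorphism T S ?g"
    unfolding cap_homomorphism_def
  proof (intro conjI ballI)
    have eq: "?g y = x" if "x \<in> carrier S" "y = f x" for x y using gf[OF that(1)] that(2) by simp
    fix x y assume "x \<in> carrier T" "y \<in> carrier T"
    then have "?g x \<in> carrier S" "?g y \<in> carrier S" "f (?g x) = x" "f (?g y) = y" using g by auto
    then show "?g (meet T x y) = meet S (?g x) (?g y)" "?g (join T x y) = join S (?g x) (?g y)"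
      "?g (diff T x y) = diff S (?g x) (?g y)" "?g (cap T x y) = cap S (?g x) (?g y)"
      using f opsS by (intro eq; simp add: cap_homomorphism_def)+
  next
    show "?g (zero T) = zero S" using f gf[OF S.zero_closed] by (simp add: cap_homomorphism_def)
  qed (use g in auto)
  have "proper_hom S T ?f"
    unfolding proper_hom_iff[OF S.left_handed_skew_lattice_axioms T.left_handed_skew_lattice_axioms homf]
    using g T.pre_le_refl by (metis restrict_apply')
  moreover have "proper_hom T S ?g"
    unfolding proper_hom_iff[OF T.left_handed_skew_lattice_axioms S.left_handed_skew_lattice_axioms homg]
    using gf fc S.pre_le_refl by metis
  moreover have "compose (carrier T) ?f ?g = restrict (\<lambda>x. x) (carrier T)"
    using g by (auto simp: compose_def fun_eq_iff)
  moreover have "compose (carrier S) ?g ?f = restrict (\<lambda>x. x) (carrier S)"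
    using gf fc by (auto simp: compose_def fun_eq_iff)
  ultimately show ?thesis
    unfolding isomorphism_in_def using homf homg by (auto simp: BLSBIA_def intro!: exI[of _ ?f])
qed

section \<open>Essential surjectivity and the equivalence\<close>

lemma sections_functor_ess_surj:
  assumes inf: "infinite (UNIV :: 'u set)"
    and S: "S \<in> Obj (BLSBIA :: ('u skew_algebra, 'u \<Rightarrow> 'u) category)"
  shows "\<exists>A \<in> Obj ESBSE. \<exists>u. isomorphism_in (BLSBIA :: ('u skew_algebra, 'u \<Rightarrow> 'u) category)
    (onObj sections_functor A) S u"
proof -
  interpret spectral_algebra S using S by (rule BLSBIA_spectral)
  \<comment> \<open>The base of the total space is indexed by the elements of \<open>S\<close>, so
    the spectrum is as small as \<open>S\<close>, however many prime filters there are.\<close>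
  have "germs ` carrier S \<prec> (UNIV :: 'u set)"
    using S by (intro lesspoll_trans1[OF image_lepoll]) (simp add: BLSBIA_def small_def)
  then have spec: "spec \<in> Obj (ESBSE :: (('u set, 'u set) etale, ('u set, 'u set) etale_mor) category)"
    using etale_space_spec boolean_space_base_spec clopen_equalizers_spec open_base_total_spec
    by (auto simp: ESBSE_def small_def)
  interpret A: partial_map_family "csections spec" "section_code spec :: _ \<Rightarrow> 'u"
    using inf spec by (rule partial_map_family_section_code)
  let ?f = "\<lambda>a. section_code spec (elt_section a) :: 'u"
  have "cap_homomorphism S A.S ?f"
    unfolding cap_homomorphism_def
    by (auto simp: A.carrier_map_algebra A.zero_map_algebra A.ops_map_algebra
        elt_section_csections elt_section_ops(1-4) elt_section_ops(5)[OF zero_closed zero_closed])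
  moreover have "bij_betw ?f (carrier S) (carrier A.S)"
    unfolding bij_betw_def
  proof
    show "inj_on ?f (carrier S)"
      using elt_section_inject by (auto simp: inj_on_def A.code_eq_iff elt_section_csections)
    show "?f ` carrier S = carrier A.S"
      unfolding A.carrier_map_algebra by (simp add: csections_spec image_image)
  qed
  moreover have "A.S \<in> Obj (BLSBIA :: ('u skew_algebra, 'u \<Rightarrow> 'u) category)"
    using section_algebra_Obj[OF inf spec] by (simp add: section_algebra_def)
  ultimately have "isomorphism_in (BLSBIA :: ('u skew_algebra, 'u \<Rightarrow> 'u) category) A.S S
      (restrict (inv_into (carrier S) ?f) (carrier A.S))"
    using isomorphism_inv_BLSBIA[OF S] by blast
  then show ?thesis using spec by (auto simp: sections_functor_def section_algebra_def)
qed

theorem corollary2: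
  assumes "infinite (UNIV :: 'u set)"
  shows "equivalent_categories
           (ESBSE :: (('u set, 'u set) etale, ('u set, 'u set) etale_mor) category)
           (BLSBIA :: ('u skew_algebra, 'u \<Rightarrow> 'u) category)"
proof -
  interpret fully_faithful_ess_surj
    "ESBSE :: (('u set, 'u set) etale, ('u set, 'u set) etale_mor) category"
    "BLSBIA :: ('u skew_algebra, 'u \<Rightarrow> 'u) category" sections_functor
    by (intro fully_faithful_ess_surj.intro fully_faithful_ess_surj_axioms.intro
        functor_sections[OF assms] category_ESBSE category_BLSBIA)
      (fact sections_functor_faithful[OF assms] sections_functor_full[OF assms]
        sections_functor_ess_surj[OF assms])+
  show ?thesis by (rule equivalent)
qed

end
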